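(* Let $V$ be a complex vector space with $\dim V=k$. The space $(V^{\otimes p}\otimes V^{*\otimes q})^{\mathrm{SL}(V)}$ is nonzero if and only if $k\mid(p-q)$. In this case, identifying $V^{\otimes p}\otimes V^{*\otimes q}$ with the space of multilinear forms on $V^{*p}\oplus V^q$, a basis is given by the 1-regular $\mathrm{SL}(V)$-graphs. In particular, each basis graph contains exactly $\min\{p,q\}$ arcs and exactly $\frac{|p-q|}{k}$ hyperedges on one side, such that the hyperedge rule is satisfied, and each vertex has degree 1.
   Context: On $V^{*p}\oplus V^q\ni(v_1^*,\dots,v_p^*,v_1,\dots,v_q)$ define $f_{ij}=v_i^*(v_j)$, $\det_{I^*}=\det(v^*_{i_1},\dots,v^*_{i_k})$ for $I\in\mathcal C^p_k$, and $\det_J=\det(v_{j_1},\dots,v_{j_k})$ for $J\in\mathcal C^q_k$ (with respect to a fixed basis of $V$ and its dual basis). Here $\mathcal C^n_k$ is the set of strictly increasing sequences of length $k$ in $\{1,\dots,n\}$, ordered componentwise. An $\mathrm{SL}(V)$-graph consists of: a bipartite multigraph on vertices $1^*,\dots,p^*$ (starred side), $1,\dots,q$ (unstarred side), whose edges (arcs) join a starred vertex $i^*$ to an unstarred vertex $j$, containing no strict nesting of more than $k$ arcs (a strict nesting is a set of arcs such that for any two of them $(i^*,j),(i'^*,j')$ either $i<i'$ and $j>j'$, or $i>i'$ and $j<j'$); together with a finite chain $I_1\le\dots\le I_m$ ($m\ge0$) of hyperedges, all in $\mathcal C^p_k$ (starred side) or all in $\mathcal C^q_k$ (unstarred side), each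 regarded as an edge incident to the $k$ vertices it lists, satisfying the hyperedge rule below. The graph represents the product of $f_{ij}$ over its arcs $(i^*,j)$ and of $\det_{I^*}$ (starred) or $\det_J$ (unstarred) over its hyperedges. It is 1-regular if every vertex has degree 1, where the degree counts incident arcs and hyperedges. Let $M$ be the multiset of arcs, written as pairs $(i,j)$. Let $C_1^*(M)$ be the sub-multiset of those $(i,j)\in M$ for which there is no $(i',j')\in M$ with $i'<i$ and $j'>j$, and $C^*_{\ell+1}=C^*_1(M\setminus\bigcup_{s\le\ell}C^*_s)$. Let $C_1(M)$ be the sub-multiset of those $(i,j)\in M$ for which there is no $(i',j')\in M$ with $i'>i$ and $j'<j$, and $C_{\ell+1}=C_1(M\setminus\bigcup_{s\le\ell}C_s)$. Hyperedge rule: if the hyperedges are starred and the topmost (largest) one is $(i_1<\dots<i_k)$, then $i_\ell\le i$ for every $(i,j)\in C^*_\ell$; if they are unstarred and the topmost one is $(j_1<\dots<j_k)$, then $j_\ell\le j$ for every $(i,j)\in C_\ell$; vacuous for indices $\ell$ for which $C^*_\ell$ (resp. $C_\ell$) does not exist. *)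

theory Defs
  imports
    "Jordan_Normal_Form.Determinant"
    "HOL-Library.FuncSet"
    "HOL-Library.Function_Algebras"
    "HOL-Library.Multiset"
begin

section \<open>Multilinear forms and tensors\<close>

text \<open>
  A complex vector space \<open>V\<close> is given by its scalar multiplication \<open>scale\<close> on a whole type.
\<close>

definition covectors :: "(complex \<Rightarrow> 'v::ab_group_add \<Rightarrow> 'v) \<Rightarrow> ('v \<Rightarrow> complex) set" where
  "covectors scale = {\<phi>. Vector_Spaces.linear scale (*) \<phi>}"

definition ordered_basis ::
  "(complex \<Rightarrow> 'v::ab_group_add \<Rightarrow> 'v) \<Rightarrow> (nat \<Rightarrow> 'v) \<Rightarrow> nat \<Rightarrow> bool" where
  "ordered_basis scale e k \<longleftrightarrow>
     inj_on e {..<k} \<and> \<not> module.dependent scale (e ` {..<k}) \<and>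
     module.span scale (e ` {..<k}) = UNIV"

definition dual_basis ::
  "(complex \<Rightarrow> 'v::ab_group_add \<Rightarrow> 'v) \<Rightarrow> (nat \<Rightarrow> 'v) \<Rightarrow> nat \<Rightarrow> nat \<Rightarrow> 'v \<Rightarrow> complex" where
  "dual_basis scale e k r v = module.representation scale (e ` {..<k}) v (e r)"

text \<open>
  The points of the direct sum of \<open>p\<close> copies of the dual of \<open>V\<close> and \<open>q\<close> copies of \<open>V\<close>,
  with slots numbered from 1.
\<close>

definition points ::
  "(complex \<Rightarrow> 'v::ab_group_add \<Rightarrow> 'v) \<Rightarrow> nat \<Rightarrow> nat \<Rightarrow> ((nat \<Rightarrow> 'v \<Rightarrow> complex) \<times> (nat \<Rightarrow> 'v)) set" where
  "points scale p q = (\<Pi>\<^sub>E i\<in>{1..p}. covectors scale) \<times> (\<Pi>\<^sub>E j\<in>{1..q}. UNIV)"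

text \<open>
  A form is a total function; it is normalised to be 0 off \<open>points\<close>, so that equality of
  functions is equality of forms.
\<close>

type_synonym 'v form = "(nat \<Rightarrow> 'v \<Rightarrow> complex) \<times> (nat \<Rightarrow> 'v) \<Rightarrow> complex"

definition form_scale :: "complex \<Rightarrow> 'v form \<Rightarrow> 'v form" where
  "form_scale c F = (\<lambda>z. c * F z)"

definition multilinear_forms ::
  "(complex \<Rightarrow> 'v::ab_group_add \<Rightarrow> 'v) \<Rightarrow> nat \<Rightarrow> nat \<Rightarrow> 'v form set" where
  "multilinear_forms scale p q = {F.
     (\<forall>z. z \<notin> points scale p q \<longrightarrow> F z = 0) \<and>
     (\<forall>(x, w) \<in> points scale p q.
        (\<forall>i\<in>{1..p}. \<forall>\<phi>\<in>covectors scale. \<forall>\<psi>\<in>covectors scale.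
           F (x(i := \<phi> + \<psi>), w) = F (x(i := \<phi>), w) + F (x(i := \<psi>), w)) \<and>
        (\<forall>i\<in>{1..p}. \<forall>\<phi>\<in>covectors scale. \<forall>c.
           F (x(i := (\<lambda>v. c * \<phi> v)), w) = c * F (x(i := \<phi>), w)) \<and>
        (\<forall>j\<in>{1..q}. Vector_Spaces.linear scale (*) (\<lambda>v. F (x, w(j := v)))))}"

text \<open>
  The tensor product of \<open>p\<close> copies of \<open>V\<close> and \<open>q\<close> copies of its dual, realised as the span of
  the decomposable tensors, where a decomposable tensor is identified with the multilinear form
  it defines. Lemma \<open>tensor_space_eq_multilinear_forms\<close> below shows that in finite dimension
  this is the space of all multilinear forms.
\<close>

definition pure_tensor ::
  "(complex \<Rightarrow> 'v::ab_group_add \<Rightarrow> 'v) \<Rightarrow> nat \<Rightarrow> nat \<Rightarrow>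
   (nat \<Rightarrow> 'v) \<Rightarrow> (nat \<Rightarrow> 'v \<Rightarrow> complex) \<Rightarrow> 'v form" where
  "pure_tensor scale p q v \<phi> = (\<lambda>(x, w).
     if (x, w) \<in> points scale p q
     then (\<Prod>i\<in>{1..p}. x i (v i)) * (\<Prod>j\<in>{1..q}. \<phi> j (w j)) else 0)"

definition tensor_space ::
  "(complex \<Rightarrow> 'v::ab_group_add \<Rightarrow> 'v) \<Rightarrow> nat \<Rightarrow> nat \<Rightarrow> 'v form set" where
  "tensor_space scale p q = module.span form_scale
     {pure_tensor scale p q v \<phi> | v \<phi>. \<forall>j\<in>{1..q}. \<phi> j \<in> covectors scale}"


section \<open>The action of the special linear group\<close>

definition special_linear ::
  "(complex \<Rightarrow> 'v::ab_group_add \<Rightarrow> 'v) \<Rightarrow> (nat \<Rightarrow> 'v) \<Rightarrow> nat \<Rightarrow> ('v \<Rightarrow> 'v) set" where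
  "special_linear scale e k = {g. Vector_Spaces.linear scale scale g \<and>
     det (mat k k (\<lambda>(r, c). dual_basis scale e k r (g (e c)))) = 1}"

text \<open>
  Lemma \<open>tensor_action_pure_tensor\<close> below shows that this is the usual action on decomposable
  tensors.
\<close>

definition tensor_action ::
  "(complex \<Rightarrow> 'v::ab_group_add \<Rightarrow> 'v) \<Rightarrow> nat \<Rightarrow> nat \<Rightarrow> ('v \<Rightarrow> 'v) \<Rightarrow> 'v form \<Rightarrow> 'v form" where
  "tensor_action scale p q g F = (\<lambda>(x, w).
     if (x, w) \<in> points scale p q
     then F (restrict (\<lambda>i. x i \<circ> g) {1..p}, restrict (\<lambda>j. inv_into UNIV g (w j)) {1..q}) else 0)"

definition tensor_invariants ::
  "(complex \<Rightarrow> 'v::ab_group_add \<Rightarrow> 'v) \<Rightarrow> (nat \<Rightarrow> 'v) \<Rightarrow> nat \<Rightarrow> nat \<Rightarrow> nat \<Rightarrow> 'v form set" where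
  "tensor_invariants scale e k p q = {F \<in> tensor_space scale p q.
     \<forall>g \<in> special_linear scale e k. tensor_action scale p q g F = F}"


section \<open>Graphs\<close>

text \<open>
  The pair \<open>(i, j)\<close> is the arc joining the starred vertex \<open>i\<close> and the unstarred vertex \<open>j\<close>.
  The two lists are the chains of starred and of unstarred hyperedges in increasing order; in a
  graph at most one of them is nonempty. A hyperedge is the list of its vertices.
\<close>

datatype sl_graph = SL_Graph
  (arcs: "(nat \<times> nat) multiset")
  (star_hyperedges: "nat list list")
  (unstar_hyperedges: "nat list list")

definition hyperedges :: "nat \<Rightarrow> nat \<Rightarrow> nat list set" where
  "hyperedges n k = {I. length I = k \<and> sorted_wrt (<) I \<and> set I \<subseteq> {1..n}}"

definition hyperedge_chain :: "nat \<Rightarrow> nat \<Rightarrow> nat list list \<Rightarrow> bool" where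
  "hyperedge_chain n k Is \<longleftrightarrow> set Is \<subseteq> hyperedges n k \<and> sorted_wrt (list_all2 (\<le>)) Is"

definition strict_nesting :: "(nat \<times> nat) set \<Rightarrow> bool" where
  "strict_nesting S \<longleftrightarrow> (\<forall>(i, j)\<in>S. \<forall>(i', j')\<in>S. (i, j) \<noteq> (i', j') \<longrightarrow>
     (i < i' \<and> j > j') \<or> (i > i' \<and> j < j'))"

definition first_layer_star :: "(nat \<times> nat) multiset \<Rightarrow> (nat \<times> nat) multiset" where
  "first_layer_star M = {# (i, j) \<in># M. \<not> (\<exists>(i', j') \<in> set_mset M. i' < i \<and> j' > j) #}"

definition first_layer_unstar :: "(nat \<times> nat) multiset \<Rightarrow> (nat \<times> nat) multiset" where
  "first_layer_unstar M = {# (i, j) \<in># M. \<not> (\<exists>(i', j') \<in> set_mset M. i' > i \<and> j' < j) #}"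

text \<open>
  Layers are numbered from 0, as are list positions, so layer \<open>l\<close> is compared with entry
  \<open>I ! l\<close> of a hyperedge. The iterated function removes the first layer, so its \<open>l\<close>-th iterate
  removes the layers \<open>0, \<dots>, l - 1\<close>.
\<close>

definition layer_star :: "nat \<Rightarrow> (nat \<times> nat) multiset \<Rightarrow> (nat \<times> nat) multiset" where
  "layer_star l M = first_layer_star (((\<lambda>N. N - first_layer_star N) ^^ l) M)"

definition layer_unstar :: "nat \<Rightarrow> (nat \<times> nat) multiset \<Rightarrow> (nat \<times> nat) multiset" where
  "layer_unstar l M = first_layer_unstar (((\<lambda>N. N - first_layer_unstar N) ^^ l) M)"

definition hyperedge_rule :: "nat \<Rightarrow> sl_graph \<Rightarrow> bool" where
  "hyperedge_rule k G \<longleftrightarrow>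
     (star_hyperedges G \<noteq> [] \<longrightarrow>
        (\<forall>l<k. \<forall>(i, j) \<in> set_mset (layer_star l (arcs G)). last (star_hyperedges G) ! l \<le> i)) \<and>
     (unstar_hyperedges G \<noteq> [] \<longrightarrow>
        (\<forall>l<k. \<forall>(i, j) \<in> set_mset (layer_unstar l (arcs G)). last (unstar_hyperedges G) ! l \<le> j))"

definition is_sl_graph :: "nat \<Rightarrow> nat \<Rightarrow> nat \<Rightarrow> sl_graph \<Rightarrow> bool" where
  "is_sl_graph k p q G \<longleftrightarrow>
     set_mset (arcs G) \<subseteq> {1..p} \<times> {1..q} \<and>
     (\<forall>S \<subseteq> set_mset (arcs G). strict_nesting S \<longrightarrow> card S \<le> k) \<and>
     hyperedge_chain p k (star_hyperedges G) \<and>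
     hyperedge_chain q k (unstar_hyperedges G) \<and>
     (star_hyperedges G = [] \<or> unstar_hyperedges G = []) \<and>
     hyperedge_rule k G"

definition degree_star :: "sl_graph \<Rightarrow> nat \<Rightarrow> nat" where
  "degree_star G i =
     size {# a \<in># arcs G. fst a = i #} + length (filter (\<lambda>I. i \<in> set I) (star_hyperedges G))"

definition degree_unstar :: "sl_graph \<Rightarrow> nat \<Rightarrow> nat" where
  "degree_unstar G j =
     size {# a \<in># arcs G. snd a = j #} + length (filter (\<lambda>J. j \<in> set J) (unstar_hyperedges G))"

definition one_regular :: "nat \<Rightarrow> nat \<Rightarrow> sl_graph \<Rightarrow> bool" where
  "one_regular p q G \<longleftrightarrow>
     (\<forall>i\<in>{1..p}. degree_star G i = 1) \<and> (\<forall>j\<in>{1..q}. degree_unstar G j = 1)"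

definition one_regular_sl_graphs :: "nat \<Rightarrow> nat \<Rightarrow> nat \<Rightarrow> sl_graph set" where
  "one_regular_sl_graphs k p q = {G. is_sl_graph k p q G \<and> one_regular p q G}"

definition det_star :: "(nat \<Rightarrow> 'v) \<Rightarrow> nat \<Rightarrow> (nat \<Rightarrow> 'v \<Rightarrow> complex) \<Rightarrow> nat list \<Rightarrow> complex" where
  "det_star e k x I = det (mat k k (\<lambda>(r, c). x (I ! c) (e r)))"

definition det_unstar ::
  "(complex \<Rightarrow> 'v::ab_group_add \<Rightarrow> 'v) \<Rightarrow> (nat \<Rightarrow> 'v) \<Rightarrow> nat \<Rightarrow> (nat \<Rightarrow> 'v) \<Rightarrow> nat list \<Rightarrow> complex" where
  "det_unstar scale e k w J = det (mat k k (\<lambda>(r, c). dual_basis scale e k r (w (J ! c))))"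

definition graph_form ::
  "(complex \<Rightarrow> 'v::ab_group_add \<Rightarrow> 'v) \<Rightarrow> (nat \<Rightarrow> 'v) \<Rightarrow> nat \<Rightarrow> nat \<Rightarrow> nat \<Rightarrow> sl_graph \<Rightarrow> 'v form" where
  "graph_form scale e k p q G = (\<lambda>(x, w).
     if (x, w) \<in> points scale p q
     then (\<Prod>(i, j) \<in># arcs G. x i (w j)) *
          (\<Prod>I \<leftarrow> star_hyperedges G. det_star e k x I) *
          (\<Prod>J \<leftarrow> unstar_hyperedges G. det_unstar scale e k w J)
     else 0)"


section \<open>Justification of the model of the tensor product\<close>

lemma tensor_action_pure_tensor:
  assumes "Vector_Spaces.linear scale scale g"
  shows "tensor_action scale p q g (pure_tensor scale p q v \<phi>) =
    pure_tensor scale p q (g \<circ> v) (\<lambda>j. \<phi> j \<circ> inv_into UNIV g)"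
proof (rule ext, clarify)
  fix x w
  show "tensor_action scale p q g (pure_tensor scale p q v \<phi>) (x, w) =
    pure_tensor scale p q (g \<circ> v) (\<lambda>j. \<phi> j \<circ> inv_into UNIV g) (x, w)"
  proof (cases "(x, w) \<in> points scale p q")
    case True
    have "x i \<circ> g \<in> covectors scale" if "i \<in> {1..p}" for i
    proof -
      have "Vector_Spaces.linear scale (*) (x i)"
        using True that by (auto simp: points_def covectors_def PiE_iff)
      with assms show ?thesis
        unfolding covectors_def by (auto intro: Vector_Spaces.linear_compose)
    qed
    then have "(restrict (\<lambda>i. x i \<circ> g) {1..p}, restrict (\<lambda>j. inv_into UNIV g (w j)) {1..q}) \<in> points scale p q"
      by (auto simp: points_def)
    with True show ?thesis
      by (simp add: tensor_action_def pure_tensor_def)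
  qed (simp add: tensor_action_def pure_tensor_def)
qed

lemma form_space: "vector_space (form_scale :: complex \<Rightarrow> 'v form \<Rightarrow> 'v form)"
  by unfold_locales (auto simp: form_scale_def fun_eq_iff algebra_simps)

lemma linear_mult_iff:
  assumes "vector_space scale"
  shows "Vector_Spaces.linear scale (*) (f :: _ \<Rightarrow> complex) \<longleftrightarrow>
    (\<forall>a b. f (a + b) = f a + f b) \<and> (\<forall>c a. f (scale c a) = c * f a)"
proof -
  have "vector_space ((*) :: complex \<Rightarrow> complex \<Rightarrow> complex)"
    by unfold_locales (auto simp: algebra_simps)
  with assms show ?thesis
    by (auto simp: Vector_Spaces.linear_def module_hom_def module_hom_axioms_def
        module_iff_vector_space)
qed

lemma points_upd_star:
  assumes "(x, w) \<in> points scale p q" "i \<in> {1..p}" "\<phi> \<in> covectors scale"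
  shows "(x(i := \<phi>), w) \<in> points scale p q"
  using assms unfolding points_def by (auto simp: PiE_iff extensional_def)

lemma points_upd_unstar:
  assumes "(x, w) \<in> points scale p q" "j \<in> {1..q}"
  shows "(x, w(j := v)) \<in> points scale p q"
  using assms unfolding points_def by (auto simp: PiE_iff extensional_def)

lemma covectors_add:
  assumes "vector_space scale" "\<phi> \<in> covectors scale" "\<psi> \<in> covectors scale"
  shows "\<phi> + \<psi> \<in> covectors scale"
  using assms by (auto simp: covectors_def linear_mult_iff algebra_simps)

lemma covectors_scale:
  assumes "vector_space scale" "\<phi> \<in> covectors scale"
  shows "(\<lambda>v. c * \<phi> v) \<in> covectors scale"
  using assms by (auto simp: covectors_def linear_mult_iff algebra_simps)

lemma prod_fun_upd_split:
  fixes f :: "nat \<Rightarrow> 'b \<Rightarrow> complex"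
  assumes "i \<in> {1..p::nat}"
  shows "(\<Prod>l\<in>{1..p}. f l ((x(i := y)) l)) = f i y * (\<Prod>l\<in>{1..p} - {i}. f l (x l))"
proof -
  have "(\<Prod>l\<in>{1..p}. f l ((x(i := y)) l)) =
      f i ((x(i := y)) i) * (\<Prod>l\<in>{1..p} - {i}. f l ((x(i := y)) l))"
    using assms by (subst prod.remove[of _ i]) auto
  also have "(\<Prod>l\<in>{1..p} - {i}. f l ((x(i := y)) l)) = (\<Prod>l\<in>{1..p} - {i}. f l (x l))"
    by (rule prod.cong) auto
  finally show ?thesis by simp
qed

lemma pure_tensor_multilinear:
  assumes V: "vector_space scale" and \<phi>: "\<forall>j\<in>{1..q}. \<phi> j \<in> covectors scale"
  shows "pure_tensor scale p q v \<phi> \<in> multilinear_forms scale p q"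
proof -
  let ?P = "pure_tensor scale p q v \<phi>"
  have star: "?P (x(i := y), w) =
      y (v i) * (\<Prod>l\<in>{1..p} - {i}. x l (v l)) * (\<Prod>j\<in>{1..q}. \<phi> j (w j))"
    if "(x, w) \<in> points scale p q" "i \<in> {1..p}" "y \<in> covectors scale" for x w i y
    using points_upd_star[OF that] prod_fun_upd_split[OF that(2), of "\<lambda>l h. h (v l)" x y]
    by (simp add: pure_tensor_def)
  have unstar: "?P (x, w(j := y)) =
      (\<Prod>i\<in>{1..p}. x i (v i)) * (\<phi> j y * (\<Prod>l\<in>{1..q} - {j}. \<phi> l (w l)))"
    if "(x, w) \<in> points scale p q" "j \<in> {1..q}" for x w j y
    using points_upd_unstar[OF that] prod_fun_upd_split[OF that(2), of \<phi> w y]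
    by (simp add: pure_tensor_def)
  have "Vector_Spaces.linear scale (*) (\<lambda>y. ?P (x, w(j := y)))"
    if "(x, w) \<in> points scale p q" "j \<in> {1..q}" for x w j
    using \<phi> that(2) unfolding unstar[OF that] linear_mult_iff[OF V]
    by (auto simp: covectors_def linear_mult_iff[OF V] algebra_simps)
  moreover have "?P z = 0" if "z \<notin> points scale p q" for z
    using that by (cases z) (auto simp: pure_tensor_def)
  ultimately show ?thesis
    unfolding multilinear_forms_def
    by (auto simp: star covectors_add[OF V] covectors_scale[OF V] algebra_simps
        simp del: fun_upd_apply)
qed

lemma subspace_multilinear_forms:
  assumes V: "vector_space scale"
  shows "module.subspace form_scale (multilinear_forms scale p q)"
proof -
  interpret F: vector_space "form_scale :: complex \<Rightarrow> 'a form \<Rightarrow> 'a form" by (rule form_space)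
  show ?thesis
    unfolding F.subspace_def multilinear_forms_def linear_mult_iff[OF V]
    by (auto simp: form_scale_def algebra_simps split_beta)
qed

lemma linear_sum_scale:
  assumes "vector_space scale" "Vector_Spaces.linear scale (*) (f :: _ \<Rightarrow> complex)"
  shows "f (\<Sum>r\<in>A. scale (c r) (u r)) = (\<Sum>r\<in>A. c r * f (u r))"
proof -
  have l: "f (a + b) = f a + f b" "f (scale c a) = c * f a" for a b c
    using assms by (auto simp: linear_mult_iff)
  have "f 0 = 0" using l(1)[of 0 0] by simp
  then show ?thesis by (induction A rule: infinite_finite_induct) (auto simp: l)
qed

lemma dual_basis:
  assumes V: "vector_space scale" and B: "ordered_basis scale e k"
  shows "dual_basis scale e k r \<in> covectors scale"
    and "(\<Sum>r<k. scale (dual_basis scale e k r v) (e r)) = v"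
    and "r < k \<Longrightarrow> s < k \<Longrightarrow> dual_basis scale e k r (e s) = (if r = s then 1 else 0)"
proof -
  interpret vector_space scale by (rule V)
  from B have inj: "inj_on e {..<k}" and ind: "independent (e ` {..<k})"
    and sp: "span (e ` {..<k}) = UNIV"
    by (auto simp: ordered_basis_def)
  show "dual_basis scale e k r \<in> covectors scale"
    unfolding covectors_def dual_basis_def mem_Collect_eq linear_mult_iff[OF V]
    using ind sp by (auto simp: representation_add representation_scale)
  have "(\<Sum>r<k. scale (dual_basis scale e k r v) (e r)) =
      (\<Sum>b\<in>e ` {..<k}. scale (representation (e ` {..<k}) v b) b)"
    by (simp add: sum.reindex[OF inj] dual_basis_def)
  also have "\<dots> = v"
    using ind sp by (intro sum_representation_eq) auto
  finally show "(\<Sum>r<k. scale (dual_basis scale e k r v) (e r)) = v" .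
  show "dual_basis scale e k r (e s) = (if r = s then 1 else 0)" if "r < k" "s < k"
    using that ind inj by (auto simp: dual_basis_def representation_basis inj_on_eq_iff)
qed

lemma prod_indicator:
  "finite A \<Longrightarrow> (\<Prod>i\<in>A. if P i then 1 else 0 :: complex) = (if \<forall>i\<in>A. P i then 1 else 0)"
  by (induction A rule: finite_induct) auto

lemma multilinear_eq_0:
  assumes V: "vector_space scale" and B: "ordered_basis scale e k"
    and F: "F \<in> multilinear_forms scale p q"
    and 0: "\<And>a b. a \<in> {1..p} \<rightarrow> {..<k} \<Longrightarrow> b \<in> {1..q} \<rightarrow> {..<k} \<Longrightarrow>
      F (restrict (\<lambda>i. dual_basis scale e k (a i)) {1..p}, restrict (\<lambda>j. e (b j)) {1..q}) = 0"
  shows "F = 0"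
proof -
  let ?d = "dual_basis scale e k"
  have star: "F (x(i := (\<Sum>r\<in>A. (\<lambda>v. c r * ?d r v))), w) = (\<Sum>r\<in>A. c r * F (x(i := ?d r), w))
      \<and> (\<Sum>r\<in>A. (\<lambda>v. c r * ?d r v)) \<in> covectors scale"
    if z: "(x, w) \<in> points scale p q" and i: "i \<in> {1..p}" and "finite A" for x w i A and c :: "nat \<Rightarrow> complex"
    using \<open>finite A\<close>
  proof induction
    case empty
    have 0: "(\<lambda>v. 0 :: complex) \<in> covectors scale"
      by (simp add: covectors_def linear_mult_iff[OF V])
    have "F (x(i := (\<lambda>v. c * \<phi> v)), w) = c * F (x(i := \<phi>), w)" if "\<phi> \<in> covectors scale" for c \<phi>
      using F z i that unfolding multilinear_forms_def by blast
    from this[OF 0, of 0] show ?case using 0 by (simp add: zero_fun_def fun_upd_def)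
  next
    case (insert r A)
    have c: "?d r \<in> covectors scale" "(\<lambda>v. c r * ?d r v) \<in> covectors scale"
      using dual_basis(1)[OF V B] covectors_scale[OF V] by auto
    have "F (x(i := (\<lambda>v. c r * ?d r v) + (\<Sum>r\<in>A. (\<lambda>v. c r * ?d r v))), w) =
        F (x(i := (\<lambda>v. c r * ?d r v)), w) + F (x(i := (\<Sum>r\<in>A. (\<lambda>v. c r * ?d r v))), w)"
      using F z i c insert.IH unfolding multilinear_forms_def by blast
    moreover have "F (x(i := (\<lambda>v. c r * ?d r v)), w) = c r * F (x(i := ?d r), w)"
      using F z i c(1) unfolding multilinear_forms_def by blast
    ultimately show ?case
      unfolding sum.insert[OF insert.hyps] insert.IH[THEN conjunct1]
      using covectors_add[OF V c(2) insert.IH[THEN conjunct2]] by (intro conjI) argo+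
  qed
  have expand: "(\<Sum>r<k. (\<lambda>v. \<phi> (e r) * ?d r v)) = \<phi>" if "\<phi> \<in> covectors scale" for \<phi>
  proof
    fix v
    have "\<phi> v = \<phi> (\<Sum>r<k. scale (?d r v) (e r))" by (simp only: dual_basis(2)[OF V B])
    also have "\<dots> = (\<Sum>r<k. ?d r v * \<phi> (e r))"
      using that by (intro linear_sum_scale[OF V]) (simp add: covectors_def)
    finally have "\<phi> v = (\<Sum>r<k. \<phi> (e r) * ?d r v)" by (simp add: mult.commute)
    moreover have "(\<Sum>r\<in>A. (\<lambda>v. \<phi> (e r) * ?d r v)) v = (\<Sum>r\<in>A. \<phi> (e r) * ?d r v)" for A
      by (induction A rule: infinite_finite_induct) auto
    ultimately show "(\<Sum>r<k. (\<lambda>v. \<phi> (e r) * ?d r v)) v = \<phi> v" by simp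
  qed
  have unstar: "F (x, w) = 0"
    if "A \<subseteq> {1..q}" "(x, w) \<in> points scale p q" "\<forall>i\<in>{1..p}. x i \<in> ?d ` {..<k}"
      "\<forall>j\<in>{1..q} - A. w j \<in> e ` {..<k}" for A x w
    using finite_subset[OF that(1) finite_atLeastAtMost] that
  proof (induction A arbitrary: w)
    case empty
    then have "\<forall>i\<in>{1..p}. \<exists>r. r < k \<and> x i = ?d r" "\<forall>j\<in>{1..q}. \<exists>r. r < k \<and> w j = e r"
      by auto
    from this[THEN bchoice] obtain a b where a: "\<forall>i\<in>{1..p}. a i < k \<and> x i = ?d (a i)"
      and b: "\<forall>j\<in>{1..q}. b j < k \<and> w j = e (b j)"
      by (elim exE)
    have "x = restrict (\<lambda>i. ?d (a i)) {1..p}" "w = restrict (\<lambda>j. e (b j)) {1..q}"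
      using empty.prems(2) a b
      by (auto simp: points_def fun_eq_iff restrict_def PiE_iff extensional_def)
    moreover have "F (restrict (\<lambda>i. ?d (a i)) {1..p}, restrict (\<lambda>j. e (b j)) {1..q}) = 0"
      using a b by (intro 0) auto
    ultimately show ?case by (simp only:)
  next
    case (insert j A)
    then have j: "j \<in> {1..q}" by simp
    have lin: "Vector_Spaces.linear scale (*) (\<lambda>v. F (x, w(j := v)))"
      using F insert.prems(2) j unfolding multilinear_forms_def by blast
    have z: "F (x, w(j := e r)) = 0" if "r < k" for r
    proof (rule insert.IH)
      show "(x, w(j := e r)) \<in> points scale p q"
        by (rule points_upd_unstar[OF insert.prems(2) j])
    qed (use insert.prems that in auto)
    have "F (x, w) = F (x, w(j := (\<Sum>r<k. scale (?d r (w j)) (e r))))"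
      by (simp add: dual_basis(2)[OF V B])
    also have "\<dots> = 0"
      using z by (subst linear_sum_scale[OF V lin]) auto
    finally show ?case .
  qed
  have main: "F (x, w) = 0"
    if "A \<subseteq> {1..p}" "(x, w) \<in> points scale p q" "\<forall>i\<in>{1..p} - A. x i \<in> ?d ` {..<k}" for A x w
    using finite_subset[OF that(1) finite_atLeastAtMost] that
  proof (induction A arbitrary: x)
    case empty
    then show ?case using unstar[of "{1..q}" x w] by simp
  next
    case (insert i A)
    then have i: "i \<in> {1..p}" by simp
    then have xi: "x i \<in> covectors scale"
      using insert.prems(2) by (auto simp: points_def)
    have z: "F (x(i := ?d r), w) = 0" if "r < k" for r
    proof (rule insert.IH)
      show "(x(i := ?d r), w) \<in> points scale p q"
        by (rule points_upd_star[OF insert.prems(2) i dual_basis(1)[OF V B]])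
    qed (use insert.prems that in auto)
    have "F (x, w) = F (x(i := (\<Sum>r<k. (\<lambda>v. x i (e r) * ?d r v))), w)"
      by (simp add: expand[OF xi])
    also have "\<dots> = 0"
      using star[OF insert.prems(2) i, of "{..<k}" "\<lambda>r. x i (e r)"] z by simp
    finally show ?case .
  qed
  show ?thesis
  proof
    fix z
    show "F z = 0 z"
      using main[of "{1..p}" "fst z" "snd z"] F
      by (cases z; cases "z \<in> points scale p q") (auto simp: multilinear_forms_def)
  qed
qed

lemma tensor_space_eq_multilinear_forms:
  assumes V: "vector_space scale" and B: "ordered_basis scale e k"
  shows "tensor_space scale p q = multilinear_forms scale p q"
proof
  interpret F: vector_space "form_scale :: complex \<Rightarrow> 'a form \<Rightarrow> 'a form" by (rule form_space)
  show sub: "tensor_space scale p q \<subseteq> multilinear_forms scale p q"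
    unfolding tensor_space_def
    by (intro F.span_minimal subspace_multilinear_forms V) (auto intro: pure_tensor_multilinear[OF V])
  show "multilinear_forms scale p q \<subseteq> tensor_space scale p q"
  proof
    fix F assume F: "F \<in> multilinear_forms scale p q"
    let ?d = "dual_basis scale e k"
    define J where "J = (\<Pi>\<^sub>E i\<in>{1..p}. {..<k}) \<times> (\<Pi>\<^sub>E j\<in>{1..q}. {..<k})"
    define pt where "pt = (\<lambda>(a, b). (restrict (\<lambda>i. ?d (a i)) {1..p}, restrict (\<lambda>j. e (b j)) {1..q}))"
    define P where "P = (\<lambda>(a, b). pure_tensor scale p q (\<lambda>i. e (a i)) (\<lambda>j. ?d (b j)))"
    define G where "G = (\<Sum>m\<in>J. form_scale (F (pt m)) (P m))"
    have fin: "finite J" unfolding J_def by (intro finite_cartesian_product finite_PiE) auto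
    have G: "G \<in> tensor_space scale p q"
      unfolding G_def tensor_space_def P_def
      by (intro F.span_sum F.span_scale F.span_base) (use dual_basis(1)[OF V B] in fastforce)
    have G_apply: "G z = (\<Sum>m\<in>J. F (pt m) * P m z)" for z
      unfolding G_def using fin by induction (auto simp: form_scale_def)
    have P: "P m (pt n) = (if m = n then 1 else 0)" if mn: "m \<in> J" "n \<in> J" for m n
    proof -
      obtain a b a' b' where eq: "m = (a, b)" "n = (a', b')" by (cases m, cases n)
      have "pt n \<in> points scale p q"
        by (auto simp: eq pt_def points_def dual_basis(1)[OF V B])
      then have "P m (pt n) = (\<Prod>i\<in>{1..p}. ?d (a' i) (e (a i))) * (\<Prod>j\<in>{1..q}. ?d (b j) (e (b' j)))"
        by (simp add: eq P_def pt_def pure_tensor_def)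
      also have "\<dots> = (\<Prod>i\<in>{1..p}. if a' i = a i then 1 else 0) * (\<Prod>j\<in>{1..q}. if b j = b' j then 1 else 0)"
        using mn by (intro arg_cong2[where f = "(*)"] prod.cong refl dual_basis(3)[OF V B])
          (auto simp: eq J_def)
      also have "\<dots> = (if (\<forall>i\<in>{1..p}. a' i = a i) \<and> (\<forall>j\<in>{1..q}. b j = b' j) then 1 else 0)"
        by (simp add: prod_indicator)
      also have "(\<forall>i\<in>{1..p}. a' i = a i) \<and> (\<forall>j\<in>{1..q}. b j = b' j) \<longleftrightarrow> m = n"
        using mn PiE_ext[of a "{1..p}" "\<lambda>_. {..<k}" a'] PiE_ext[of b "{1..q}" "\<lambda>_. {..<k}" b']
        unfolding eq J_def by (auto simp only: mem_Times_iff fst_conv snd_conv prod.inject)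
      finally show ?thesis .
    qed
    have "F - G = 0"
    proof (rule multilinear_eq_0[OF V B])
      show "F - G \<in> multilinear_forms scale p q"
        using F G sub by (intro F.subspace_diff subspace_multilinear_forms[OF V]) auto
      fix a b :: "nat \<Rightarrow> nat"
      assume ab: "a \<in> {1..p} \<rightarrow> {..<k}" "b \<in> {1..q} \<rightarrow> {..<k}"
      define n where "n = (restrict a {1..p}, restrict b {1..q})"
      have n: "n \<in> J" using ab by (auto simp: n_def J_def)
      have "G (pt n) = (\<Sum>m\<in>J. if m = n then F (pt m) else 0)"
        unfolding G_apply by (intro sum.cong) (auto simp: P n)
      also have "\<dots> = F (pt n)" using fin n by simp
      finally have "(F - G) (pt n) = 0" by simp
      moreover have "pt n = (restrict (\<lambda>i. ?d (a i)) {1..p}, restrict (\<lambda>j. e (b j)) {1..q})"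
        by (auto simp: pt_def n_def restrict_def fun_eq_iff)
      ultimately show "(F - G) (restrict (\<lambda>i. ?d (a i)) {1..p}, restrict (\<lambda>j. e (b j)) {1..q}) = 0"
        by simp
    qed
    then show "F \<in> tensor_space scale p q" using G by simp
  qed
qed

end

theory Submission
  imports Defs
begin

text \<open>
  Why the theorem holds. Fix the basis \<open>e\<close> of \<open>V\<close>, of size \<open>k\<close>. A multilinear form is determined by its
  values on tuples of basis vectors and dual basis vectors, that is, by a function \<open>\<Phi> a b\<close> of two words
  in the letters \<open>0, \<dots>, k - 1\<close>: the word \<open>a\<close> names the covectors in the starred slots, the word \<open>b\<close> the vectors
  in the unstarred ones. In these coordinates an arc \<open>(i, j)\<close> tests \<open>a i = b j\<close> and a hyperedge is the
  sign of the arrangement of letters on its vertices, or 0 if a letter is repeated. Everything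
  combinatorial happens on words.

  Spanning, part one (\<open>first_fundamental_theorem\<close>). Unipotent elements of the group turn invariance into
  the relations of the Lie algebra \<open>sl\<close> (\<open>invariant_unipotent\<close>: compare the linear coefficients of a
  polynomial in the parameter), and diagonal elements fix the weight (\<open>invariant_weight\<close>), which already forces
  \<open>k\<close> to divide \<open>p - q\<close>. With \<open>p - q = k m\<close> and \<open>m \<ge> 0\<close>, contracting the relations as in the Casimir element
  yields, for each starred slot \<open>l\<close>, the identity
  \<open>(\<Sum>i \<noteq> l. \<Phi> (a \<circ> (i l)) b) + (k - m) \<Phi> a b = (\<Sum>j. [a l = b j] \<sqdot> contraction of l with j)\<close>
  (\<open>casimir_identity\<close>). The right-hand side is a combination of graphs by induction, since it splits off an arc.
  It remains to see that modulo graphs there is no invariant on which the sum over transpositions acts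
  as \<open>m - k\<close> for every \<open>l\<close>. Take an invariant that alternates in \<open>t\<close> slots, with \<open>t\<close> as large as possible modulo graphs.
  Maximality gives a second identity, for antisymmetrising over one more slot, and adding
  up all identities leaves \<open>q + (m + t) (k - t)\<close> times the invariant, a nonzero multiple unless
  \<open>t = k\<close> and \<open>q = 0\<close>. If \<open>t = k\<close> and \<open>m > 0\<close>, the invariant splits off a determinant instead.

  Spanning, part two (\<open>straightening\<close>). Give each starred vertex a mark: the index of its hyperedge, or
  the number of hyperedges plus the partner of its arc. A graph violates one of the three defining conditions
  (bounded nesting, the chain condition, the hyperedge rule) only if the marks are weakly decreasing on
  some \<open>k + 1\<close> vertices (\<open>antimono_free_imp_sl_graph\<close>). Antisymmetrising over \<open>k + 1\<close> vertices gives 0, because two of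
  them carry the same letter. In this relation a permutation either keeps the marks, and then contributes
  the graph itself with coefficient 1, or it makes the sequence of marks lexicographically smaller.

  Independence (\<open>word_values_independent\<close>). Colour each arc of a graph by its layer and each hyperedge vertex
  by its position (\<open>layer_colouring\<close>). The graph has value 1 on these two words, and any other basis graph that
  does not vanish there has a smaller key in a fixed lexicographic order (\<open>graph_key_decreases\<close>). So
  the matrix of values is triangular.

  The case \<open>p < q\<close> follows by exchanging the two sides of a graph (\<open>swap_graph\<close>).
\<close>

section \<open>Words and determinants\<close>

definition words :: "nat \<Rightarrow> (nat \<Rightarrow> nat) set" where
  "words k = {a. \<forall>i. a i < k}"

text \<open>
  The determinant of the dual basis covectors named by \<open>a\<close> in the slots \<open>I\<close>, and equally of the basis vectors named
  by \<open>a\<close>, since both have the same coordinate columns.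
\<close>

definition word_det :: "nat \<Rightarrow> (nat \<Rightarrow> nat) \<Rightarrow> nat list \<Rightarrow> complex" where
  "word_det k a I = det (mat k k (\<lambda>(r, c). if a (I ! c) = r then 1 else 0))"

definition alternating :: "nat \<Rightarrow> nat set \<Rightarrow> ((nat \<Rightarrow> nat) \<Rightarrow> complex) \<Rightarrow> bool" where
  "alternating k K f \<longleftrightarrow> (\<forall>a\<in>words k. \<forall>x\<in>K. \<forall>y\<in>K. x \<noteq> y \<longrightarrow> f (a \<circ> transpose x y) = - f a)"

lemma words_comp: "a \<in> words k \<Longrightarrow> a \<circ> \<tau> \<in> words k"
  by (simp add: words_def)

lemma words_upd: "a \<in> words k \<Longrightarrow> r < k \<Longrightarrow> a(i := r) \<in> words k"
  by (simp add: words_def)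

lemma comp_transpose_same: "a x = a y \<Longrightarrow> a \<circ> transpose x y = a"
  by (auto simp: fun_eq_iff transpose_def)

lemma alternatingD:
  "alternating k K f \<Longrightarrow> a \<in> words k \<Longrightarrow> x \<in> K \<Longrightarrow> y \<in> K \<Longrightarrow> x \<noteq> y \<Longrightarrow> f (a \<circ> transpose x y) = - f a"
  unfolding alternating_def by blast

lemma alternating_eq_0:
  assumes "alternating k K f" "a \<in> words k" "x \<in> K" "y \<in> K" "x \<noteq> y" "a x = a y"
  shows "f a = 0"
  using alternatingD[OF assms(1-5)] comp_transpose_same[of a x y, OF assms(6)] by simp

text \<open>
  Only \<open>k\<close> letters are available, so some letter occurs twice on \<open>K\<close>, and exchanging the two occurrences both
  fixes the word and negates the value.
\<close>

lemma alternating_eq_0_card: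
  assumes f: "alternating k K f" and a: "a \<in> words k" and K: "finite K" "card K > k"
  shows "f a = 0"
proof -
  have "\<not> inj_on a K"
  proof
    assume "inj_on a K"
    then have "card K \<le> card {..<k}"
      using a by (intro card_inj_on_le[of a]) (auto simp: words_def)
    with K show False by simp
  qed
  then show ?thesis unfolding inj_on_def using alternating_eq_0[OF f a] by blast
qed

lemma word_det_alternating:
  assumes I: "distinct I" "length I = k"
  shows "alternating k (set I) (\<lambda>a. word_det k a I)"
  unfolding alternating_def
proof (intro ballI impI)
  fix a x y assume xy: "x \<in> set I" "y \<in> set I" "x \<noteq> y"
  obtain c d where cd: "c < k" "d < k" "I ! c = x" "I ! d = y"
    using xy I by (metis in_set_conv_nth)
  have ne: "c \<noteq> d" using cd xy by auto
  have eq: "I ! i = x \<longleftrightarrow> i = c" "I ! i = y \<longleftrightarrow> i = d" if "i < k" for i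
    using cd that I by (auto simp: nth_eq_iff_index_eq)
  let ?A = "mat k k (\<lambda>(r, c). if a (I ! c) = r then 1 else 0 :: complex)"
  have "mat k k (\<lambda>(r, c). if (a \<circ> transpose x y) (I ! c) = r then 1 else 0) = swapcols c d ?A"
    by (rule eq_matI) (use cd ne eq in \<open>auto simp: transpose_def\<close>)
  then show "word_det k (a \<circ> transpose x y) I = - word_det k a I"
    unfolding word_det_def using det_swapcols[OF cd(1,2) ne, of ?A] by simp
qed

lemma word_det_id:
  assumes "\<And>c. c < k \<Longrightarrow> a (I ! c) = c"
  shows "word_det k a I = 1"
proof -
  have "mat k k (\<lambda>(r, c). if a (I ! c) = r then 1 else 0 :: complex) = 1\<^sub>m k"
    by (rule eq_matI) (use assms in auto)
  then show ?thesis unfolding word_det_def by simp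
qed

lemma word_det_nonzero_inj:
  assumes I: "distinct I" "length I = k" and a: "a \<in> words k" and "word_det k a I \<noteq> 0"
  shows "inj_on a (set I)"
  using assms alternating_eq_0[OF word_det_alternating[OF I] a] unfolding inj_on_def by blast

lemma word_det_cong: "(\<And>i. i \<in> set I \<Longrightarrow> a i = a' i) \<Longrightarrow> length I = k \<Longrightarrow> word_det k a I = word_det k a' I"
  unfolding word_det_def by (rule arg_cong[of _ _ det]) (auto intro!: eq_matI)

lemma word_det_map: "length I = k \<Longrightarrow> word_det k a (map \<tau> I) = word_det k (a \<circ> \<tau>) I"
  unfolding word_det_def by (rule arg_cong[of _ _ det]) (auto intro!: eq_matI)

text \<open>
  The letters \<open>0, 1, \<dots>\<close> are written on the positions listed by \<open>I\<close>, in the order of the list; elsewhere the word is kept.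
\<close>

definition fill_in_order :: "nat list \<Rightarrow> (nat \<Rightarrow> nat) \<Rightarrow> nat \<Rightarrow> nat" where
  "fill_in_order I a i = (if i \<in> set I then (THE c. c < length I \<and> I ! c = i) else a i)"

lemma fill_in_order_nth:
  assumes "distinct I" "c < length I"
  shows "fill_in_order I a (I ! c) = c"
proof -
  have "(THE c'. c' < length I \<and> I ! c' = I ! c) = c"
    using assms by (intro the_equality) (auto simp: nth_eq_iff_index_eq)
  with assms show ?thesis by (simp add: fill_in_order_def)
qed

lemma fill_in_order_words:
  assumes "distinct I" "length I = k" "a \<in> words k"
  shows "fill_in_order I a \<in> words k"
  unfolding words_def
proof clarify
  fix i show "fill_in_order I a i < k"
  proof (cases "i \<in> set I")
    case True
    then obtain c where "c < length I" "I ! c = i" by (auto simp: in_set_conv_nth)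
    then show ?thesis using fill_in_order_nth[of I c a] assms by auto
  qed (use assms in \<open>simp add: fill_in_order_def words_def\<close>)
qed

text \<open>
  Up to a factor, the determinant is the only alternating function of \<open>k\<close> letters from \<open>k\<close>. Two equal letters make
  both sides vanish; otherwise transpositions carry the letters to their places one at a time, and each of
  them changes the sign on both sides.
\<close>

lemma alternating_eq_word_det:
  assumes I: "distinct I" "length I = k" and f: "alternating k (set I) f" and a: "a \<in> words k"
  shows "f a = word_det k a I * f (fill_in_order I a)"
  using a
proof (induction "card {c. c < k \<and> a (I ! c) \<noteq> c}" arbitrary: a rule: less_induct)
  case less
  note D = word_det_alternating[OF I]
  show ?case
  proof (cases "\<exists>c<k. a (I ! c) \<noteq> c")
    case False
    then have *: "a (I ! c) = c" if "c < k" for c using that by blast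
    have "fill_in_order I a i = a i" for i
    proof (cases "i \<in> set I")
      case True
      then obtain c where "c < k" "I ! c = i" using I by (auto simp: in_set_conv_nth)
      then show ?thesis using fill_in_order_nth[of I c a] * I by auto
    qed (simp add: fill_in_order_def)
    then have "fill_in_order I a = a" by blast
    then show ?thesis using word_det_id[of k a I] * by simp
  next
    case True
    then obtain c where c: "c < k" "a (I ! c) \<noteq> c" by blast
    define c' where "c' = a (I ! c)"
    have c': "c' < k" "c' \<noteq> c" using c less.prems by (auto simp: c'_def words_def)
    let ?x = "I ! c" and ?y = "I ! c'"
    have xy: "?x \<in> set I" "?y \<in> set I" "?x \<noteq> ?y"
      using c c' I by (auto simp: nth_eq_iff_index_eq)
    show ?thesis
    proof (cases "a ?y = c'")
      case True
      then have "a ?x = a ?y" by (simp add: c'_def)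
      then show ?thesis
        using alternating_eq_0[OF f less.prems xy] alternating_eq_0[OF D less.prems xy] by simp
    next
      case False
      let ?a = "a \<circ> transpose ?x ?y"
      have w: "?a \<in> words k" by (rule words_comp[OF less.prems])
      have nth: "?a (I ! d) = (if d = c then a ?y else if d = c' then c' else a (I ! d))" if "d < k" for d
        using that c c' I by (auto simp: transpose_def c'_def nth_eq_iff_index_eq)
      have "{d. d < k \<and> ?a (I ! d) \<noteq> d} \<subset> {d. d < k \<and> a (I ! d) \<noteq> d}"
      proof
        show "{d. d < k \<and> ?a (I ! d) \<noteq> d} \<subseteq> {d. d < k \<and> a (I ! d) \<noteq> d}"
          using c nth by (auto split: if_splits)
        have "c' \<notin> {d. d < k \<and> ?a (I ! d) \<noteq> d}" using nth[of c'] c' by simp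
        then show "{d. d < k \<and> ?a (I ! d) \<noteq> d} \<noteq> {d. d < k \<and> a (I ! d) \<noteq> d}"
          using c' False by blast
      qed
      then have "card {d. d < k \<and> ?a (I ! d) \<noteq> d} < card {d. d < k \<and> a (I ! d) \<noteq> d}"
        by (intro psubset_card_mono) auto
      from less.hyps[OF this w]
      have "f ?a = word_det k ?a I * f (fill_in_order I ?a)" .
      moreover have "fill_in_order I ?a = fill_in_order I a"
        using xy by (auto simp: fill_in_order_def fun_eq_iff transpose_def)
      ultimately show ?thesis
        using alternatingD[OF f less.prems xy] alternatingD[OF D less.prems xy] by simp
    qed
  qed
qed


section \<open>Linear combinations of graphs as functions of words\<close>

definition word_value :: "nat \<Rightarrow> sl_graph \<Rightarrow> (nat \<Rightarrow> nat) \<Rightarrow> (nat \<Rightarrow> nat) \<Rightarrow> complex" where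
  "word_value k G a b =
     (\<Prod>(i, j) \<in># arcs G. if a i = b j then 1 else 0) *
     (\<Prod>I \<leftarrow> star_hyperedges G. word_det k a I) *
     (\<Prod>J \<leftarrow> unstar_hyperedges G. word_det k b J)"

text \<open>
  Functions are only looked at on \<open>words k\<close>, and values elsewhere are arbitrary. The inductive form builds this
  in, so that no quotient and no finite support has to be carried along.
\<close>

inductive word_span ::
  "nat \<Rightarrow> sl_graph set \<Rightarrow> ((nat \<Rightarrow> nat) \<Rightarrow> (nat \<Rightarrow> nat) \<Rightarrow> complex) \<Rightarrow> bool" for k \<Gamma> where
  zero: "(\<And>a b. a \<in> words k \<Longrightarrow> b \<in> words k \<Longrightarrow> \<Phi> a b = 0) \<Longrightarrow> word_span k \<Gamma> \<Phi>"
| step: "word_span k \<Gamma> \<Phi> \<Longrightarrow> G \<in> \<Gamma> \<Longrightarrow>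
    (\<And>a b. a \<in> words k \<Longrightarrow> b \<in> words k \<Longrightarrow> \<Psi> a b = \<Phi> a b + c * word_value k G a b) \<Longrightarrow>
    word_span k \<Gamma> \<Psi>"

lemma word_span_cong:
  assumes "word_span k \<Gamma> \<Phi>" "\<And>a b. a \<in> words k \<Longrightarrow> b \<in> words k \<Longrightarrow> \<Psi> a b = \<Phi> a b"
  shows "word_span k \<Gamma> \<Psi>"
  using assms
proof (induction arbitrary: \<Psi>)
  case (zero \<Phi>)
  then show ?case by (intro word_span.zero) simp
next
  case (step \<Phi> G \<Phi>' c)
  then show ?case by (intro word_span.step[OF step.hyps(1,2), of \<Psi> c]) simp
qed

lemma word_span_add:
  assumes "word_span k \<Gamma> \<Phi>" "word_span k \<Gamma> \<Psi>"
  shows "word_span k \<Gamma> (\<lambda>a b. \<Phi> a b + \<Psi> a b)"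
  using assms
proof induction
  case (zero \<Phi>)
  then show ?case by (intro word_span_cong[OF zero.prems]) simp
next
  case (step \<Phi> G \<Phi>' c)
  show ?case
    by (rule word_span.step[OF step.IH[OF step.prems] step.hyps(2), of _ c])
      (simp add: step.hyps(3))
qed

text \<open>
  Multiplication by a fixed function is linear, so it suffices to know its effect on the generators.
\<close>

lemma word_span_times:
  assumes "word_span k \<Gamma> \<Phi>"
    and "\<And>G. G \<in> \<Gamma> \<Longrightarrow> word_span k \<Delta> (\<lambda>a b. g a b * word_value k G a b)"
  shows "word_span k \<Delta> (\<lambda>a b. g a b * \<Phi> a b)"
proof -
  have scale: "word_span k \<Delta> (\<lambda>a b. c * \<Psi> a b)" if "word_span k \<Delta> \<Psi>" for c :: complex and \<Psi>
    using that
  proof induction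
    case (zero \<Phi>)
    then show ?case by (intro word_span.zero) simp
  next
    case (step \<Phi> G \<Phi>' d)
    show ?case
      by (rule word_span.step[OF step.IH step.hyps(2), of _ "c * d"])
        (simp add: step.hyps(3) algebra_simps)
  qed
  from assms(1) show ?thesis
  proof induction
    case (zero \<Phi>)
    then show ?case by (intro word_span.zero) simp
  next
    case (step \<Phi> G \<Phi>' c)
    show ?case
      by (rule word_span_cong[OF word_span_add[OF step.IH scale[OF assms(2)[OF step.hyps(2)], of c]]])
        (simp add: step.hyps(3) algebra_simps)
  qed
qed

lemma word_span_base:
  assumes "G \<in> \<Gamma>" shows "word_span k \<Gamma> (word_value k G)"
  by (rule word_span.step[OF word_span.zero[of k "\<lambda>_ _. 0"] assms, of _ 1]) simp_all

lemma word_span_scale: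
  assumes "word_span k \<Gamma> \<Phi>"
  shows "word_span k \<Gamma> (\<lambda>a b. c * \<Phi> a b)"
proof (rule word_span_times[OF assms])
  fix G assume "G \<in> \<Gamma>"
  then show "word_span k \<Gamma> (\<lambda>a b. c * word_value k G a b)"
    by (intro word_span.step[OF word_span.zero[of k "\<lambda>_ _. 0"], of G \<Gamma> _ c]) simp_all
qed

lemma word_span_sum:
  assumes "\<And>x. x \<in> X \<Longrightarrow> word_span k \<Gamma> (\<Phi> x)"
  shows "word_span k \<Gamma> (\<lambda>a b. \<Sum>x\<in>X. \<Phi> x a b)"
  using assms
proof (induction X rule: infinite_finite_induct)
  case (insert x X)
  have "word_span k \<Gamma> (\<lambda>a b. \<Phi> x a b + (\<Sum>x\<in>X. \<Phi> x a b))"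
    using insert.prems by (intro word_span_add insert.IH) auto
  then show ?case using insert.hyps by simp
qed (auto intro: word_span.zero)

lemma word_span_trans:
  assumes "word_span k \<Gamma> \<Phi>" "\<And>G. G \<in> \<Gamma> \<Longrightarrow> word_span k \<Delta> (word_value k G)"
  shows "word_span k \<Delta> \<Phi>"
proof -
  have "word_span k \<Delta> (\<lambda>a b. 1 * \<Phi> a b)"
    using assms(2) by (intro word_span_times[OF assms(1)]) simp
  then show ?thesis by simp
qed

text \<open>
  The multiset equations say that every vertex of \<open>S\<close> and of \<open>T\<close> has degree one and that there are no other vertices.
  Arcs may nest at will and hyperedges may come in any order, since straightening passes through such graphs.
\<close>

definition matching_graphs :: "nat \<Rightarrow> nat set \<Rightarrow> nat set \<Rightarrow> sl_graph set" where
  "matching_graphs k S T = {G.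
     image_mset fst (arcs G) + mset (concat (star_hyperedges G)) = mset_set S \<and>
     image_mset snd (arcs G) = mset_set T \<and>
     (\<forall>I\<in>set (star_hyperedges G). length I = k) \<and> unstar_hyperedges G = []}"

lemma word_span_times_arc:
  assumes "finite S" "finite T" "l \<in> S" "j \<in> T"
    and "word_span k (matching_graphs k (S - {l}) (T - {j})) \<Phi>"
  shows "word_span k (matching_graphs k S T) (\<lambda>a b. (if a l = b j then 1 else 0) * \<Phi> a b)"
proof (rule word_span_times[OF assms(5)])
  fix G assume G: "G \<in> matching_graphs k (S - {l}) (T - {j})"
  let ?H = "SL_Graph (add_mset (l, j) (arcs G)) (star_hyperedges G) []"
  have "?H \<in> matching_graphs k S T"
    using G assms(1-4) mset_set.remove[of S l] mset_set.remove[of T j]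
    by (simp add: matching_graphs_def)
  from word_span_base[OF this]
  show "word_span k (matching_graphs k S T) (\<lambda>a b. (if a l = b j then 1 else 0) * word_value k G a b)"
    by (rule word_span_cong) (use G in \<open>simp add: matching_graphs_def word_value_def\<close>)
qed

lemma word_span_times_hyperedge:
  assumes "finite S" "set I \<subseteq> S" "distinct I" "length I = k"
    and "word_span k (matching_graphs k (S - set I) T) \<Phi>"
  shows "word_span k (matching_graphs k S T) (\<lambda>a b. word_det k a I * \<Phi> a b)"
proof (rule word_span_times[OF assms(5)])
  fix G assume G: "G \<in> matching_graphs k (S - set I) T"
  let ?H = "SL_Graph (arcs G) (I # star_hyperedges G) []"
  have "mset_set (set I \<union> (S - set I)) = mset_set (set I) + mset_set (S - set I)"
    using assms(1) by (intro mset_set_Union) auto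
  then have "mset_set S = mset I + mset_set (S - set I)"
    using assms(2,3) by (simp add: mset_set_set Un_absorb1)
  then have "?H \<in> matching_graphs k S T"
    using G assms(4) by (simp add: matching_graphs_def ac_simps)
  from word_span_base[OF this]
  show "word_span k (matching_graphs k S T) (\<lambda>a b. word_det k a I * word_value k G a b)"
    by (rule word_span_cong) (use G in \<open>simp add: matching_graphs_def word_value_def\<close>)
qed

text \<open>
  Invariance under the Lie algebra, in coordinates. The displayed difference is the action of the matrix unit that
  turns one letter \<open>r\<close> of \<open>a\<close> into \<open>s\<close>, and dually one letter \<open>s\<close> of \<open>b\<close> into \<open>r\<close>. For \<open>r \<noteq> s\<close> the action is 0, and all
  diagonal matrix units act by the same scalar \<open>\<mu>\<close>, the power of the determinant by which the general linear
  group acts. The first conjunct says that only the letters on \<open>S\<close> and \<open>T\<close> matter.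
\<close>

definition sl_invariant ::
  "nat \<Rightarrow> complex \<Rightarrow> nat set \<Rightarrow> nat set \<Rightarrow> ((nat \<Rightarrow> nat) \<Rightarrow> (nat \<Rightarrow> nat) \<Rightarrow> complex) \<Rightarrow> bool" where
  "sl_invariant k \<mu> S T \<Phi> \<longleftrightarrow>
     (\<forall>a\<in>words k. \<forall>a'\<in>words k. \<forall>b\<in>words k. \<forall>b'\<in>words k.
        (\<forall>i\<in>S. a i = a' i) \<longrightarrow> (\<forall>j\<in>T. b j = b' j) \<longrightarrow> \<Phi> a b = \<Phi> a' b') \<and>
     (\<forall>a\<in>words k. \<forall>b\<in>words k. \<forall>r<k. \<forall>s<k.
        (\<Sum>i\<in>S. if a i = r then \<Phi> (a(i := s)) b else 0) -
        (\<Sum>j\<in>T. if b j = s then \<Phi> a (b(j := r)) else 0) = (if r = s then \<mu> * \<Phi> a b else 0))"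

lemma sl_invariant_cong:
  "sl_invariant k \<mu> S T \<Phi> \<Longrightarrow> a \<in> words k \<Longrightarrow> a' \<in> words k \<Longrightarrow> b \<in> words k \<Longrightarrow> b' \<in> words k \<Longrightarrow>
    (\<And>i. i \<in> S \<Longrightarrow> a i = a' i) \<Longrightarrow> (\<And>j. j \<in> T \<Longrightarrow> b j = b' j) \<Longrightarrow> \<Phi> a b = \<Phi> a' b'"
  unfolding sl_invariant_def by blast

lemma sl_invariantD:
  assumes "sl_invariant k \<mu> S T \<Phi>" "a \<in> words k" "b \<in> words k" "r < k" "s < k"
  shows "(\<Sum>i\<in>S. if a i = r then \<Phi> (a(i := s)) b else 0) -
     (\<Sum>j\<in>T. if b j = s then \<Phi> a (b(j := r)) else 0) = (if r = s then \<mu> * \<Phi> a b else 0)"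
  by (rule assms(1)[unfolded sl_invariant_def, THEN conjunct2, THEN bspec, OF assms(2), THEN bspec,
        OF assms(3), THEN spec, THEN mp, OF assms(4), THEN spec, THEN mp, OF assms(5)])

lemma sl_invariant_add_scale:
  assumes "sl_invariant k \<mu> S T \<Phi>" "sl_invariant k \<mu> S T \<Psi>"
  shows "sl_invariant k \<mu> S T (\<lambda>a b. \<Phi> a b + c * \<Psi> a b)"
  unfolding sl_invariant_def
proof (intro conjI ballI allI impI)
  fix a a' b b' assume *: "a \<in> words k" "a' \<in> words k" "b \<in> words k" "b' \<in> words k"
    "\<forall>i\<in>S. a i = a' i" "\<forall>j\<in>T. b j = b' j"
  show "\<Phi> a b + c * \<Psi> a b = \<Phi> a' b' + c * \<Psi> a' b'"
    using sl_invariant_cong[OF assms(1) *(1-4)] sl_invariant_cong[OF assms(2) *(1-4)] *(5,6) by simp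
next
  fix a b r s assume *: "a \<in> words k" "b \<in> words k" "r < k" "s < k"
  have 1: "(\<Sum>x\<in>X. if P x then \<Phi> (f x) (g x) + c * \<Psi> (f x) (g x) else 0) =
     (\<Sum>x\<in>X. if P x then \<Phi> (f x) (g x) else 0) + c * (\<Sum>x\<in>X. if P x then \<Psi> (f x) (g x) else 0)"
    for P f g and X :: "nat set"
    by (auto simp: sum_distrib_left sum.distrib[symmetric] intro!: sum.cong)
  show "(\<Sum>i\<in>S. if a i = r then \<Phi> (a(i := s)) b + c * \<Psi> (a(i := s)) b else 0) -
        (\<Sum>j\<in>T. if b j = s then \<Phi> a (b(j := r)) + c * \<Psi> a (b(j := r)) else 0) =
        (if r = s then \<mu> * (\<Phi> a b + c * \<Psi> a b) else 0)"
  proof -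
    have 2: "x + c * y - (x' + c * y') = d + c * d'" if "x - x' = d" "y - y' = d'" for x x' y y' d d'
      unfolding that[symmetric] by (simp add: algebra_simps)
    show ?thesis
      unfolding 1 2[OF sl_invariantD[OF assms(1) *] sl_invariantD[OF assms(2) *]]
      by (simp add: distrib_left mult.left_commute)
  qed
qed

lemma sl_invariant_sub_sum:
  assumes "sl_invariant k \<mu> S T \<Phi>" "\<And>x. x \<in> X \<Longrightarrow> sl_invariant k \<mu> S T (\<Psi> x)"
  shows "sl_invariant k \<mu> S T (\<lambda>a b. \<Phi> a b - (\<Sum>x\<in>X. \<Psi> x a b))"
  using assms(2)
proof (induction X rule: infinite_finite_induct)
  case (insert x X)
  have "sl_invariant k \<mu> S T (\<lambda>a b. (\<Phi> a b - (\<Sum>x\<in>X. \<Psi> x a b)) + (-1) * \<Psi> x a b)"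
    using insert by (intro sl_invariant_add_scale) auto
  then show ?case using insert.hyps by (simp add: algebra_simps)
qed (use assms(1) in auto)

lemma sl_invariant_transpose:
  assumes \<Phi>: "sl_invariant k \<mu> S T \<Phi>" and xy: "x \<in> S" "y \<in> S"
  shows "sl_invariant k \<mu> S T (\<lambda>a b. \<Phi> (a \<circ> transpose x y) b)"
  unfolding sl_invariant_def
proof (intro conjI ballI allI impI)
  let ?t = "transpose x y"
  have t: "?t permutes S" using xy by (simp add: permutes_swap_id)
  fix a a' b b' assume *: "a \<in> words k" "a' \<in> words k" "b \<in> words k" "b' \<in> words k"
    "\<forall>i\<in>S. a i = a' i" "\<forall>j\<in>T. b j = b' j"
  show "\<Phi> (a \<circ> ?t) b = \<Phi> (a' \<circ> ?t) b'"
    using * permutes_in_image[OF t] by (intro sl_invariant_cong[OF \<Phi>] words_comp) auto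
next
  let ?t = "transpose x y"
  have t: "?t permutes S" using xy by (simp add: permutes_swap_id)
  fix a b r s assume *: "a \<in> words k" "b \<in> words k" "r < k" "s < k"
  have upd: "a(?t i := s) \<circ> ?t = (a \<circ> ?t)(i := s)" for i
    by (auto simp: fun_eq_iff transpose_def)
  have eq: "(\<Sum>i\<in>S. if a i = r then \<Phi> (a(i := s) \<circ> ?t) b else 0) =
      (\<Sum>i\<in>S. if (a \<circ> ?t) i = r then \<Phi> ((a \<circ> ?t)(i := s)) b else 0)"
    by (subst sum.permute[OF t], intro sum.cong refl) (simp only: comp_apply upd)
  show "(\<Sum>i\<in>S. if a i = r then \<Phi> (a(i := s) \<circ> ?t) b else 0) -
        (\<Sum>j\<in>T. if b j = s then \<Phi> (a \<circ> ?t) (b(j := r)) else 0) =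
        (if r = s then \<mu> * \<Phi> (a \<circ> ?t) b else 0)"
    unfolding eq by (rule sl_invariantD[OF \<Phi> words_comp[OF *(1)] *(2-4)])
qed


section \<open>The first fundamental theorem\<close>

text \<open>
  The contraction of the starred slot \<open>l\<close> with the unstarred slot \<open>j\<close>.
\<close>

definition contract :: "nat \<Rightarrow> nat \<Rightarrow> nat \<Rightarrow> ((nat \<Rightarrow> nat) \<Rightarrow> (nat \<Rightarrow> nat) \<Rightarrow> complex) \<Rightarrow>
    (nat \<Rightarrow> nat) \<Rightarrow> (nat \<Rightarrow> nat) \<Rightarrow> complex" where
  "contract k l j \<Phi> a b = (\<Sum>t<k. \<Phi> (a(l := t)) (b(j := t)))"

text \<open>
  The relation for the full word contains, besides the terms of the relation for the smaller slot sets, one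
  term for \<open>l\<close> and one for \<open>j\<close>. Summed over the contracted letter these two cancel.
\<close>

lemma sl_invariant_contract:
  assumes \<Phi>: "sl_invariant k \<mu> S T \<Phi>" and fin: "finite S" "finite T" and lj: "l \<in> S" "j \<in> T"
  shows "sl_invariant k \<mu> (S - {l}) (T - {j}) (contract k l j \<Phi>)"
  unfolding sl_invariant_def
proof (intro conjI ballI allI impI)
  fix a a' b b' assume *: "a \<in> words k" "a' \<in> words k" "b \<in> words k" "b' \<in> words k"
    "\<forall>i\<in>S - {l}. a i = a' i" "\<forall>j\<in>T - {j}. b j = b' j"
  show "contract k l j \<Phi> a b = contract k l j \<Phi> a' b'"
    unfolding contract_def using *
    by (intro sum.cong refl sl_invariant_cong[OF \<Phi>] words_upd) auto
next
  fix a b r s assume *: "a \<in> words k" "b \<in> words k" "r < k" "s < k"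
  have t: "(\<Sum>i\<in>S - {l}. if a i = r then \<Phi> (a(i := s, l := t)) (b(j := t)) else 0) -
      (\<Sum>j'\<in>T - {j}. if b j' = s then \<Phi> (a(l := t)) (b(j' := r, j := t)) else 0) =
      (if r = s then \<mu> * \<Phi> (a(l := t)) (b(j := t)) else 0)
      - (if t = r then \<Phi> (a(l := s)) (b(j := r)) else 0)
      + (if t = s then \<Phi> (a(l := s)) (b(j := r)) else 0)" if "t < k" for t
  proof -
    have twist: "f(x := u, y := v) = f(y := v, x := u)" if "y \<noteq> x" for f :: "nat \<Rightarrow> nat" and x y u v
      using that by auto
    have 1: "(\<Sum>i\<in>S. if (a(l := t)) i = r then \<Phi> ((a(l := t))(i := s)) (b(j := t)) else 0) =
       (if t = r then \<Phi> (a(l := s)) (b(j := r)) else 0) +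
       (\<Sum>i\<in>S - {l}. if a i = r then \<Phi> (a(i := s, l := t)) (b(j := t)) else 0)"
      using fin lj by (subst sum.remove[of S l]) (simp_all, intro sum.cong refl, simp add: twist)
    have 2: "(\<Sum>j'\<in>T. if (b(j := t)) j' = s then \<Phi> (a(l := t)) ((b(j := t))(j' := r)) else 0) =
       (if t = s then \<Phi> (a(l := s)) (b(j := r)) else 0) +
       (\<Sum>j'\<in>T - {j}. if b j' = s then \<Phi> (a(l := t)) (b(j' := r, j := t)) else 0)"
      using fin lj by (subst sum.remove[of T j]) (simp_all, intro sum.cong refl, simp add: twist)
    show ?thesis
      using sl_invariantD[OF \<Phi> words_upd[OF *(1) that] words_upd[OF *(2) that] *(3,4), of l j]
      unfolding 1 2 by (simp add: algebra_simps)
  qed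
  have "(\<Sum>i\<in>S - {l}. if a i = r then contract k l j \<Phi> (a(i := s)) b else 0) -
        (\<Sum>j'\<in>T - {j}. if b j' = s then contract k l j \<Phi> a (b(j' := r)) else 0) =
      (\<Sum>t<k. (\<Sum>i\<in>S - {l}. if a i = r then \<Phi> (a(i := s, l := t)) (b(j := t)) else 0) -
        (\<Sum>j'\<in>T - {j}. if b j' = s then \<Phi> (a(l := t)) (b(j' := r, j := t)) else 0))"
  proof -
    have swap: "(\<Sum>x\<in>X. if P x then \<Sum>t<k. h x t else 0) = (\<Sum>t<k. \<Sum>x\<in>X. if P x then h x t else 0)"
      for P and h :: "nat \<Rightarrow> nat \<Rightarrow> complex" and X
      by (subst sum.swap) (intro sum.cong refl, simp)
    show ?thesis unfolding contract_def sum_subtractf swap ..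
  qed
  also have "\<dots> = (\<Sum>t<k. (if r = s then \<mu> * \<Phi> (a(l := t)) (b(j := t)) else 0)
      - (if t = r then \<Phi> (a(l := s)) (b(j := r)) else 0)
      + (if t = s then \<Phi> (a(l := s)) (b(j := r)) else 0))"
    using t by (intro sum.cong) auto
  also have "\<dots> = (if r = s then \<mu> * contract k l j \<Phi> a b else 0)"
    using *(3,4) by (simp add: contract_def sum.distrib sum_subtractf sum_distrib_left)
  finally show "(\<Sum>i\<in>S - {l}. if a i = r then contract k l j \<Phi> (a(i := s)) b else 0) -
        (\<Sum>j'\<in>T - {j}. if b j' = s then contract k l j \<Phi> a (b(j' := r)) else 0) =
      (if r = s then \<mu> * contract k l j \<Phi> a b else 0)" .
qed

text \<open>
  Apply the relation that turns \<open>t\<close> back into \<open>a l\<close> to the word with \<open>t\<close> written in slot \<open>l\<close>, and sum over \<open>t\<close>: this is the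
  Casimir element with one leg acting on slot \<open>l\<close> and the other on all slots. A starred slot \<open>i \<noteq> l\<close> contributes
  the transposition of \<open>i\<close> and \<open>l\<close>, the slot \<open>l\<close> itself contributes \<open>k\<close>, and an unstarred slot contributes a contraction.
\<close>

lemma casimir_identity:
  assumes \<Phi>: "sl_invariant k \<mu> S T \<Phi>" and fin: "finite S" and l: "l \<in> S"
    and w: "a \<in> words k" "b \<in> words k"
  shows "(\<Sum>i\<in>S - {l}. \<Phi> (a \<circ> transpose i l) b) + (of_nat k - \<mu>) * \<Phi> a b =
    (\<Sum>j\<in>T. (if a l = b j then 1 else 0) * contract k l j \<Phi> a b)"
proof -
  have al: "a l < k" using w by (simp add: words_def)
  have t: "\<Phi> a b + (\<Sum>i\<in>S - {l}. if a i = t then \<Phi> (a \<circ> transpose i l) b else 0) -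
      (\<Sum>j\<in>T. (if a l = b j then 1 else 0) * \<Phi> (a(l := t)) (b(j := t))) =
      (if t = a l then \<mu> * \<Phi> a b else 0)" if t: "t < k" for t
  proof -
    have 1: "(\<Sum>i\<in>S. if (a(l := t)) i = t then \<Phi> ((a(l := t))(i := a l)) b else 0) =
        \<Phi> a b + (\<Sum>i\<in>S - {l}. if a i = t then \<Phi> (a \<circ> transpose i l) b else 0)"
    proof -
      have "(a(l := t))(i := a l) = a \<circ> transpose i l" if "i \<noteq> l" "a i = t" for i
        using that by (auto simp: fun_eq_iff transpose_def)
      then show ?thesis
        using fin l by (subst sum.remove[of S l]) (simp_all, intro sum.cong refl, simp)
    qed
    have 2: "(\<Sum>j\<in>T. if b j = a l then \<Phi> (a(l := t)) (b(j := t)) else 0) =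
        (\<Sum>j\<in>T. (if a l = b j then 1 else 0) * \<Phi> (a(l := t)) (b(j := t)))"
      by (intro sum.cong) auto
    have 3: "(if t = a l then \<mu> * \<Phi> (a(l := t)) b else 0) = (if t = a l then \<mu> * \<Phi> a b else 0)"
      by simp
    show ?thesis
      using sl_invariantD[OF \<Phi> words_upd[OF w(1) t] w(2) t al, of l]
      unfolding 1 2 3 .
  qed
  have "(\<Sum>t<k. if t = a l then \<mu> * \<Phi> a b else 0) = (\<Sum>t<k. \<Phi> a b +
      (\<Sum>i\<in>S - {l}. if a i = t then \<Phi> (a \<circ> transpose i l) b else 0) -
      (\<Sum>j\<in>T. (if a l = b j then 1 else 0) * \<Phi> (a(l := t)) (b(j := t))))"
    using t by (intro sum.cong) auto
  also have "\<dots> = of_nat k * \<Phi> a b +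
      (\<Sum>i\<in>S - {l}. \<Sum>t<k. if a i = t then \<Phi> (a \<circ> transpose i l) b else 0) -
      (\<Sum>j\<in>T. (if a l = b j then 1 else 0) * contract k l j \<Phi> a b)"
    unfolding sum.distrib sum_subtractf contract_def sum_distrib_left
      sum.swap[of _ "{..<k}" T] sum.swap[of _ "{..<k}" "S - {l}"] by simp
  also have "(\<Sum>i\<in>S - {l}. \<Sum>t<k. if a i = t then \<Phi> (a \<circ> transpose i l) b else 0) =
      (\<Sum>i\<in>S - {l}. \<Phi> (a \<circ> transpose i l) b)"
    using w by (simp add: words_def)
  finally show ?thesis using al by (simp add: algebra_simps)
qed


text \<open>
  Evaluating an alternating invariant with \<open>k\<close> of its slots filled by all \<open>k\<close> letters uses up one power of the
  determinant: a matrix unit with \<open>r \<noteq> s\<close> acting on these slots repeats a letter and gives 0, while a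
  diagonal one meets its letter exactly once.
\<close>

lemma sl_invariant_fill:
  assumes \<Phi>: "sl_invariant k \<mu> S T \<Phi>" and I: "distinct I" "length I = k" "set I \<subseteq> S"
    and fin: "finite S" and alt: "\<And>b. b \<in> words k \<Longrightarrow> alternating k (set I) (\<lambda>a. \<Phi> a b)"
  shows "sl_invariant k (\<mu> - 1) (S - set I) T (\<lambda>a b. \<Phi> (fill_in_order I a) b)"
  unfolding sl_invariant_def
proof (intro conjI ballI allI impI)
  fix a a' b b' assume *: "a \<in> words k" "a' \<in> words k" "b \<in> words k" "b' \<in> words k"
    "\<forall>i\<in>S - set I. a i = a' i" "\<forall>j\<in>T. b j = b' j"
  have "fill_in_order I a i = fill_in_order I a' i" if "i \<in> S" for i
    using *(5) that by (auto simp: fill_in_order_def)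
  then show "\<Phi> (fill_in_order I a) b = \<Phi> (fill_in_order I a') b'"
    using * I by (intro sl_invariant_cong[OF \<Phi>] fill_in_order_words) auto
next
  fix a b r s assume *: "a \<in> words k" "b \<in> words k" "r < k" "s < k"
  let ?a = "fill_in_order I a"
  have w: "?a \<in> words k" by (rule fill_in_order_words[OF I(1,2) *(1)])
  have nth: "?a (I ! c) = c" if "c < k" for c using fill_in_order_nth[of I c] that I by simp
  have "(\<Sum>i\<in>set I. if ?a i = r then \<Phi> (?a(i := s)) b else 0) =
      (\<Sum>i\<in>set I. if i = I ! r then \<Phi> (?a(i := s)) b else 0)"
    using I nth *(3) by (intro sum.cong refl) (auto simp: in_set_conv_nth)
  also have "\<dots> = \<Phi> (?a(I ! r := s)) b" using I *(3) by simp
  also have "\<dots> = (if r = s then \<Phi> ?a b else 0)"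
  proof (cases "r = s")
    case True
    then have "?a(I ! r := s) = ?a" using nth[OF *(3)] by auto
    with True show ?thesis by simp
  next
    case False
    then have ne: "I ! r \<noteq> I ! s" using I *(3,4) by (simp add: nth_eq_iff_index_eq)
    have "\<Phi> (?a(I ! r := s)) b = 0"
      by (rule alternating_eq_0[OF alt[OF *(2)] words_upd[OF w *(4)], of "I ! r" "I ! s"])
        (use ne I * nth in auto)
    with False show ?thesis by simp
  qed
  finally have set_I: "(\<Sum>i\<in>set I. if ?a i = r then \<Phi> (?a(i := s)) b else 0) =
    (if r = s then \<Phi> ?a b else 0)" .
  have rest: "(\<Sum>i\<in>S - set I. if a i = r then \<Phi> (fill_in_order I (a(i := s))) b else 0) =
      (\<Sum>i\<in>S - set I. if ?a i = r then \<Phi> (?a(i := s)) b else 0)"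
  proof (intro sum.cong refl)
    fix i assume "i \<in> S - set I"
    then have "?a i = a i" "fill_in_order I (a(i := s)) = ?a(i := s)"
      by (auto simp: fill_in_order_def fun_eq_iff)
    then show "(if a i = r then \<Phi> (fill_in_order I (a(i := s))) b else 0) =
      (if ?a i = r then \<Phi> (?a(i := s)) b else 0)" by simp
  qed
  have split: "(\<Sum>i\<in>S. if ?a i = r then \<Phi> (?a(i := s)) b else 0) =
      (\<Sum>i\<in>S - set I. if ?a i = r then \<Phi> (?a(i := s)) b else 0) + (if r = s then \<Phi> ?a b else 0)"
    unfolding sum.subset_diff[OF I(3) fin, of "\<lambda>i. if ?a i = r then \<Phi> (?a(i := s)) b else 0"] set_I ..
  show "(\<Sum>i\<in>S - set I. if a i = r then \<Phi> (fill_in_order I (a(i := s))) b else 0) -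
      (\<Sum>j\<in>T. if b j = s then \<Phi> ?a (b(j := r)) else 0) =
      (if r = s then (\<mu> - 1) * \<Phi> ?a b else 0)"
    unfolding rest using sl_invariantD[OF \<Phi> w *(2-4)] unfolding split
    by (auto simp: algebra_simps split: if_splits)
qed

text \<open>
  Up to a factor this is the antisymmetrisation over \<open>insert l K\<close>: the identity and the transpositions with \<open>l\<close>
  represent the cosets of the permutations of \<open>K\<close>.
\<close>

lemma alternating_extend:
  assumes alt: "alternating k K f" and fin: "finite K" and l: "l \<notin> K"
  shows "alternating k (insert l K) (\<lambda>a. f a - (\<Sum>i\<in>K. f (a \<circ> transpose i l)))"
proof -
  define u where "u = (\<lambda>a. f a - (\<Sum>i\<in>K. f (a \<circ> transpose i l)))"
  have inside: "u (a \<circ> transpose x y) = - u a"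
    if a: "a \<in> words k" and xy: "x \<in> K" "y \<in> K" "x \<noteq> y" for a x y
  proof -
    have "f (a \<circ> transpose x y \<circ> transpose i l) = - f (a \<circ> transpose (transpose x y i) l)" for i
    proof -
      have "transpose x y \<circ> transpose i l = transpose (transpose x y i) l \<circ> transpose x y"
        using l xy by (auto simp: fun_eq_iff transpose_def)
      then have "a \<circ> transpose x y \<circ> transpose i l = a \<circ> transpose (transpose x y i) l \<circ> transpose x y"
        by (simp add: comp_assoc)
      then show ?thesis using alternatingD[OF alt words_comp[OF a] xy] by simp
    qed
    then have "(\<Sum>i\<in>K. f (a \<circ> transpose x y \<circ> transpose i l)) =
        - (\<Sum>i\<in>K. f (a \<circ> transpose (transpose x y i) l))"
      by (simp add: sum_negf)
    also have "(\<Sum>i\<in>K. f (a \<circ> transpose (transpose x y i) l)) = (\<Sum>i\<in>K. f (a \<circ> transpose i l))"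
      unfolding sum.permute[OF permutes_swap_id[OF xy(1,2)], of "\<lambda>i. f (a \<circ> transpose i l)"]
      by (intro sum.cong refl) (simp only: comp_apply)
    finally have sum: "(\<Sum>i\<in>K. f (a \<circ> transpose x y \<circ> transpose i l)) = - (\<Sum>i\<in>K. f (a \<circ> transpose i l))" .
    show ?thesis unfolding u_def alternatingD[OF alt a xy] sum by (rule minus_diff_minus)
  qed
  have outside: "u (a \<circ> transpose x l) = - u a" if a: "a \<in> words k" and x: "x \<in> K" for a x
  proof -
    have "f (a \<circ> transpose x l \<circ> transpose i l) = - f (a \<circ> transpose i l)" if i: "i \<in> K - {x}" for i
    proof -
      have "transpose x l \<circ> transpose i l = transpose i l \<circ> transpose x i"
        using l x i by (auto simp: fun_eq_iff transpose_def)
      then have "a \<circ> transpose x l \<circ> transpose i l = a \<circ> transpose i l \<circ> transpose x i"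
        by (simp add: comp_assoc)
      then show ?thesis using alternatingD[OF alt words_comp[OF a], of x i] x i by auto
    qed
    then have "(\<Sum>i\<in>K - {x}. f (a \<circ> transpose x l \<circ> transpose i l)) =
        - (\<Sum>i\<in>K - {x}. f (a \<circ> transpose i l))"
      by (simp add: sum_negf)
    moreover have "a \<circ> transpose x l \<circ> transpose x l = a" by (simp add: comp_assoc)
    ultimately show ?thesis using fin x by (simp add: u_def sum.remove[of K x])
  qed
  have "alternating k (insert l K) u"
    unfolding alternating_def
  proof (intro ballI impI)
    fix a x y assume *: "a \<in> words k" "x \<in> insert l K" "y \<in> insert l K" "x \<noteq> y"
    then consider "x \<in> K" "y \<in> K" | "x \<in> K" "y = l" | "x = l" "y \<in> K" by auto
    then show "u (a \<circ> transpose x y) = - u a"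
      by cases (use * inside outside in \<open>auto simp: transpose_commute[of l]\<close>)
  qed
  then show ?thesis unfolding u_def .
qed

text \<open>
  The trace of the relations: the diagonal matrix units together count all letters of \<open>a\<close> minus all letters of \<open>b\<close>.
\<close>

lemma sl_invariant_card:
  assumes \<Phi>: "sl_invariant k (of_nat m) S T \<Phi>" and fin: "finite S" "finite T"
    and w: "a \<in> words k" "b \<in> words k" and "\<Phi> a b \<noteq> 0"
  shows "card S = card T + k * m"
proof -
  have letters: "(\<Sum>r<k. \<Sum>x\<in>X. if c x = r then \<Phi> (f x r) (g x r) else 0) = of_nat (card X) * \<Phi> a b"
    if "c \<in> words k" "\<And>x. f x (c x) = a" "\<And>x. g x (c x) = b" for c f g and X :: "nat set"
    by (subst sum.swap) (use that in \<open>simp add: words_def\<close>)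
  have "(\<Sum>r<k. (\<Sum>i\<in>S. if a i = r then \<Phi> (a(i := r)) b else 0) -
      (\<Sum>j\<in>T. if b j = r then \<Phi> a (b(j := r)) else 0)) = (\<Sum>r<k. of_nat m * \<Phi> a b)"
    using sl_invariantD[OF \<Phi> w] by (intro sum.cong refl) simp
  then have "of_nat (card S) * \<Phi> a b - of_nat (card T) * \<Phi> a b = of_nat k * (of_nat m * \<Phi> a b)"
    unfolding sum_subtractf
    using letters[OF w(1), of "\<lambda>x r. a(x := r)" "\<lambda>_ _. b" S] letters[OF w(2), of "\<lambda>_ _. a" "\<lambda>x r. b(x := r)" T]
    by simp
  then have "(of_nat (card S) - (of_nat (card T) + of_nat k * of_nat m)) * \<Phi> a b = 0"
    by (simp add: algebra_simps)
  then have "(of_nat (card S) :: complex) = of_nat (card T) + of_nat k * of_nat m"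
    using assms(6) by simp
  then have "(of_nat (card S) :: complex) = of_nat (card T + k * m)" by simp
  then show ?thesis by (simp only: of_nat_eq_iff)
qed

text \<open>
  Downward induction on the number \<open>t\<close> of alternating slots, starting from \<open>t = k + 1\<close>, where the function is 0.
  If \<open>t = k\<close> and \<open>m > 0\<close>, a determinant splits off. Otherwise two families of combinations are already known to be in
  the span: the left-hand sides of the Casimir identities for \<open>l \<in> K\<close>, and the functions that alternate in one
  more slot \<open>l \<in> S - K\<close>. Their transposition terms agree up to sign, so their sum is a multiple of the function itself.
\<close>

lemma alternating_in_span:
  assumes fin: "finite S" "finite T" and card: "card S = card T + k * m" and T: "m = 0 \<Longrightarrow> T \<noteq> {}"
    and contr: "\<And>l j \<Psi>. l \<in> S \<Longrightarrow> j \<in> T \<Longrightarrow> sl_invariant k (of_nat m) (S - {l}) (T - {j}) \<Psi> \<Longrightarrow>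
      word_span k (matching_graphs k (S - {l}) (T - {j})) \<Psi>"
    and fill: "\<And>I \<Psi>. m > 0 \<Longrightarrow> distinct I \<Longrightarrow> length I = k \<Longrightarrow> set I \<subseteq> S \<Longrightarrow>
      sl_invariant k (of_nat (m - 1)) (S - set I) T \<Psi> \<Longrightarrow> word_span k (matching_graphs k (S - set I) T) \<Psi>"
    and t: "1 \<le> t" "t \<le> k + 1"
    and K: "K \<subseteq> S" "card K = t"
    and \<Phi>: "sl_invariant k (of_nat m) S T \<Phi>" "\<And>b. b \<in> words k \<Longrightarrow> alternating k K (\<lambda>a. \<Phi> a b)"
  shows "word_span k (matching_graphs k S T) \<Phi>"
  using t(2,1) K \<Phi>
proof (induction t arbitrary: K \<Phi> rule: inc_induct)
  case base
  have "finite K" using base.prems(2) fin finite_subset by blast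
  then show ?case
    using alternating_eq_0_card[OF base.prems(5)] base.prems(3) by (intro word_span.zero) simp
next
  case (step t)
  note K = step.prems(2,3) and \<Phi> = step.prems(4,5)
  let ?span = "word_span k (matching_graphs k S T)"
  have finK: "finite K" using K fin finite_subset by blast
  show ?case
  proof (cases "t = k \<and> m > 0")
    case True
    obtain I where I: "distinct I" "set I = K" using finite_distinct_list[OF finK] by blast
    have len: "length I = k" using I K True distinct_card by fastforce
    have "sl_invariant k (of_nat m - 1) (S - set I) T (\<lambda>a b. \<Phi> (fill_in_order I a) b)"
      using \<Phi> I len K fin by (intro sl_invariant_fill) auto
    then have "sl_invariant k (of_nat (m - 1)) (S - set I) T (\<lambda>a b. \<Phi> (fill_in_order I a) b)"
      using True by (simp add: of_nat_diff)
    then have "?span (\<lambda>a b. word_det k a I * \<Phi> (fill_in_order I a) b)"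
      using I len K fin True by (intro word_span_times_hyperedge fill) auto
    then show ?thesis
    proof (rule word_span_cong)
      fix a b assume "a \<in> words k" "b \<in> words k"
      then show "\<Phi> a b = word_det k a I * \<Phi> (fill_in_order I a) b"
        using alternating_eq_word_det[OF I(1) len, of "\<lambda>a. \<Phi> a b" a] \<Phi>(2) I(2) by simp
    qed
  next
    case False
    have casimir: "?span (\<lambda>a b. (\<Sum>i\<in>S - {l}. \<Phi> (a \<circ> transpose i l) b) + (of_nat k - of_nat m) * \<Phi> a b)"
      if l: "l \<in> S" for l
    proof (rule word_span_cong)
      show "?span (\<lambda>a b. \<Sum>j\<in>T. (if a l = b j then 1 else 0) * contract k l j \<Phi> a b)"
        using fin l \<Phi>(1) by (intro word_span_sum word_span_times_arc contr sl_invariant_contract) auto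
    qed (rule casimir_identity[OF \<Phi>(1) fin(1) l])
    have extend: "?span (\<lambda>a b. \<Phi> a b - (\<Sum>i\<in>K. \<Phi> (a \<circ> transpose i l) b))" if l: "l \<in> S - K" for l
    proof (rule step.IH)
      show "sl_invariant k (of_nat m) S T (\<lambda>a b. \<Phi> a b - (\<Sum>i\<in>K. \<Phi> (a \<circ> transpose i l) b))"
        using \<Phi>(1) K l by (intro sl_invariant_sub_sum sl_invariant_transpose) auto
      show "alternating k (insert l K) (\<lambda>a. \<Phi> a b - (\<Sum>i\<in>K. \<Phi> (a \<circ> transpose i l) b))" if "b \<in> words k" for b
        by (rule alternating_extend[OF \<Phi>(2)[OF that] finK]) (use l in simp)
    qed (use K l finK in auto)
    \<comment> \<open>the multiple of \<open>\<Phi>\<close> that is left after adding up all identities; it equals \<open>card T + (m + t) (k - t)\<close>\<close>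
    define c :: complex where "c = of_nat (card (S - K)) - of_nat t * (of_nat t - 1) + of_nat t * (of_nat k - of_nat m)"
    have "?span (\<lambda>a b. (\<Sum>l\<in>S - K. \<Phi> a b - (\<Sum>i\<in>K. \<Phi> (a \<circ> transpose i l) b)) +
        (\<Sum>l\<in>K. (\<Sum>i\<in>S - {l}. \<Phi> (a \<circ> transpose i l) b) + (of_nat k - of_nat m) * \<Phi> a b))"
      by (rule word_span_add; rule word_span_sum; (rule extend | rule casimir)) (use K in auto)
    then have "?span (\<lambda>a b. c * \<Phi> a b)"
    proof (rule word_span_cong)
      fix a b assume w: "a \<in> words k" "b \<in> words k"
      have "(\<Sum>i\<in>S - {l}. \<Phi> (a \<circ> transpose i l) b) =
          (\<Sum>i\<in>S - K. \<Phi> (a \<circ> transpose l i) b) - (of_nat t - 1) * \<Phi> a b" if l: "l \<in> K" for l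
      proof -
        have "(\<Sum>i\<in>S - {l}. \<Phi> (a \<circ> transpose i l) b) =
            (\<Sum>i\<in>(S - {l}) - (K - {l}). \<Phi> (a \<circ> transpose i l) b) + (\<Sum>i\<in>K - {l}. \<Phi> (a \<circ> transpose i l) b)"
          using K fin by (intro sum.subset_diff) auto
        also have "(S - {l}) - (K - {l}) = S - K" using l by auto
        also have "(\<Sum>i\<in>K - {l}. \<Phi> (a \<circ> transpose i l) b) = (\<Sum>i\<in>K - {l}. - \<Phi> a b)"
          by (intro sum.cong refl alternatingD[OF \<Phi>(2)[OF w(2)] w(1)]) (use l in auto)
        also have "\<dots> = - (of_nat t - 1) * \<Phi> a b"
          using l K finK step.prems(1) by (simp add: of_nat_diff algebra_simps)
        finally show ?thesis
          by (simp only: transpose_commute[of l] diff_conv_add_uminus mult_minus_left)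
      qed
      then have "(\<Sum>l\<in>K. (\<Sum>i\<in>S - {l}. \<Phi> (a \<circ> transpose i l) b) + (of_nat k - of_nat m) * \<Phi> a b) =
          (\<Sum>l\<in>K. (\<Sum>i\<in>S - K. \<Phi> (a \<circ> transpose l i) b) - (of_nat t - 1) * \<Phi> a b + (of_nat k - of_nat m) * \<Phi> a b)"
        by (intro sum.cong) auto
      also have "\<dots> = (\<Sum>l\<in>S - K. \<Sum>i\<in>K. \<Phi> (a \<circ> transpose i l) b)
          - of_nat t * ((of_nat t - 1) * \<Phi> a b) + of_nat t * ((of_nat k - of_nat m) * \<Phi> a b)"
        using K unfolding sum.distrib sum_subtractf sum.swap[of _ K "S - K"] by simp
      finally show "c * \<Phi> a b = (\<Sum>l\<in>S - K. \<Phi> a b - (\<Sum>i\<in>K. \<Phi> (a \<circ> transpose i l) b)) +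
          (\<Sum>l\<in>K. (\<Sum>i\<in>S - {l}. \<Phi> (a \<circ> transpose i l) b) + (of_nat k - of_nat m) * \<Phi> a b)"
        by (simp add: c_def sum_subtractf algebra_simps)
    qed
    then have *: "?span (\<lambda>a b. inverse c * (c * \<Phi> a b))" by (rule word_span_scale)
    have c: "c = of_nat (card T + (m + t) * (k - t))"
    proof -
      have "t \<le> k" using step.hyps by simp
      then obtain d where d: "k = t + d" using le_Suc_ex by blast
      have "card (S - K) + t = card T + k * m"
        using K fin finK card card_mono[OF fin(1) K(1)] by (simp add: card_Diff_subset)
      then have "(of_nat (card (S - K)) :: complex) + of_nat t = of_nat (card T) + of_nat k * of_nat m"
        by (metis of_nat_add of_nat_mult)
      then have "(of_nat (card (S - K)) :: complex) = of_nat (card T) + of_nat k * of_nat m - of_nat t"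
        by (simp add: algebra_simps)
      then show ?thesis unfolding c_def d by (simp add: algebra_simps)
    qed
    have nz: "card T + (m + t) * (k - t) \<noteq> 0"
      using False T step.prems(1) step.hyps fin by auto
    have "c \<noteq> 0" unfolding c of_nat_eq_0_iff by (rule nz)
    then show ?thesis by (intro word_span_cong[OF *]) simp
  qed
qed

text \<open>
  A function alternates trivially in a single slot, so the preceding lemma applies to every invariant. The
  induction is on the number of starred slots: contraction removes one of them, filling in a determinant removes \<open>k\<close>.
\<close>

theorem first_fundamental_theorem:
  assumes "finite S" "finite T" "k \<ge> 1" "sl_invariant k (of_nat m) S T \<Phi>"
  shows "word_span k (matching_graphs k S T) \<Phi>"
  using assms
proof (induction "card S" arbitrary: S T m \<Phi> rule: less_induct)
  case less
  note fin = less.prems(1,2) and k = less.prems(3) and \<Phi> = less.prems(4)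
  show ?case
  proof (cases "card S = card T + k * m")
    case False
    then show ?thesis
      using sl_invariant_card[OF \<Phi> fin] by (intro word_span.zero) blast
  next
    case True
    show ?thesis
    proof (cases "S = {}")
      case True
      with \<open>card S = _\<close> fin have T: "T = {}" by auto
      have G: "SL_Graph {#} [] [] \<in> matching_graphs k S T"
        using True T by (simp add: matching_graphs_def)
      define z :: "nat \<Rightarrow> nat" where "z = (\<lambda>_. 0)"
      have z: "z \<in> words k" using k by (auto simp: words_def z_def)
      have "\<Phi> a b = 0 + \<Phi> z z * word_value k (SL_Graph {#} [] []) a b" if "a \<in> words k" "b \<in> words k" for a b
        using sl_invariant_cong[OF \<Phi> that(1) z that(2) z] True T by (simp add: word_value_def)
      then show ?thesis by (rule word_span.step[OF word_span.zero[of k "\<lambda>_ _. 0", OF refl] G])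
    next
      case False
      then obtain l where l: "l \<in> S" by blast
      show ?thesis
      proof (rule alternating_in_span[OF fin True, where t = 1 and K = "{l}"])
        show "T \<noteq> {}" if "m = 0" using that True False fin by auto
        show "word_span k (matching_graphs k (S - {l}) (T - {j})) \<Psi>"
          if "l \<in> S" "j \<in> T" "sl_invariant k (of_nat m) (S - {l}) (T - {j}) \<Psi>" for l j \<Psi>
          using that fin k by (intro less.hyps[of _ _ m] psubset_card_mono) auto
        show "word_span k (matching_graphs k (S - set I) T) \<Psi>"
          if "distinct I" "length I = k" "set I \<subseteq> S" "sl_invariant k (of_nat (m - 1)) (S - set I) T \<Psi>" for I \<Psi>
        proof (rule less.hyps[of _ _ "m - 1"])
          have "I ! 0 \<in> set I" using that k by simp
          then have "S - set I \<subset> S" using that(3) by blast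
          then show "card (S - set I) < card S" using fin by (intro psubset_card_mono)
        qed (use that fin k in auto)
        show "alternating k {l} (\<lambda>a. \<Phi> a b)" for b by (simp add: alternating_def)
      qed (use l k \<Phi> in auto)
    qed
  qed
qed


section \<open>Layers of arcs and graphs of degree one\<close>

lemma mem_first_layer_star:
  "(i, j) \<in># first_layer_star M \<longleftrightarrow> (i, j) \<in># M \<and> \<not> (\<exists>i' j'. (i', j') \<in># M \<and> i' < i \<and> j' > j)"
  by (auto simp: first_layer_star_def)

lemma mem_diff_first_layer_star:
  "(i, j) \<in># M - first_layer_star M \<longleftrightarrow> (i, j) \<in># M \<and> (\<exists>i' j'. (i', j') \<in># M \<and> i' < i \<and> j' > j)"
proof -
  have "M - filter_mset P M = filter_mset (\<lambda>x. \<not> P x) M" for P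
    by (rule multiset_eqI) simp
  then show ?thesis by (auto simp: first_layer_star_def)
qed

text \<open>
  Passing from an arc to one that nests strictly around it decreases the starred end, so this stops at an arc
  of the first layer. The premise on \<open>P\<close> makes the property survive each step.
\<close>

lemma exists_first_layer_star:
  assumes "(i, j) \<in># M" "P i j"
    and "\<And>i j i' j'. (i', j') \<in># M \<Longrightarrow> i' < i \<Longrightarrow> j' > j \<Longrightarrow> P i j \<Longrightarrow> P i' j'"
  shows "\<exists>i j. (i, j) \<in># first_layer_star M \<and> P i j"
  using assms(1,2)
proof (induction i arbitrary: j rule: less_induct)
  case (less i)
  show ?case
  proof (cases "\<exists>(i', j') \<in> set_mset M. i' < i \<and> j' > j")
    case True
    then obtain i' j' where "(i', j') \<in># M" "i' < i" "j' > j" by blast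
    then show ?thesis using less.IH[of i' j'] assms(3) less.prems by blast
  next
    case False
    then have "(i, j) \<in># first_layer_star M" using less.prems by (auto simp: mem_first_layer_star)
    then show ?thesis using less.prems by blast
  qed
qed

text \<open>
  An arc survives the removal of a layer only if some arc nests strictly around it, and that one can be chosen
  in the removed layer. Repeating this builds a nesting with one arc from each of the layers \<open>0, \<dots>, l\<close>.
\<close>

lemma mem_layer_star_nesting:
  assumes "(i, j) \<in># layer_star l M"
  shows "\<exists>C. C \<subseteq> set_mset M \<and> strict_nesting C \<and> card C = Suc l \<and> (i, j) \<in> C \<and>
    (\<forall>(i', j') \<in> C. i' \<le> i \<and> j' \<ge> j)"
  using assms
proof (induction l arbitrary: i j)
  case 0
  then show ?case
    by (intro exI[of _ "{(i, j)}"]) (auto simp: layer_star_def first_layer_star_def strict_nesting_def)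
next
  case (Suc l)
  define N where "N = ((\<lambda>N. N - first_layer_star N) ^^ l) M"
  have N: "(i, j) \<in># N - first_layer_star N"
    using Suc.prems by (simp add: layer_star_def mem_first_layer_star N_def)
  then obtain i0 j0 where "(i0, j0) \<in># N" "i0 < i" "j0 > j"
    unfolding mem_diff_first_layer_star by blast
  then have "\<exists>i' j'. (i', j') \<in># first_layer_star N \<and> (i' < i \<and> j' > j)"
    by (intro exists_first_layer_star[of i0 j0]) auto
  then obtain i' j' where 1: "(i', j') \<in># layer_star l M" "i' < i" "j' > j"
    by (auto simp: layer_star_def N_def)
  from Suc.IH[OF 1(1)] obtain C where C: "C \<subseteq> set_mset M" "strict_nesting C" "card C = Suc l"
    "\<forall>(a, b) \<in> C. a \<le> i' \<and> b \<ge> j'" by blast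
  have fin: "finite C" using C(3) card.infinite by fastforce
  have C': "a < i \<and> b > j" if "(a, b) \<in> C" for a b
    using bspec[OF C(4) that] 1 by simp
  have "(i, j) \<in># N" using N by (rule in_diffD)
  moreover have "set_mset (((\<lambda>N. N - first_layer_star N) ^^ l) M) \<subseteq> set_mset M" for l
    by (induction l) (auto dest: in_diffD)
  ultimately have "(i, j) \<in># M" unfolding N_def by blast
  moreover have "strict_nesting (insert (i, j) C)"
    using C(2) C' unfolding strict_nesting_def by auto
  moreover have "card (insert (i, j) C) = Suc (Suc l)" using fin C(3) C' by (subst card_insert_disjoint) auto
  ultimately show ?case
    using C(1) C' by (intro exI[of _ "insert (i, j) C"]) (auto simp: less_imp_le)
qed

lemma exists_layer_star:
  assumes "e \<in># M" shows "\<exists>l. e \<in># layer_star l M"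
  using assms
proof (induction "size M" arbitrary: M rule: less_induct)
  case less
  let ?f = "\<lambda>N. N - first_layer_star N"
  show ?case
  proof (cases "e \<in># first_layer_star M")
    case True
    then show ?thesis by (intro exI[of _ 0]) (simp add: layer_star_def)
  next
    case False
    obtain i j where "(i, j) \<in># M" using less.prems by (cases e) auto
    then have "\<exists>i j. (i, j) \<in># first_layer_star M \<and> True"
      by (intro exists_first_layer_star) auto
    then have "first_layer_star M \<noteq> {#}" by auto
    moreover have "first_layer_star M \<subseteq># M" by (simp add: first_layer_star_def)
    ultimately have "size (?f M) < size M"
      by (metis size_Diff_submset size_mset_mono diff_less size_eq_0_iff_empty neq0_conv le_zero_eq)
    moreover have "e \<in># ?f M"
      using less.prems False by (metis in_diff_count not_in_iff count_greater_zero_iff)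
    ultimately obtain l where "e \<in># layer_star l (?f M)" using less.hyps by blast
    then have "e \<in># layer_star (Suc l) M" by (simp add: layer_star_def funpow_Suc_right del: funpow.simps)
    then show ?thesis by blast
  qed
qed

lemma layer_star_not_nested:
  assumes "(i, j) \<in># layer_star l M" "(i', j') \<in># layer_star l M"
  shows "\<not> (i' < i \<and> j' > j)"
  using assms by (auto simp: layer_star_def first_layer_star_def)

lemma layer_star_subset: "e \<in># layer_star l M \<Longrightarrow> e \<in># M"
  using mem_layer_star_nesting[of "fst e" "snd e" l M] by auto

lemma size_filter_fst: "size {# e \<in># M. f e = i #} = count (image_mset f M) i"
  by (induction M) auto

lemma length_filter_mem:
  "\<forall>I\<in>set Is. distinct I \<Longrightarrow> length (filter (\<lambda>I. i \<in> set I) Is) = count (mset (concat Is)) i"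
  by (induction Is) (auto simp: count_mset_0_iff distinct_count_atmost_1)

lemma count_mset_set_if: "finite A \<Longrightarrow> count (mset_set A) i = (if i \<in> A then 1 else 0)"
  by (cases "i \<in> A") auto

lemma matching_graphs_count:
  assumes "G \<in> matching_graphs k S T" "finite S" "finite T"
  shows "count (image_mset fst (arcs G)) i + count (mset (concat (star_hyperedges G))) i = (if i \<in> S then 1 else 0)"
    and "count (image_mset snd (arcs G)) j = (if j \<in> T then 1 else 0)"
proof -
  have *: "image_mset fst (arcs G) + mset (concat (star_hyperedges G)) = mset_set S"
    "image_mset snd (arcs G) = mset_set T"
    using assms(1) by (auto simp: matching_graphs_def)
  show "count (image_mset fst (arcs G)) i + count (mset (concat (star_hyperedges G))) i = (if i \<in> S then 1 else 0)"
    using arg_cong[OF *(1), of "\<lambda>M. count M i"] count_mset_set_if[OF assms(2)] by simp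
  show "count (image_mset snd (arcs G)) j = (if j \<in> T then 1 else 0)"
    using *(2) count_mset_set_if[OF assms(3)] by simp
qed

lemma count_image_unique:
  assumes "count (image_mset f M) y \<le> 1" "x \<in># M" "x' \<in># M" "f x = y" "f x' = y"
  shows "x = x'"
proof (rule ccontr)
  assume "x \<noteq> x'"
  then have "x' \<in># M - {#x#}" using assms by (simp add: in_diff_count)
  then have "{#x, x'#} \<subseteq># M" using assms(2) by (simp add: insert_subset_eq_iff)
  then have "count (image_mset f {#x, x'#}) y \<le> count (image_mset f M) y"
    by (intro mset_subset_eq_count image_mset_subseteq_mono)
  with assms show False by simp
qed

lemma count_le_count_image: "count M x \<le> count (image_mset f M) (f x)"
  by (induction M) auto

lemma matching_graphs_cases:
  assumes "G \<in> matching_graphs k S T" "finite S" "finite T" "i \<in> S"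
  obtains (arc) j where "(i, j) \<in># arcs G" | (hyperedge) I where "I \<in> set (star_hyperedges G)" "i \<in> set I"
proof -
  have "count (image_mset fst (arcs G)) i + count (mset (concat (star_hyperedges G))) i = 1"
    using matching_graphs_count(1)[OF assms(1-3)] assms(4) by simp
  then have "i \<in># image_mset fst (arcs G) \<or> i \<in># mset (concat (star_hyperedges G))"
    by (metis add_cancel_left_right count_eq_zero_iff zero_neq_one add.right_neutral)
  then show ?thesis using that by auto
qed

lemma matching_graphs_props:
  assumes "G \<in> matching_graphs k S T" "finite S" "finite T"
  shows "(i, j) \<in># arcs G \<Longrightarrow> i \<in> S \<and> j \<in> T"
    and "I \<in> set (star_hyperedges G) \<Longrightarrow> set I \<subseteq> S \<and> length I = k"
    and "(i, j) \<in># arcs G \<Longrightarrow> (i, j') \<in># arcs G \<Longrightarrow> j = j'"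
    and "(i, j) \<in># arcs G \<Longrightarrow> (i', j) \<in># arcs G \<Longrightarrow> i = i'"
    and "(i, j) \<in># arcs G \<Longrightarrow> I \<in> set (star_hyperedges G) \<Longrightarrow> i \<notin> set I"
    and "distinct (concat (star_hyperedges G))"
    and "j \<in> T \<Longrightarrow> \<exists>i. (i, j) \<in># arcs G"
    and "count (arcs G) e \<le> 1"
proof -
  note c = matching_graphs_count[OF assms]
  have fst: "count (image_mset fst (arcs G)) i \<le> 1" for i
    using c(1)[of i] by (simp split: if_splits)
  have snd: "count (image_mset snd (arcs G)) i \<le> 1" for i
    using c(2)[of i] by (simp split: if_splits)
  have *: "image_mset fst (arcs G) + mset (concat (star_hyperedges G)) = mset_set S"
    "image_mset snd (arcs G) = mset_set T"
    using assms(1) by (auto simp: matching_graphs_def)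
  have S: "set_mset (image_mset fst (arcs G)) \<union> set (concat (star_hyperedges G)) = S"
    using arg_cong[OF *(1), of set_mset] assms(2) by simp
  have T: "set_mset (image_mset snd (arcs G)) = T"
    using arg_cong[OF *(2), of set_mset] assms(3) by simp
  show "i \<in> S \<and> j \<in> T" if "(i, j) \<in># arcs G"
  proof -
    have "i \<in> fst ` set_mset (arcs G)" "j \<in> snd ` set_mset (arcs G)"
      using that by (metis fst_conv image_eqI, metis snd_conv image_eqI)
    then show ?thesis using S T by auto
  qed
  show "set I \<subseteq> S \<and> length I = k" if "I \<in> set (star_hyperedges G)"
    using S that assms(1) by (auto simp: matching_graphs_def)
  show "(i, j) \<in># arcs G \<Longrightarrow> (i, j') \<in># arcs G \<Longrightarrow> j = j'"
    using count_image_unique[OF fst, of "(i, j)" "(i, j')" i] by simp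
  show "(i, j) \<in># arcs G \<Longrightarrow> (i', j) \<in># arcs G \<Longrightarrow> i = i'"
    using count_image_unique[OF snd, of "(i, j)" "(i', j)" j] by simp
  show "j \<in> T \<Longrightarrow> \<exists>i. (i, j) \<in># arcs G" using T by force
  show "i \<notin> set I" if "(i, j) \<in># arcs G" "I \<in> set (star_hyperedges G)"
  proof
    assume "i \<in> set I"
    then have "i \<in># mset (concat (star_hyperedges G))" using that(2) by auto
    then have "count (mset (concat (star_hyperedges G))) i \<ge> 1" by (simp only: count_greater_eq_one_iff)
    moreover have "i \<in># image_mset fst (arcs G)" using that(1) by force
    then have "count (image_mset fst (arcs G)) i \<ge> 1" by (simp only: count_greater_eq_one_iff)
    moreover have "count (image_mset fst (arcs G)) i + count (mset (concat (star_hyperedges G))) i \<le> 1"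
      unfolding c(1) by simp
    ultimately show False by linarith
  qed
  have "count (mset (concat (star_hyperedges G))) i \<le> 1" for i
  proof -
    have "count (image_mset fst (arcs G)) i + count (mset (concat (star_hyperedges G))) i \<le> 1"
      unfolding c(1) by simp
    then show ?thesis by linarith
  qed
  then show "distinct (concat (star_hyperedges G))"
    unfolding distinct_count_atmost_1 by (metis count_eq_zero_iff count_greater_eq_one_iff le_antisym set_mset_mset)
  show "count (arcs G) e \<le> 1"
    using count_le_count_image[of "arcs G" e fst] fst[of "fst e"] by simp
qed


section \<open>Antisymmetrisation over the starred vertices\<close>

definition relabel :: "(nat \<Rightarrow> nat) \<Rightarrow> sl_graph \<Rightarrow> sl_graph" where
  "relabel \<tau> G = SL_Graph (image_mset (apfst \<tau>) (arcs G)) (map (map \<tau>) (star_hyperedges G))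
     (unstar_hyperedges G)"

lemma relabel_matching:
  assumes "G \<in> matching_graphs k S T" and \<tau>: "\<tau> permutes S"
  shows "relabel \<tau> G \<in> matching_graphs k S T"
proof -
  have *: "image_mset fst (arcs G) + mset (concat (star_hyperedges G)) = mset_set S"
    using assms(1) by (simp add: matching_graphs_def)
  have "image_mset fst (image_mset (apfst \<tau>) (arcs G)) = image_mset \<tau> (image_mset fst (arcs G))"
    by (simp add: image_mset.compositionality comp_def)
  moreover have "mset (concat (map (map \<tau>) (star_hyperedges G))) = image_mset \<tau> (mset (concat (star_hyperedges G)))"
    by (simp flip: map_concat)
  ultimately have "image_mset fst (image_mset (apfst \<tau>) (arcs G)) +
      mset (concat (map (map \<tau>) (star_hyperedges G))) = image_mset \<tau> (mset_set S)"
    by (simp flip: *)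
  also have "\<dots> = mset_set (\<tau> ` S)"
    using \<tau> by (intro image_mset_mset_set permutes_inj_on)
  also have "\<tau> ` S = S" using \<tau> by (rule permutes_image)
  finally show ?thesis
    using assms(1) by (simp add: matching_graphs_def relabel_def image_mset.compositionality comp_def)
qed

lemma word_value_relabel:
  assumes "\<forall>I\<in>set (star_hyperedges G). length I = k"
  shows "word_value k (relabel \<tau> G) a b = word_value k G (a \<circ> \<tau>) b"
proof -
  have "map (\<lambda>I. word_det k a I) (map (map \<tau>) (star_hyperedges G)) =
      map (\<lambda>I. word_det k (a \<circ> \<tau>) I) (star_hyperedges G)"
    using assms by (auto simp: word_det_map)
  moreover have "(\<Prod>(i, j) \<in># image_mset (apfst \<tau>) (arcs G). if a i = b j then 1 else 0 :: complex) =
      (\<Prod>(i, j) \<in># arcs G. if (a \<circ> \<tau>) i = b j then 1 else 0)"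
    by (simp add: image_mset.compositionality comp_def case_prod_unfold)
  ultimately show ?thesis unfolding word_value_def relabel_def sl_graph.sel by (simp only:)
qed

text \<open>
  The mark of a starred vertex is the index of its hyperedge or, for the end of an arc, the partner shifted beyond
  all hyperedge indices. With this encoding a forbidden nesting, a failure of the chain condition and a violation
  of the hyperedge rule all become the same pattern: \<open>k + 1\<close> vertices on which the marks decrease weakly.
\<close>

definition marking :: "sl_graph \<Rightarrow> (nat \<Rightarrow> nat) \<Rightarrow> bool" where
  "marking G w \<longleftrightarrow> (\<forall>(i, j) \<in># arcs G. w i = length (star_hyperedges G) + j) \<and>
     (\<forall>s < length (star_hyperedges G). \<forall>i \<in> set (star_hyperedges G ! s). w i = s)"

lemma marking_arc: "marking G w \<Longrightarrow> (i, j) \<in># arcs G \<Longrightarrow> w i = length (star_hyperedges G) + j"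
  by (auto simp: marking_def)

lemma marking_hyperedge:
  "marking G w \<Longrightarrow> s < length (star_hyperedges G) \<Longrightarrow> i \<in> set (star_hyperedges G ! s) \<Longrightarrow> w i = s"
  by (auto simp: marking_def)

lemma marking_relabel:
  assumes "marking G w" "\<tau> permutes S"
  shows "marking (relabel \<tau> G) (w \<circ> inv_into UNIV \<tau>)"
  using assms(1) permutes_inverses(2)[OF assms(2)] by (fastforce simp: marking_def relabel_def)

lemma distinct_concat_unique:
  assumes "distinct (concat Is)" "s < length Is" "s' < length Is" "i \<in> set (Is ! s)" "i \<in> set (Is ! s')"
  shows "s = s'"
  using assms
proof (induction Is arbitrary: s s')
  case (Cons I Is)
  have disj: "i \<notin> set I" if "t < length Is" "i \<in> set (Is ! t)" for t
  proof -
    have "i \<in> set (concat Is)" using that nth_mem[OF that(1)] by auto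
    then show ?thesis using Cons.prems(1) by auto
  qed
  show ?case
    using Cons.prems disj Cons.IH by (cases s; cases s') auto
qed simp

lemma marking_exists:
  assumes G: "G \<in> matching_graphs k S T" and fin: "finite S" "finite T"
  shows "\<exists>w. marking G w"
proof -
  note props = matching_graphs_props[OF G fin]
  define w where "w i = (if \<exists>j. (i, j) \<in># arcs G then length (star_hyperedges G) + (THE j. (i, j) \<in># arcs G)
    else (THE s. s < length (star_hyperedges G) \<and> i \<in> set (star_hyperedges G ! s)))" for i
  have "w i = length (star_hyperedges G) + j" if "(i, j) \<in># arcs G" for i j
  proof -
    have "(THE j. (i, j) \<in># arcs G) = j" by (rule the_equality[of _ j]) (use that props(3) in blast)+
    then show ?thesis using that by (auto simp: w_def)
  qed
  moreover have "w i = s" if "s < length (star_hyperedges G)" "i \<in> set (star_hyperedges G ! s)" for i s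
  proof -
    have "\<nexists>j. (i, j) \<in># arcs G" using props(5) that by (meson nth_mem)
    moreover have "(THE s. s < length (star_hyperedges G) \<and> i \<in> set (star_hyperedges G ! s)) = s"
      by (rule the_equality[of _ s]) (use that distinct_concat_unique[OF props(6)] in blast)+
    ultimately show ?thesis by (simp add: w_def)
  qed
  ultimately have "marking G w" unfolding marking_def by blast
  then show ?thesis by blast
qed

text \<open>
  Two different vertices with the same mark lie in the same hyperedge, because the arcs have distinct partners.
  So the transposition changes only one determinant, by a sign.
\<close>

lemma word_value_swap_in_hyperedge:
  assumes G: "G \<in> matching_graphs k S T" and fin: "finite S" "finite T" and w: "marking G w"
    and a: "a \<in> words k" and xy: "x \<in> S" "y \<in> S" "x \<noteq> y" "w x = w y"
  shows "word_value k G (a \<circ> transpose x y) b = - word_value k G a b"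
proof -
  note props = matching_graphs_props[OF G fin]
  let ?Is = "star_hyperedges G"
  have arc_ge: "w i \<ge> length ?Is" if "(i, j) \<in># arcs G" for i j
    using marking_arc[OF w that] by simp
  have hyp_less: "\<exists>s<length ?Is. i \<in> set (?Is ! s) \<and> w i = s" if "I \<in> set ?Is" "i \<in> set I" for i I
    using that marking_hyperedge[OF w] by (metis in_set_conv_nth)
  have no_arc: "(x, j) \<notin># arcs G" for j
  proof
    assume x: "(x, j) \<in># arcs G"
    show False
    proof (cases rule: matching_graphs_cases[OF G fin xy(2)])
      case (1 j')
      then have "j = j'" using marking_arc[OF w x] marking_arc[OF w 1] xy(4) by simp
      then show False using props(4)[OF x] 1 xy(3) by blast
    next
      case (2 I)
      then show False using hyp_less[OF 2] arc_ge[OF x] xy(4) by auto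
    qed
  qed
  then obtain I where "I \<in> set ?Is" "x \<in> set I"
    using matching_graphs_cases[OF G fin xy(1)] by metis
  then obtain s where s: "s < length ?Is" "x \<in> set (?Is ! s)" "w x = s" using hyp_less by blast
  have no_arc_y: "(y, j) \<notin># arcs G" for j using arc_ge[of y j] s xy(4) by auto
  then obtain I' where "I' \<in> set ?Is" "y \<in> set I'"
    using matching_graphs_cases[OF G fin xy(2)] by metis
  then have y: "y \<in> set (?Is ! s)" using hyp_less s xy(4) by metis
  let ?a = "a \<circ> transpose x y"
  have arcs: "(\<Prod>(i, j) \<in># arcs G. if ?a i = b j then 1 else 0 :: complex) =
      (\<Prod>(i, j) \<in># arcs G. if a i = b j then 1 else 0)"
  proof (rule arg_cong[of _ _ prod_mset], rule image_mset_cong, clarify)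
    fix i j assume "(i, j) \<in># arcs G"
    then have "i \<noteq> x" "i \<noteq> y" using no_arc no_arc_y by auto
    then show "(if ?a i = b j then 1 else 0 :: complex) = (if a i = b j then 1 else 0)" by simp
  qed
  have prod: "(\<Prod>I \<leftarrow> ?Is. word_det k c I) = word_det k c (?Is ! s) *
      (\<Prod>s'\<in>{..<length ?Is} - {s}. word_det k c (?Is ! s'))" for c
    using s(1) by (simp add: prod.list_conv_set_nth prod.remove atLeast0LessThan)
  have others: "(\<Prod>s'\<in>{..<length ?Is} - {s}. word_det k ?a (?Is ! s')) =
      (\<Prod>s'\<in>{..<length ?Is} - {s}. word_det k a (?Is ! s'))"
  proof (intro prod.cong refl word_det_cong)
    fix s' i assume s': "s' \<in> {..<length ?Is} - {s}" and i: "i \<in> set (?Is ! s')"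
    then have "i \<noteq> x" "i \<noteq> y"
      using distinct_concat_unique[OF props(6), of s s'] s y by auto
    then show "?a i = a i" by simp
  next
    fix s' assume "s' \<in> {..<length ?Is} - {s}"
    then show "length (?Is ! s') = k" using props(2) by simp
  qed
  have len: "length (?Is ! s) = k" using props(2) s(1) by simp
  have dist: "distinct (?Is ! s)" using props(6) s(1) by (simp add: distinct_concat_iff)
  have "word_det k ?a (?Is ! s) = - word_det k a (?Is ! s)"
    using alternatingD[OF word_det_alternating[OF dist len] a s(2) y xy(3)] .
  moreover have "unstar_hyperedges G = []" using G by (simp add: matching_graphs_def)
  ultimately show ?thesis unfolding word_value_def prod arcs others by simp
qed

text \<open>
  A permutation that preserves the levels of \<open>w\<close> is a product of transpositions of points of equal level: compose it
  with the transposition of a moved point and its image, which reduces the number of moved points.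
\<close>

lemma level_preserving_permutation_sign:
  assumes "finite X" "\<tau> permutes X" "w \<circ> \<tau> = w" "a \<in> words k"
    and swap: "\<And>x y a. x \<in> X \<Longrightarrow> y \<in> X \<Longrightarrow> x \<noteq> y \<Longrightarrow> w x = w y \<Longrightarrow> a \<in> words k \<Longrightarrow>
      f (a \<circ> transpose x y) = - f a"
  shows "f (a \<circ> \<tau>) = of_int (sign \<tau>) * (f a :: complex)"
  using assms(2-4)
proof (induction "card {x. \<tau> x \<noteq> x}" arbitrary: \<tau> a rule: less_induct)
  case less
  have sub: "{x. \<tau> x \<noteq> x} \<subseteq> X" using less.prems(1) by (auto simp: permutes_def)
  show ?case
  proof (cases "\<tau> = id")
    case False
    then obtain x where x: "\<tau> x \<noteq> x" by (auto simp: fun_eq_iff)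
    define y where "y = \<tau> x"
    have xX: "x \<in> X" using sub x by blast
    then have yX: "y \<in> X" unfolding y_def using permutes_in_image[OF less.prems(1)] by simp
    have wxy: "w x = w y" using fun_cong[OF less.prems(2), of x] by (simp add: y_def)
    define \<sigma> where "\<sigma> = transpose x y \<circ> \<tau>"
    have \<sigma>: "\<sigma> permutes X"
      unfolding \<sigma>_def using less.prems(1) permutes_swap_id[OF xX yX] by (rule permutes_compose)
    have \<tau>: "\<tau> = transpose x y \<circ> \<sigma>" by (simp add: \<sigma>_def flip: comp_assoc)
    have w\<sigma>: "w \<circ> \<sigma> = w"
    proof
      fix z
      have "w (transpose x y (\<tau> z)) = w (\<tau> z)" using wxy by (auto simp: transpose_def)
      then show "(w \<circ> \<sigma>) z = w z" using fun_cong[OF less.prems(2), of z] by (simp add: \<sigma>_def)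
    qed
    have "{z. \<sigma> z \<noteq> z} \<subset> {z. \<tau> z \<noteq> z}"
    proof
      show "{z. \<sigma> z \<noteq> z} \<subseteq> {z. \<tau> z \<noteq> z}"
      proof clarify
        fix z assume z: "\<sigma> z \<noteq> z" "\<tau> z = z"
        then have "z = x \<or> z = y" by (auto simp: \<sigma>_def transpose_def split: if_splits)
        then have "z = y" using z x by auto
        then have "\<tau> y = \<tau> x" using z by (simp add: y_def)
        then have "y = x" using permutes_inj[OF less.prems(1)] by (simp add: inj_eq)
        then show False using x by (simp add: y_def)
      qed
      have "\<sigma> x = x" by (simp add: \<sigma>_def y_def)
      then show "{z. \<sigma> z \<noteq> z} \<noteq> {z. \<tau> z \<noteq> z}" using x by blast
    qed
    then have card: "card {z. \<sigma> z \<noteq> z} < card {z. \<tau> z \<noteq> z}"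
      using finite_subset[OF sub assms(1)] by (rule psubset_card_mono[rotated])
    have xy: "x \<noteq> y" using x by (simp add: y_def)
    have "permutation \<sigma>" using \<sigma> assms(1) permutation_permutes by blast
    from sign_compose[OF permutation_swap_id[of x y] this]
    have "sign \<tau> = - sign \<sigma>"
      unfolding \<tau>[symmetric] using xy by (simp add: sign_swap_id)
    moreover have "f (a \<circ> \<tau>) = of_int (sign \<sigma>) * f (a \<circ> transpose x y)"
      using less.hyps[OF card \<sigma> w\<sigma> words_comp[OF less.prems(3)], of "transpose x y"]
      unfolding \<tau> comp_assoc .
    ultimately show ?thesis using swap[OF xX yX xy wxy less.prems(3)] by simp
  qed (simp add: sign_id)
qed

text \<open>
  Some letter occurs at two places \<open>x, y\<close> of \<open>X\<close>. Composing with the transposition of \<open>x\<close> and \<open>y\<close> permutes the summands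
  and negates each of them.
\<close>

lemma antisymmetrization_eq_0:
  fixes f :: "(nat \<Rightarrow> nat) \<Rightarrow> complex"
  assumes X: "finite X" "card X > k" and a: "a \<in> words k"
  shows "(\<Sum>\<tau> | \<tau> permutes X. of_int (sign \<tau>) * f (a \<circ> \<tau>)) = 0"
proof -
  have "\<not> inj_on a X"
  proof
    assume "inj_on a X"
    then have "card X \<le> card {..<k}"
      using a by (intro card_inj_on_le[of a]) (auto simp: words_def)
    with X show False by simp
  qed
  then obtain x y where xy: "x \<in> X" "y \<in> X" "x \<noteq> y" "a x = a y" by (auto simp: inj_on_def)
  let ?t = "transpose x y"
  have at: "a \<circ> ?t = a" using xy(4) by (rule comp_transpose_same)
  let ?h = "\<lambda>\<tau>. of_int (sign \<tau>) * f (a \<circ> \<tau>)"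
  have "(\<Sum>\<tau> | \<tau> permutes X. ?h \<tau>) = (\<Sum>\<tau> | \<tau> permutes X. ?h (?t \<circ> \<tau>))"
    using setum_permutations_compose_left[OF permutes_swap_id[OF xy(1,2)], of ?h] .
  also have "\<dots> = (\<Sum>\<tau> | \<tau> permutes X. - ?h \<tau>)"
  proof (intro sum.cong refl)
    fix \<tau> assume "\<tau> \<in> {\<tau>. \<tau> permutes X}"
    then have "permutation \<tau>" using X(1) permutation_permutes by blast
    from sign_compose[OF permutation_swap_id[of x y] this]
    have "sign (?t \<circ> \<tau>) = - sign \<tau>"
      using xy(3) by (simp add: sign_swap_id)
    moreover have "a \<circ> (?t \<circ> \<tau>) = a \<circ> \<tau>" by (simp add: at flip: comp_assoc)
    ultimately show "?h (?t \<circ> \<tau>) = - ?h \<tau>" by simp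
  qed
  finally show ?thesis by (simp add: sum_negf)
qed

lemma lex_first_difference:
  assumes "i \<in> {1..p}" "\<And>i'. 1 \<le> i' \<Longrightarrow> i' < i \<Longrightarrow> v' i' = v i'" "v' i < (v i :: nat)"
  shows "(map v' [1..<Suc p], map v [1..<Suc p]) \<in> lex less_than"
proof -
  have split: "[1..<Suc p] = [1..<i] @ i # [Suc i..<Suc p]"
    using assms(1) upt_add_eq_append[of 1 i "Suc p - i"] upt_conv_Cons[of i "Suc p"] by simp
  have same: "map v' [1..<i] = map v [1..<i]" using assms(2) by auto
  have "map v' [1..<Suc p] = map v [1..<i] @ v' i # map v' [Suc i..<Suc p]"
    "map v [1..<Suc p] = map v [1..<i] @ v i # map v [Suc i..<Suc p]"
    unfolding split map_append list.map same by simp_all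
  then show ?thesis
    unfolding lex_conv using assms(3)
    by (intro CollectI case_prodI conjI exI) (simp, assumption, assumption, simp)
qed

text \<open>
  Among all rearrangements of a finite sequence the weakly decreasing one is lexicographically largest.
\<close>

lemma permuted_antimono_lex:
  assumes X: "X \<subseteq> {1..p}" and anti: "\<And>x y. x \<in> X \<Longrightarrow> y \<in> X \<Longrightarrow> x < y \<Longrightarrow> w y \<le> (w x :: nat)"
    and \<tau>: "\<tau> permutes X" and ne: "w \<circ> \<tau> \<noteq> w"
  shows "(map (w \<circ> \<tau>) [1..<Suc p], map w [1..<Suc p]) \<in> lex less_than"
proof -
  define x where "x = (LEAST x. w (\<tau> x) \<noteq> w x)"
  obtain x0 where "w (\<tau> x0) \<noteq> w x0" using ne by (auto simp: fun_eq_iff)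
  then have x: "w (\<tau> x) \<noteq> w x" unfolding x_def by (rule LeastI)
  have before: "w (\<tau> z) = w z" if "z < x" for z using that not_less_Least unfolding x_def by blast
  have xX: "x \<in> X" using x \<tau> by (metis permutes_not_in)
  have fin: "finite X" using X finite_subset by blast
  have "w (\<tau> x) < w x"
  proof (rule ccontr)
    assume "\<not> w (\<tau> x) < w x"
    then have gt: "w (\<tau> x) > w x" using x by simp
    \<comment> \<open>A larger mark than \<open>w x\<close> occurs only before \<open>x\<close>, where \<open>w \<circ> \<tau>\<close> agrees with \<open>w\<close>, so \<open>\<tau>\<close> already maps these places onto themselves.\<close>
    define Y where "Y = {y \<in> X. w y > w x}"
    have lt: "y < x" if "y \<in> Y" for y
    proof (rule ccontr)
      assume "\<not> y < x"
      then consider "y = x" | "x < y" by linarith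
      then show False using that anti[OF xX, of y] by cases (auto simp: Y_def)
    qed
    have "\<tau> ` Y \<subseteq> Y"
      using lt before permutes_in_image[OF \<tau>] by (auto simp: Y_def)
    then have "\<tau> ` Y = Y"
      using fin permutes_inj_on[OF \<tau>] by (intro card_subset_eq) (auto simp: Y_def card_image)
    moreover have "\<tau> x \<in> Y" using gt xX permutes_in_image[OF \<tau>] by (simp add: Y_def)
    ultimately obtain y where "y \<in> Y" "\<tau> y = \<tau> x" by (metis imageE)
    then have "x \<in> Y" using permutes_inj[OF \<tau>] by (simp add: inj_eq)
    then show False by (simp add: Y_def)
  qed
  then show ?thesis using xX X before by (intro lex_first_difference[of x]) auto
qed


section \<open>Straightening\<close>

text \<open>
  The degrees of a graph are the multiplicities in the two multisets that define \<open>matching_graphs\<close>.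
\<close>

lemma one_regular_iff_matching:
  assumes G: "is_sl_graph k p q G" and "unstar_hyperedges G = []"
  shows "one_regular p q G \<longleftrightarrow> G \<in> matching_graphs k {1..p} {1..q}"
proof -
  have hyp: "I \<in> hyperedges p k" if "I \<in> set (star_hyperedges G)" for I
    using G that by (auto simp: is_sl_graph_def hyperedge_chain_def)
  then have len: "\<forall>I\<in>set (star_hyperedges G). length I = k" and sub: "\<forall>I\<in>set (star_hyperedges G). set I \<subseteq> {1..p}"
    by (auto simp: hyperedges_def)
  have dist: "\<forall>I\<in>set (star_hyperedges G). distinct I"
    using hyp strict_sorted_iff by (auto simp: hyperedges_def)
  have arcs: "set_mset (arcs G) \<subseteq> {1..p} \<times> {1..q}" using G by (simp add: is_sl_graph_def)
  let ?M = "image_mset fst (arcs G) + mset (concat (star_hyperedges G))" and ?N = "image_mset snd (arcs G)"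
  have deg: "degree_star G i = count ?M i" "degree_unstar G j = count ?N j" for i j
    using assms(2) length_filter_mem[OF dist]
    by (simp_all add: degree_star_def degree_unstar_def size_filter_fst)
  have "count ?M i = 0" if "i \<notin> {1..p}" for i
  proof -
    have "i \<notin># ?M" using that arcs sub by fastforce
    then show ?thesis by (simp only: not_in_iff)
  qed
  then have M: "(\<forall>i\<in>{1..p}. degree_star G i = 1) \<longleftrightarrow> ?M = mset_set {1..p}"
    unfolding deg multiset_eq_iff count_mset_set_if[OF finite_atLeastAtMost] by metis
  have "count ?N j = 0" if "j \<notin> {1..q}" for j
  proof -
    have "j \<notin># ?N" using that arcs by fastforce
    then show ?thesis by (simp only: not_in_iff)
  qed
  then have N: "(\<forall>j\<in>{1..q}. degree_unstar G j = 1) \<longleftrightarrow> ?N = mset_set {1..q}"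
    unfolding deg multiset_eq_iff count_mset_set_if[OF finite_atLeastAtMost] by metis
  show ?thesis
    unfolding one_regular_def M N matching_graphs_def using len assms(2) by auto
qed

lemma sort_hyperedges_matching:
  "G \<in> matching_graphs k S T \<Longrightarrow>
    SL_Graph (arcs G) (map sort (star_hyperedges G)) [] \<in> matching_graphs k S T"
proof -
  have "mset (concat (map sort Is)) = mset (concat Is)" for Is :: "nat list list"
    by (induction Is) auto
  then show "G \<in> matching_graphs k S T \<Longrightarrow> ?thesis" by (auto simp: matching_graphs_def)
qed

text \<open>
  Sorting a hyperedge changes its determinant by a sign. Only a constant factor is claimed, which follows from the
  uniqueness of alternating functions without keeping track of the sorting permutation.
\<close>

lemma word_value_sort_hyperedges:
  assumes G: "G \<in> matching_graphs k S T" and fin: "finite S" "finite T" and k: "k \<ge> 1"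
  shows "\<exists>c. \<forall>a\<in>words k. \<forall>b. word_value k G a b =
    c * word_value k (SL_Graph (arcs G) (map sort (star_hyperedges G)) []) a b"
proof -
  note props = matching_graphs_props[OF G fin]
  define z :: "nat \<Rightarrow> nat" where "z = (\<lambda>_. 0)"
  have z: "z \<in> words k" using k by (auto simp: words_def z_def)
  define c where "c I = word_det k (fill_in_order (sort I) z) I" for I
  have 1: "word_det k a I = c I * word_det k a (sort I)"
    if a: "a \<in> words k" and I: "I \<in> set (star_hyperedges G)" for a I
  proof -
    have "distinct I" using props(6) I by (simp add: distinct_concat_iff)
    moreover have len: "length I = k" using props(2)[OF I] by simp
    ultimately have J: "distinct (sort I)" "length (sort I) = k" and
      alt: "alternating k (set (sort I)) (\<lambda>a. word_det k a I)"
      using word_det_alternating[of I k] by simp_all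
    have "fill_in_order (sort I) a i = fill_in_order (sort I) z i" if "i \<in> set I" for i
      using that by (simp add: fill_in_order_def)
    then have "word_det k (fill_in_order (sort I) a) I = c I"
      unfolding c_def using len by (intro word_det_cong) auto
    then show ?thesis using alternating_eq_word_det[OF J alt a] by simp
  qed
  have "(\<Prod>I \<leftarrow> Is. word_det k a I) = (\<Prod>I \<leftarrow> Is. c I) * (\<Prod>I \<leftarrow> map sort Is. word_det k a I)"
    if "a \<in> words k" "set Is \<subseteq> set (star_hyperedges G)" for a Is
    using that(2) by (induction Is) (use 1[OF that(1)] in auto)
  moreover have "unstar_hyperedges G = []" using G by (simp add: matching_graphs_def)
  ultimately have "\<forall>a\<in>words k. \<forall>b. word_value k G a b = (\<Prod>I \<leftarrow> star_hyperedges G. c I) *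
      word_value k (SL_Graph (arcs G) (map sort (star_hyperedges G)) []) a b"
    by (simp add: word_value_def)
  then show ?thesis by blast
qed

lemma antimono_on_nat_iff:
  "antimono_on X w \<longleftrightarrow> (\<forall>x\<in>X. \<forall>y\<in>X. x < y \<longrightarrow> w y \<le> w x)" for w :: "nat \<Rightarrow> nat"
  unfolding monotone_on_def by (auto simp: le_less)

text \<open>
  Each failure exhibits \<open>k + 1\<close> starred vertices with weakly decreasing marks. For a strict nesting of more than \<open>k\<close> arcs
  these are the starred ends. If position \<open>l\<close> of a hyperedge lies to the right of position \<open>l\<close> of a later
  hyperedge, take the first \<open>l + 1\<close> vertices of the later one followed by the vertices of the earlier one from position \<open>l\<close>
  on. If the hyperedge rule fails at an arc of layer \<open>l\<close>, take the starred ends of a nesting of \<open>l + 1\<close> arcs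
  that ends with this arc, followed by the vertices of the top hyperedge from position \<open>l\<close> on.
\<close>

lemma antimono_free_imp_sl_graph:
  assumes G: "G \<in> matching_graphs k {1..p} {1..q}" and w: "marking G w"
    and free: "\<And>X. X \<subseteq> {1..p} \<Longrightarrow> antimono_on X w \<Longrightarrow> card X \<le> k"
  shows "is_sl_graph k p q (SL_Graph (arcs G) (map sort (star_hyperedges G)) [])"
proof -
  note props = matching_graphs_props[OF G finite_atLeastAtMost finite_atLeastAtMost]
  let ?Is = "star_hyperedges G"
  define m where "m = length ?Is"
  have arcs: "set_mset (arcs G) \<subseteq> {1..p} \<times> {1..q}" using props(1) by auto
  have nest_anti: "antimono_on (fst ` C) w \<and> card (fst ` C) = card C \<and> fst ` C \<subseteq> {1..p}"
    if C: "C \<subseteq> set_mset (arcs G)" "strict_nesting C" for C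
  proof (intro conjI)
    show "antimono_on (fst ` C) w"
      unfolding antimono_on_nat_iff
    proof clarify
      fix i j i' j' assume *: "(i, j) \<in> C" "(i', j') \<in> C" "fst (i, j) < fst (i', j')"
      then have "j > j'" using C(2) unfolding strict_nesting_def by fastforce
      moreover have "w i = m + j" "w i' = m + j'" using * C(1) marking_arc[OF w] by (auto simp: m_def)
      ultimately show "w (fst (i', j')) \<le> w (fst (i, j))" by simp
    qed
    have "j = j'" if "(i, j) \<in> C" "(i, j') \<in> C" for i j j'
      using props(3) subsetD[OF C(1) that(1)] subsetD[OF C(1) that(2)] by blast
    then have "inj_on fst C" by (auto simp: inj_on_def)
    then show "card (fst ` C) = card C" by (rule card_image)
    show "fst ` C \<subseteq> {1..p}" using C(1) arcs by auto
  qed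
  have sorted_hyp: "length (sort (?Is ! s)) = k \<and> sorted_wrt (<) (sort (?Is ! s)) \<and> set (?Is ! s) \<subseteq> {1..p}"
    if "s < m" for s
  proof -
    have I: "?Is ! s \<in> set ?Is" using that by (simp add: m_def)
    then have "distinct (?Is ! s)" using props(6) by (simp add: distinct_concat_iff)
    then have "sorted_wrt (<) (sort (?Is ! s))" by (simp add: strict_sorted_iff)
    then show ?thesis using props(2)[OF I] by simp
  qed
  have mem: "sort (?Is ! s) ! l \<in> {1..p} \<and> w (sort (?Is ! s) ! l) = s" if "s < m" "l < k" for s l
  proof -
    have "sort (?Is ! s) ! l \<in> set (sort (?Is ! s))" using that sorted_hyp by (intro nth_mem) simp
    then show ?thesis using sorted_hyp[OF that(1)] marking_hyperedge[OF w] that(1) by (auto simp: m_def)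
  qed
  have tail: "card X + (k - l) \<le> k"
    if s: "s < m" and l: "l < k" and X: "X \<subseteq> {1..p}" "antimono_on X w"
      and less: "\<And>x. x \<in> X \<Longrightarrow> x < sort (?Is ! s) ! l" and ge: "\<And>x. x \<in> X \<Longrightarrow> s \<le> w x" for s l X
  proof -
    \<comment> \<open>the part of hyperedge \<open>s\<close> from position \<open>l\<close> on, which continues the weakly decreasing sequence on \<open>X\<close>\<close>
    define Y where "Y = (\<lambda>c. sort (?Is ! s) ! c) ` {l..<k}"
    note sh = sorted_hyp[OF s]
    have "inj_on (\<lambda>c. sort (?Is ! s) ! c) {l..<k}"
      using sh by (auto simp: inj_on_def strict_sorted_iff nth_eq_iff_index_eq)
    then have cardY: "card Y = k - l" by (simp add: Y_def card_image)
    have Yge: "sort (?Is ! s) ! l \<le> y" if "y \<in> Y" for y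
      using that sh sorted_wrt_nth_less[of "(<)" "sort (?Is ! s)" l] by (fastforce simp: Y_def le_less)
    have Yw: "y \<in> {1..p} \<and> w y = s" if "y \<in> Y" for y using that mem[OF s] by (auto simp: Y_def)
    have "antimono_on (X \<union> Y) w"
      unfolding antimono_on_nat_iff
    proof (intro ballI impI)
      fix x y assume *: "x \<in> X \<union> Y" "y \<in> X \<union> Y" "x < y"
      show "w y \<le> w x"
      proof (cases "y \<in> Y")
        case True
        then show ?thesis using * Yw ge by auto
      next
        case False
        then have "y \<in> X" using * by simp
        then have "x \<in> X" using * less[of y] Yge[of x] by fastforce
        then show ?thesis using X(2) \<open>y \<in> X\<close> *(3) by (simp add: antimono_on_nat_iff)
      qed
    qed
    moreover have "X \<union> Y \<subseteq> {1..p}" using X(1) Yw by auto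
    ultimately have "card (X \<union> Y) \<le> k" by (intro free)
    moreover have "X \<inter> Y = {}" using less Yge by fastforce
    moreover have "finite X" "finite Y" using X(1) finite_subset by (auto simp: Y_def)
    ultimately show ?thesis using cardY by (simp add: card_Un_disjoint)
  qed
  have "card C \<le> k" if "C \<subseteq> set_mset (arcs G)" "strict_nesting C" for C
    using nest_anti[OF that] free[of "fst ` C"] by simp
  moreover have "hyperedge_chain p k (map sort ?Is)"
    unfolding hyperedge_chain_def
  proof
    show "set (map sort ?Is) \<subseteq> hyperedges p k"
    proof
      fix J assume "J \<in> set (map sort ?Is)"
      then obtain s where "s < m" "J = sort (?Is ! s)" by (auto simp: in_set_conv_nth m_def)
      then show "J \<in> hyperedges p k" using sorted_hyp by (simp add: hyperedges_def)
    qed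
    show "sorted_wrt (list_all2 (\<le>)) (map sort ?Is)"
      unfolding sorted_wrt_map unfolding sorted_wrt_iff_nth_less
    proof (intro allI impI)
      fix s s' assume s: "s < s'" "s' < length ?Is"
      then have sm: "s < m" "s' < m" by (auto simp: m_def)
      show "list_all2 (\<le>) (sort (?Is ! s)) (sort (?Is ! s'))"
        unfolding list_all2_conv_all_nth
      proof (intro conjI allI impI)
        show "length (sort (?Is ! s)) = length (sort (?Is ! s'))" using sorted_hyp sm by simp
        fix l assume "l < length (sort (?Is ! s))"
        then have l: "l < k" using sorted_hyp[OF sm(1)] by simp
        show "sort (?Is ! s) ! l \<le> sort (?Is ! s') ! l"
        proof (rule ccontr)
          assume gt: "\<not> sort (?Is ! s) ! l \<le> sort (?Is ! s') ! l"
          define X where "X = (\<lambda>c. sort (?Is ! s') ! c) ` {..l}"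
          note sh = sorted_hyp[OF sm(2)]
          have "inj_on (\<lambda>c. sort (?Is ! s') ! c) {..l}"
            using sh l by (auto simp: inj_on_def strict_sorted_iff nth_eq_iff_index_eq)
          then have cardX: "card X = Suc l" by (simp add: X_def card_image)
          have Xw: "x \<in> {1..p} \<and> w x = s'" if "x \<in> X" for x using that mem[OF sm(2)] l by (auto simp: X_def)
          have "x \<le> sort (?Is ! s') ! l" if "x \<in> X" for x
            using that sh l sorted_wrt_nth_less[of "(<)" "sort (?Is ! s')" _ l] by (fastforce simp: X_def le_less)
          then have "card X + (k - l) \<le> k"
            using gt Xw s(1) by (intro tail[OF sm(1) l]) (fastforce simp: antimono_on_nat_iff)+
          then show False using cardX l by simp
        qed
      qed
    qed
  qed
  moreover have "last (map sort ?Is) ! l \<le> i"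
    if ne: "?Is \<noteq> []" and l: "l < k" and ij: "(i, j) \<in># layer_star l (arcs G)" for l i j
  proof (rule ccontr)
    assume gt: "\<not> last (map sort ?Is) ! l \<le> i"
    obtain C where C: "C \<subseteq> set_mset (arcs G)" "strict_nesting C" "card C = Suc l"
      "\<forall>(i', j') \<in> C. i' \<le> i \<and> j' \<ge> j"
      using mem_layer_star_nesting[OF ij] by blast
    have m: "m - 1 < m" using ne by (cases m) (auto simp: m_def)
    have last: "last (map sort ?Is) = sort (?Is ! (m - 1))" using ne by (simp add: last_conv_nth m_def)
    have "card (fst ` C) + (k - l) \<le> k"
    proof (rule tail[OF m l])
      fix x assume "x \<in> fst ` C"
      then obtain y where y: "(x, y) \<in> C" by auto
      show "x < sort (?Is ! (m - 1)) ! l" using bspec[OF C(4) y] gt last by simp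
      show "m - 1 \<le> w x" using marking_arc[OF w, of x y] y C(1) by (auto simp: m_def)
    qed (use nest_anti[OF C(1,2)] in auto)
    then show False using nest_anti[OF C(1,2)] C(3) l by simp
  qed
  ultimately show ?thesis
    using arcs by (auto simp: is_sl_graph_def hyperedge_rule_def hyperedge_chain_def)
qed

text \<open>
  Induction on the sequence of marks in the lexicographic order. If no \<open>k + 1\<close> marks decrease weakly, the graph with
  sorted hyperedges is a basis graph. Otherwise the antisymmetrisation over such vertices expresses the graph
  through graphs with smaller sequences of marks.
\<close>

theorem straightening:
  assumes k: "k \<ge> 1" and G: "G \<in> matching_graphs k {1..p} {1..q}"
  shows "word_span k (one_regular_sl_graphs k p q) (word_value k G)"
proof -
  let ?std = "one_regular_sl_graphs k p q"
  have "word_span k ?std (word_value k G)"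
    if "G \<in> matching_graphs k {1..p} {1..q}" "marking G w" for G w
    using that
  proof (induction "map w [1..<Suc p]" arbitrary: w G rule: wf_induct_rule[OF wf_lex[OF wf_less_than]])
    case (1 w G)
    note G = "1.prems"(1) and w = "1.prems"(2)
    have len: "\<forall>I\<in>set (star_hyperedges G). length I = k" using G by (simp add: matching_graphs_def)
    show ?case
    proof (cases "\<forall>X. X \<subseteq> {1..p} \<longrightarrow> antimono_on X w \<longrightarrow> card X \<le> k")
      case True
      let ?H = "SL_Graph (arcs G) (map sort (star_hyperedges G)) []"
      have "is_sl_graph k p q ?H" using True by (intro antimono_free_imp_sl_graph[OF G w]) auto
      then have "?H \<in> ?std"
        using one_regular_iff_matching[of k p q ?H] sort_hyperedges_matching[OF G]
        by (simp add: one_regular_sl_graphs_def)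
      then have H: "word_span k ?std (word_value k ?H)" by (rule word_span_base)
      obtain c where "\<forall>a\<in>words k. \<forall>b. word_value k G a b = c * word_value k ?H a b"
        using word_value_sort_hyperedges[OF G finite_atLeastAtMost finite_atLeastAtMost k] by blast
      then show ?thesis by (intro word_span_cong[OF word_span_scale[OF H, of c]]) simp
    next
      case False
      then obtain X where X: "X \<subseteq> {1..p}" "antimono_on X w" "card X > k" by auto
      have finX: "finite X" using X(1) finite_subset by blast
      define A where "A = {\<tau>. \<tau> permutes X}"
      \<comment> \<open>the permutations that keep the marks; each of them contributes the graph itself\<close>
      define A0 where "A0 = {\<tau> \<in> A. w \<circ> \<tau> = w}"
      have finA: "finite A" unfolding A_def by (rule finite_permutations[OF finX])
      have "id \<in> A0" by (simp add: A0_def A_def permutes_id)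
      moreover have "finite A0" using finA by (simp add: A0_def)
      ultimately have card: "card A0 \<noteq> 0" by auto
      have other: "word_span k ?std (\<lambda>a b. word_value k G (a \<circ> \<tau>) b)" if \<tau>: "\<tau> \<in> A - A0" for \<tau>
      proof -
        have perm: "\<tau> permutes X" and ne: "w \<circ> \<tau> \<noteq> w" using \<tau> by (auto simp: A_def A0_def)
        have perm': "\<tau> permutes {1..p}" using perm X(1) by (rule permutes_subset)
        let ?w = "w \<circ> inv_into UNIV \<tau>"
        have "?w \<noteq> w"
        proof
          assume "?w = w"
          then have "w \<circ> \<tau> = w \<circ> (inv_into UNIV \<tau> \<circ> \<tau>)" by (metis comp_assoc)
          then show False using ne permutes_inv_o(2)[OF perm] by simp
        qed
        then have "(map ?w [1..<Suc p], map w [1..<Suc p]) \<in> lex less_than"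
          using X(2) by (intro permuted_antimono_lex[OF X(1) _ permutes_inv[OF perm]]) (auto simp: antimono_on_nat_iff)
        then have "word_span k ?std (word_value k (relabel \<tau> G))"
          by (rule "1.hyps") (rule relabel_matching[OF G perm'], rule marking_relabel[OF w perm'])
        then show ?thesis by (rule word_span_cong) (simp add: word_value_relabel[OF len])
      qed
      have "word_span k ?std (\<lambda>a b. - (1 / of_nat (card A0)) *
          (\<Sum>\<tau>\<in>A - A0. of_int (sign \<tau>) * word_value k G (a \<circ> \<tau>) b))"
        by (intro word_span_scale word_span_sum other)
      then show ?thesis
      proof (rule word_span_cong)
        fix a b assume a: "a \<in> words k"
        let ?h = "\<lambda>\<tau>. of_int (sign \<tau>) * word_value k G (a \<circ> \<tau>) b"
        have "?h \<tau> = word_value k G a b" if "\<tau> \<in> A0" for \<tau>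
        proof -
          have "word_value k G (a \<circ> \<tau>) b = of_int (sign \<tau>) * word_value k G a b"
          proof (rule level_preserving_permutation_sign[OF finX, where f = "\<lambda>a. word_value k G a b" and w = w])
            show "\<tau> permutes X" "w \<circ> \<tau> = w" using that by (auto simp: A_def A0_def)
            show "word_value k G (a \<circ> transpose x y) b = - word_value k G a b"
              if "x \<in> X" "y \<in> X" "x \<noteq> y" "w x = w y" "a \<in> words k" for x y a
              using that X(1) by (intro word_value_swap_in_hyperedge[OF G _ _ w]) auto
          qed (rule a)
          moreover have "of_int (sign \<tau>) * of_int (sign \<tau>) = (1 :: complex)" by (simp add: sign_def)
          ultimately show ?thesis by (simp flip: mult.assoc)
        qed
        then have "(\<Sum>\<tau>\<in>A0. ?h \<tau>) = of_nat (card A0) * word_value k G a b" by simp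
        moreover have "(\<Sum>\<tau>\<in>A. ?h \<tau>) = 0"
          unfolding A_def by (rule antisymmetrization_eq_0[OF finX X(3) a])
        moreover have "(\<Sum>\<tau>\<in>A. ?h \<tau>) = (\<Sum>\<tau>\<in>A - A0. ?h \<tau>) + (\<Sum>\<tau>\<in>A0. ?h \<tau>)"
          using finA by (intro sum.subset_diff) (auto simp: A0_def)
        ultimately have eq: "of_nat (card A0) * word_value k G a b + (\<Sum>\<tau>\<in>A - A0. ?h \<tau>) = 0"
          by (simp only: add.commute)
        have "v = - (1 / c) * s" if "c * v + s = 0" "c \<noteq> 0" for c v s :: complex
          using that by (simp add: eq_neg_iff_add_eq_0 field_simps)
        from this[OF eq] show "word_value k G a b = - (1 / of_nat (card A0)) * (\<Sum>\<tau>\<in>A - A0. ?h \<tau>)"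
          using card by (simp only: of_nat_eq_0_iff not_False_eq_True)
      qed
    qed
  qed
  moreover obtain w where "marking G w" using marking_exists[OF G] by auto
  ultimately show ?thesis using G by blast
qed


section \<open>Canonical words and keys of basis graphs\<close>

definition arc_partner :: "sl_graph \<Rightarrow> nat \<Rightarrow> nat" where
  "arc_partner G i = (THE j. (i, j) \<in># arcs G)"

definition hyperedge_position :: "sl_graph \<Rightarrow> nat \<Rightarrow> nat" where
  "hyperedge_position G i = (THE r. \<exists>I\<in>set (star_hyperedges G). r < length I \<and> I ! r = i)"

definition starred_sl_graphs :: "nat \<Rightarrow> nat \<Rightarrow> nat \<Rightarrow> sl_graph set" where
  "starred_sl_graphs k p q = {G \<in> one_regular_sl_graphs k p q. unstar_hyperedges G = []}"

lemma starred_imp_matching: "G \<in> starred_sl_graphs k p q \<Longrightarrow> G \<in> matching_graphs k {1..p} {1..q}"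
  using one_regular_iff_matching[of k p q G] by (auto simp: starred_sl_graphs_def one_regular_sl_graphs_def)

lemma matching_graphs_size:
  assumes "G \<in> matching_graphs k S T"
  shows "size (arcs G) + k * length (star_hyperedges G) = card S" "size (arcs G) = card T"
proof -
  have "size (mset (concat Is)) = k * length Is" if "\<forall>I\<in>set Is. length I = k" for Is :: "nat list list"
    using that by (induction Is) auto
  moreover have "size (image_mset fst (arcs G) + mset (concat (star_hyperedges G))) = size (mset_set S)"
    "size (image_mset snd (arcs G)) = size (mset_set T)"
    using assms by (auto simp: matching_graphs_def)
  ultimately show "size (arcs G) + k * length (star_hyperedges G) = card S" "size (arcs G) = card T"
    using assms by (auto simp: matching_graphs_def)
qed

lemma arc_partner_eq:
  assumes "G \<in> matching_graphs k S T" "finite S" "finite T" "(i, j) \<in># arcs G"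
  shows "arc_partner G i = j"
  unfolding arc_partner_def
  by (rule the_equality) (use assms(4) matching_graphs_props(3)[OF assms(1-3)] in blast)+

lemma hyperedge_unique:
  assumes G: "G \<in> matching_graphs k S T" "finite S" "finite T"
    and I: "I \<in> set (star_hyperedges G)" "I' \<in> set (star_hyperedges G)" "r < k" "r' < k" "I ! r = I' ! r'"
  shows "I = I' \<and> r = r'"
proof -
  note props = matching_graphs_props[OF G]
  have len: "length I = k" "length I' = k" using props(2) I by auto
  obtain s s' where s: "s < length (star_hyperedges G)" "star_hyperedges G ! s = I"
    "s' < length (star_hyperedges G)" "star_hyperedges G ! s' = I'"
    using I(1,2) by (metis in_set_conv_nth)
  have "I ! r \<in> set I" "I ! r \<in> set I'" using I len by (metis nth_mem)+
  then have "s = s'" using distinct_concat_unique[OF props(6) s(1,3)] s by blast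
  then have eq: "I = I'" using s by simp
  have "distinct I" using props(6) I(1) by (simp add: distinct_concat_iff)
  then show ?thesis using eq I len by (simp add: nth_eq_iff_index_eq)
qed

lemma hyperedge_position_eq:
  assumes G: "G \<in> matching_graphs k S T" "finite S" "finite T"
    and I: "I \<in> set (star_hyperedges G)" "r < k"
  shows "hyperedge_position G (I ! r) = r"
proof -
  have "length I = k" if "I \<in> set (star_hyperedges G)" for I
    using matching_graphs_props(2)[OF G that] by simp
  then show ?thesis
    unfolding hyperedge_position_def using I hyperedge_unique[OF G]
    by (intro the_equality) (metis, metis)
qed

lemma hyperedge_vertex_no_arc:
  assumes G: "G \<in> matching_graphs k S T" "finite S" "finite T"
    and I: "I \<in> set (star_hyperedges G)" "r < k"
  shows "(I ! r, j) \<notin># arcs G"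
  using matching_graphs_props(2,5)[OF G] I by (metis nth_mem)

lemma starred_vertex_cases:
  assumes G: "G \<in> matching_graphs k S T" "finite S" "finite T" and i: "i \<in> S"
  obtains (arc) j where "(i, j) \<in># arcs G"
  | (hyperedge) I r where "I \<in> set (star_hyperedges G)" "r < k" "i = I ! r"
proof (cases rule: matching_graphs_cases[OF G i])
  case (2 I)
  then show ?thesis using that(2) matching_graphs_props(2)[OF G 2(1)] by (metis in_set_conv_nth)
qed (use that(1) in blast)

text \<open>
  A pair of words by which a basis graph is recognised: every hyperedge carries the letters \<open>0, \<dots>, k - 1\<close> in order, and
  an arc carries the same letter, standing for its layer, at both ends. Two properties of layers are recorded: arcs of
  the same layer do not nest strictly, and the arc ends with letter \<open>l\<close> are not to the left of position \<open>l\<close> of the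
  top hyperedge.
\<close>

definition layer_colouring :: "nat \<Rightarrow> sl_graph \<Rightarrow> (nat \<Rightarrow> nat) \<Rightarrow> (nat \<Rightarrow> nat) \<Rightarrow> bool" where
  "layer_colouring k G a b \<longleftrightarrow> a \<in> words k \<and> b \<in> words k \<and>
    (\<forall>I\<in>set (star_hyperedges G). \<forall>r<k. a (I ! r) = r) \<and>
    (\<forall>i j. (i, j) \<in># arcs G \<longrightarrow> a i = b j) \<and>
    (\<forall>i j i' j'. (i, j) \<in># arcs G \<longrightarrow> (i', j') \<in># arcs G \<longrightarrow> b j = b j' \<longrightarrow> \<not> (i' < i \<and> j' > j)) \<and>
    (\<forall>i j. star_hyperedges G \<noteq> [] \<longrightarrow> (i, j) \<in># arcs G \<longrightarrow> last (star_hyperedges G) ! a i \<le> i)"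

lemma layer_colouringD:
  assumes "layer_colouring k G a b"
  shows "a \<in> words k" "b \<in> words k"
    and "I \<in> set (star_hyperedges G) \<Longrightarrow> r < k \<Longrightarrow> a (I ! r) = r"
    and "(i, j) \<in># arcs G \<Longrightarrow> a i = b j"
    and "(i, j) \<in># arcs G \<Longrightarrow> (i', j') \<in># arcs G \<Longrightarrow> b j = b j' \<Longrightarrow> \<not> (i' < i \<and> j' > j)"
    and "star_hyperedges G \<noteq> [] \<Longrightarrow> (i, j) \<in># arcs G \<Longrightarrow> last (star_hyperedges G) ! a i \<le> i"
  using assms unfolding layer_colouring_def by blast+

text \<open>
  Every arc lies in some layer, and the bound on strict nestings keeps the number of the layer below \<open>k\<close>.
\<close>

lemma layer_colouring_exists:
  assumes G: "G \<in> starred_sl_graphs k p q" and k: "k \<ge> 1"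
  shows "\<exists>a b. layer_colouring k G a b"
proof -
  have M: "G \<in> matching_graphs k {1..p} {1..q}" "finite {1..p}" "finite {1..q}"
    using starred_imp_matching[OF G] by auto
  note props = matching_graphs_props[OF M]
  have sl: "is_sl_graph k p q G" using G by (simp add: starred_sl_graphs_def one_regular_sl_graphs_def)
  define col where "col e = (SOME l. e \<in># layer_star l (arcs G))" for e
  have col: "e \<in># layer_star (col e) (arcs G)" if "e \<in># arcs G" for e
    unfolding col_def using exists_layer_star[OF that] by (rule someI_ex)
  have col_less: "col (i, j) < k" if ij: "(i, j) \<in># arcs G" for i j
  proof -
    obtain C where "C \<subseteq> set_mset (arcs G)" "strict_nesting C" "card C = Suc (col (i, j))"
      using mem_layer_star_nesting[OF col[OF ij]] by blast
    moreover have "\<forall>C \<subseteq> set_mset (arcs G). strict_nesting C \<longrightarrow> card C \<le> k"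
      using sl by (simp add: is_sl_graph_def)
    ultimately show ?thesis by auto
  qed
  define a where "a i = (if \<exists>j. (i, j) \<in># arcs G then col (i, arc_partner G i)
    else if \<exists>I\<in>set (star_hyperedges G). i \<in> set I then hyperedge_position G i else 0)" for i
  define b where "b j = (if \<exists>i. (i, j) \<in># arcs G then col (THE i. (i, j) \<in># arcs G, j) else 0)" for j
  have a_arc: "a i = col (i, j)" if "(i, j) \<in># arcs G" for i j
    using that arc_partner_eq[OF M that] by (auto simp: a_def)
  have a_hyp: "a (I ! r) = r" if "I \<in> set (star_hyperedges G)" "r < k" for I r
  proof -
    have "I ! r \<in> set I" using that props(2)[OF that(1)] by simp
    then show ?thesis
      using hyperedge_vertex_no_arc[OF M that] hyperedge_position_eq[OF M that] that by (auto simp: a_def)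
  qed
  have b_arc: "b j = col (i, j)" if "(i, j) \<in># arcs G" for i j
  proof -
    have "(THE i. (i, j) \<in># arcs G) = i"
      by (rule the_equality) (use that props(4) in blast)+
    then show ?thesis using that by (auto simp: b_def)
  qed
  have "a i < k" for i
  proof (cases "\<exists>j. (i, j) \<in># arcs G")
    case True
    then show ?thesis using a_arc col_less by auto
  next
    case no_arc: False
    show ?thesis
    proof (cases "\<exists>I\<in>set (star_hyperedges G). i \<in> set I")
      case True
      then obtain I r where "I \<in> set (star_hyperedges G)" "r < length I" "I ! r = i" by (metis in_set_conv_nth)
      then show ?thesis using a_hyp[of I r] props(2)[of I] by auto
    qed (use no_arc k in \<open>simp add: a_def\<close>)
  qed
  then have "a \<in> words k" by (simp add: words_def)
  moreover have "b j < k" for j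
  proof (cases "\<exists>i. (i, j) \<in># arcs G")
    case True
    then show ?thesis using b_arc col_less by auto
  qed (use k in \<open>simp add: b_def\<close>)
  then have "b \<in> words k" by (simp add: words_def)
  moreover have "\<not> (i' < i \<and> j' > j)"
    if "(i, j) \<in># arcs G" "(i', j') \<in># arcs G" "b j = b j'" for i j i' j'
    using layer_star_not_nested[OF col[OF that(1)]] col[OF that(2)] that(3)
    unfolding b_arc[OF that(1)] b_arc[OF that(2)] by simp
  moreover have "last (star_hyperedges G) ! a i \<le> i"
    if "star_hyperedges G \<noteq> []" "(i, j) \<in># arcs G" for i j
  proof -
    have "hyperedge_rule k G" using sl by (simp add: is_sl_graph_def)
    then have "\<forall>l<k. \<forall>(i, j) \<in># layer_star l (arcs G). last (star_hyperedges G) ! l \<le> i"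
      using that(1) by (simp add: hyperedge_rule_def)
    then show ?thesis
      using col[OF that(2)] col_less[OF that(2)] unfolding a_arc[OF that(2)] by blast
  qed
  ultimately show ?thesis
    unfolding layer_colouring_def using a_arc b_arc a_hyp by (intro exI[of _ a] exI[of _ b] conjI) auto
qed

text \<open>
  Arc ends are ordered against their partners and come below all hyperedge vertices, which are ordered by their position.
  Keys are compared lexicographically along the starred vertices. The subtraction is exact, since partners
  are at most \<open>q\<close>, and since they are at least 1 the two ranges are disjoint.
\<close>

definition graph_key :: "nat \<Rightarrow> sl_graph \<Rightarrow> nat \<Rightarrow> nat" where
  "graph_key q G i = (if \<exists>j. (i, j) \<in># arcs G then q - arc_partner G i else q + hyperedge_position G i)"

lemma graph_key_arc:
  assumes "G \<in> matching_graphs k S T" "finite S" "finite T" "(i, j) \<in># arcs G"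
  shows "graph_key q G i = q - j"
  using assms(4) arc_partner_eq[OF assms] by (auto simp: graph_key_def)

lemma graph_key_hyperedge:
  assumes "G \<in> matching_graphs k S T" "finite S" "finite T" "I \<in> set (star_hyperedges G)" "r < k"
  shows "graph_key q G (I ! r) = q + r"
  using hyperedge_vertex_no_arc[OF assms] hyperedge_position_eq[OF assms] by (auto simp: graph_key_def)

text \<open>
  The key shows the arcs and the set of vertices at each position \<open>r\<close> of the hyperedges. By the chain condition the
  hyperedges, read in order, list this set increasingly, so the set determines all entries at position \<open>r\<close>.
\<close>

lemma graph_key_inj:
  assumes G: "G \<in> starred_sl_graphs k p q" and H: "H \<in> starred_sl_graphs k p q" and k: "k \<ge> 1"
    and eq: "\<And>i. i \<in> {1..p} \<Longrightarrow> graph_key q G i = graph_key q H i"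
  shows "G = H"
proof -
  have M: "G \<in> matching_graphs k {1..p} {1..q}" "finite {1..p}" "finite {1..q}"
    and N: "H \<in> matching_graphs k {1..p} {1..q}" "finite {1..p}" "finite {1..q}"
    using starred_imp_matching G H by auto
  have arcs: "(i, j) \<in># arcs H"
    if M: "G \<in> matching_graphs k {1..p} {1..q}" "finite {1..p}" "finite {1..q}"
      and N: "H \<in> matching_graphs k {1..p} {1..q}" "finite {1..p}" "finite {1..q}"
      and ij: "(i, j) \<in># arcs G" and eq: "\<And>i. i \<in> {1..p} \<Longrightarrow> graph_key q G i = graph_key q H i"
    for G H i j
  proof -
    have i: "i \<in> {1..p}" and j: "j \<in> {1..q}" using matching_graphs_props(1)[OF M ij] by auto
    have key: "graph_key q H i = q - j" using graph_key_arc[OF M ij] eq[OF i] by simp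
    show ?thesis
    proof (cases rule: starred_vertex_cases[OF N i])
      case (1 j')
      then have "q - j' = q - j" "j' \<in> {1..q}"
        using key graph_key_arc[OF N 1] matching_graphs_props(1)[OF N 1] by auto
      then have "j' = j" using j by auto
      then show ?thesis using 1 by simp
    next
      case (2 I r)
      then show ?thesis using key graph_key_hyperedge[OF N 2(1,2), of q] j by auto
    qed
  qed
  have "count (arcs G) e = count (arcs H) e" for e
  proof -
    have "e \<in># arcs G \<longleftrightarrow> e \<in># arcs H"
      using arcs[OF M N _ eq] arcs[OF N M _ eq[symmetric]] by (cases e) blast
    then have "count (arcs G) e = 0 \<longleftrightarrow> count (arcs H) e = 0"
      by (simp only: count_eq_zero_iff)
    moreover have "count (arcs G) e \<le> 1" "count (arcs H) e \<le> 1"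
      using matching_graphs_props(8)[OF M] matching_graphs_props(8)[OF N] by auto
    ultimately show ?thesis by linarith
  qed
  then have "arcs G = arcs H" by (simp add: multiset_eq_iff)
  moreover have "unstar_hyperedges G = unstar_hyperedges H"
    using G H by (simp add: starred_sl_graphs_def)
  moreover have "star_hyperedges G = star_hyperedges H"
  proof -
    have row: "sorted_wrt (<) (map (\<lambda>I. I ! r) (star_hyperedges G)) \<and>
        set (map (\<lambda>I. I ! r) (star_hyperedges G)) = {i \<in> {1..p}. graph_key q G i = q + r}"
      if G: "G \<in> starred_sl_graphs k p q" and r: "r < k" for G r
    proof
      have M: "G \<in> matching_graphs k {1..p} {1..q}" "finite {1..p}" "finite {1..q}"
        using starred_imp_matching G by auto
      note props = matching_graphs_props[OF M]
      let ?Is = "star_hyperedges G"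
      have chain: "sorted_wrt (list_all2 (\<le>)) ?Is"
        using G by (simp add: starred_sl_graphs_def one_regular_sl_graphs_def is_sl_graph_def hyperedge_chain_def)
      show "sorted_wrt (<) (map (\<lambda>I. I ! r) ?Is)"
        unfolding sorted_wrt_map unfolding sorted_wrt_iff_nth_less
      proof (intro allI impI)
        fix s s' assume s: "s < s'" "s' < length ?Is"
        have mem: "?Is ! s \<in> set ?Is" "?Is ! s' \<in> set ?Is" using s by auto
        have len: "length (?Is ! s) = k" "length (?Is ! s') = k" using mem props(2) by auto
        have "list_all2 (\<le>) (?Is ! s) (?Is ! s')" using chain s by (simp add: sorted_wrt_iff_nth_less)
        then have "?Is ! s ! r \<le> ?Is ! s' ! r" using r len by (simp add: list_all2_conv_all_nth)
        moreover have "?Is ! s ! r \<noteq> ?Is ! s' ! r"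
        proof
          assume "?Is ! s ! r = ?Is ! s' ! r"
          then have "?Is ! s ! r \<in> set (?Is ! s)" "?Is ! s ! r \<in> set (?Is ! s')"
            using r len by (auto intro: nth_mem simp del: nth_mem) (metis nth_mem)
          then show False using distinct_concat_unique[OF props(6), of s s'] s by auto
        qed
        ultimately show "?Is ! s ! r < ?Is ! s' ! r" by simp
      qed
      show "set (map (\<lambda>I. I ! r) ?Is) = {i \<in> {1..p}. graph_key q G i = q + r}"
      proof (intro equalityI subsetI)
        fix i assume "i \<in> set (map (\<lambda>I. I ! r) ?Is)"
        then obtain I where I: "I \<in> set ?Is" "i = I ! r" by auto
        then have "i \<in> set I" using props(2)[OF I(1)] r by simp
        then have "i \<in> {1..p}" using props(2)[OF I(1)] by blast
        then show "i \<in> {i \<in> {1..p}. graph_key q G i = q + r}"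
          using graph_key_hyperedge[OF M I(1) r] I(2) by simp
      next
        fix i assume "i \<in> {i \<in> {1..p}. graph_key q G i = q + r}"
        then have i: "i \<in> {1..p}" and key: "graph_key q G i = q + r" by auto
        show "i \<in> set (map (\<lambda>I. I ! r) ?Is)"
        proof (cases rule: starred_vertex_cases[OF M i])
          case (1 j)
          then have "q - j = q + r" "j \<in> {1..q}" using key graph_key_arc[OF M 1] props(1)[OF 1] by auto
          then show ?thesis by auto
        next
          case (2 I r')
          then have "r' = r" using key graph_key_hyperedge[OF M 2(1,2), of q] by simp
          then show ?thesis using 2 by auto
        qed
      qed
    qed
    have sets: "{i \<in> {1..p}. graph_key q G i = q + r} = {i \<in> {1..p}. graph_key q H i = q + r}" for r
      using eq by auto
    have rows: "map (\<lambda>I. I ! r) (star_hyperedges G) = map (\<lambda>I. I ! r) (star_hyperedges H)" if r: "r < k" for r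
      using row[OF G r] row[OF H r] sets[of r]
      by (intro sorted_distinct_set_unique) (auto simp: strict_sorted_iff)
    have len: "length (star_hyperedges G) = length (star_hyperedges H)"
      using arg_cong[OF rows[of 0], of length] k by simp
    show ?thesis
    proof (rule nth_equalityI[OF len])
      fix s assume s: "s < length (star_hyperedges G)"
      have "length (star_hyperedges G ! s) = k" "length (star_hyperedges H ! s) = k"
        using matching_graphs_props(2)[OF M] matching_graphs_props(2)[OF N] s len by auto
      moreover have "star_hyperedges G ! s ! r = star_hyperedges H ! s ! r" if "r < k" for r
        using arg_cong[OF rows[OF that], of "\<lambda>xs. xs ! s"] s len by simp
      ultimately show "star_hyperedges G ! s = star_hyperedges H ! s" by (intro nth_equalityI) auto
    qed
  qed
  ultimately show ?thesis by (simp add: sl_graph.expand)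
qed


section \<open>Triangularity and linear independence\<close>

text \<open>
  Let \<open>i\<close> be the first starred vertex at which the keys differ. If \<open>i\<close> is the end of an arc of \<open>G\<close> and of a different
  arc of \<open>H\<close>, the partner in \<open>H\<close> has the same colour; in \<open>G\<close> the arcs of one colour join their ends in increasing order and
  the earlier ends are joined alike in \<open>H\<close>, so the partner in \<open>H\<close> is larger. The vertex \<open>i\<close> cannot lie on a
  hyperedge of \<open>H\<close> if it is an arc end of \<open>G\<close>: the hyperedge rule puts all hyperedge vertices of the colour of \<open>i\<close> before
  \<open>i\<close>, where \<open>H\<close> agrees with \<open>G\<close>, and \<open>H\<close> has no room for another one. If \<open>i\<close> lies at position \<open>r\<close> of a hyperedge of \<open>G\<close>
  and at position \<open>r'\<close> of a hyperedge of \<open>H\<close>, then \<open>r < r'\<close> is impossible, since the latter hyperedge would contain the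
  letter \<open>r\<close> twice.
\<close>

lemma graph_key_decreases:
  assumes G: "G \<in> starred_sl_graphs k p q" and H: "H \<in> starred_sl_graphs k p q" and k: "k \<ge> 1"
    and col: "layer_colouring k G a b"
    and val: "word_value k H a b \<noteq> 0"
    and i: "i \<in> {1..p}" and before: "\<And>i'. i' \<in> {1..p} \<Longrightarrow> i' < i \<Longrightarrow> graph_key q H i' = graph_key q G i'"
    and ne: "graph_key q H i \<noteq> graph_key q G i"
  shows "graph_key q H i < graph_key q G i"
proof -
  note w = layer_colouringD(1,2)[OF col] and a_hyp = layer_colouringD(3)[OF col]
    and a_arc = layer_colouringD(4)[OF col] and layer = layer_colouringD(5)[OF col]
    and rule = layer_colouringD(6)[OF col]
  have M: "G \<in> matching_graphs k {1..p} {1..q}" "finite {1..p}" "finite {1..q}"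
    and N: "H \<in> matching_graphs k {1..p} {1..q}" "finite {1..p}" "finite {1..q}"
    using starred_imp_matching G H by auto
  note propsG = matching_graphs_props[OF M] and propsH = matching_graphs_props[OF N]
  have H_arc: "a i = b j" if "(i, j) \<in># arcs H" for i j
  proof (rule ccontr)
    assume "a i \<noteq> b j"
    then have "0 \<in># image_mset (\<lambda>(i, j). if a i = b j then 1 else 0 :: complex) (arcs H)"
      using that by force
    then have "(\<Prod>(i, j) \<in># arcs H. if a i = b j then 1 else 0 :: complex) = 0"
      by (simp only: prod_mset_zero_iff)
    then show False using val by (simp add: word_value_def)
  qed
  have H_inj: "inj_on a (set J)" if J: "J \<in> set (star_hyperedges H)" for J
  proof (rule word_det_nonzero_inj[OF _ _ w(1)])
    show "distinct J" using propsH(6) J by (simp add: distinct_concat_iff)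
    show "length J = k" using propsH(2)[OF J] by simp
    have "(\<Prod>I \<leftarrow> star_hyperedges H. word_det k a I) \<noteq> 0" using val by (simp add: word_value_def)
    then show "word_det k a J \<noteq> 0" using J by (auto simp: prod_list_zero_iff)
  qed
  have strictH: "J ! r < J ! r'" if "J \<in> set (star_hyperedges H)" "r < r'" "r' < k" for J r r'
  proof -
    have "J \<in> hyperedges p k"
      using H that(1) by (auto simp: starred_sl_graphs_def one_regular_sl_graphs_def is_sl_graph_def hyperedge_chain_def)
    then show ?thesis using that by (auto simp: hyperedges_def intro: sorted_wrt_nth_less)
  qed
  have mem_nth: "J ! r \<in> set J" "set J \<subseteq> {1..p}" if "J \<in> set (star_hyperedges H)" "r < k" for J r
    using propsH(2)[OF that(1)] that(2) by auto
  have H_at_hyp: "\<exists>J\<in>set (star_hyperedges H). J ! r = i'"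
    if "i' \<in> {1..p}" "graph_key q H i' = q + r" for i' r
  proof (cases rule: starred_vertex_cases[OF N that(1)])
    case (1 j)
    then have "q - j = q + r" "j \<in> {1..q}" using that(2) graph_key_arc[OF N 1] propsH(1)[OF 1] by auto
    then show ?thesis by auto
  next
    case (2 J r')
    then have "r' = r" using that(2) graph_key_hyperedge[OF N 2(1,2), of q] by simp
    then show ?thesis using 2 by auto
  qed
  have H_at_arc: "(i', j) \<in># arcs H"
    if "i' \<in> {1..p}" "graph_key q H i' = q - j" "j \<in> {1..q}" for i' j
  proof (cases rule: starred_vertex_cases[OF N that(1)])
    case (1 j')
    then have "q - j' = q - j" "j' \<in> {1..q}" using that(2) graph_key_arc[OF N 1] propsH(1)[OF 1] by auto
    then have "j' = j" using that(3) by auto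
    then show ?thesis using 1 by simp
  next
    case (2 J r')
    then show ?thesis using that(2,3) graph_key_hyperedge[OF N 2(1,2), of q] by auto
  qed
  show ?thesis
  proof (cases rule: starred_vertex_cases[OF M i])
    case (1 j)
    note ij = 1
    have j: "j \<in> {1..q}" using propsG(1)[OF ij] by simp
    have keyG: "graph_key q G i = q - j" by (rule graph_key_arc[OF M ij])
    show ?thesis
    proof (cases rule: starred_vertex_cases[OF N i])
      case (1 j')
      have j': "j' \<in> {1..q}" using propsH(1)[OF 1] by simp
      have keyH: "graph_key q H i = q - j'" by (rule graph_key_arc[OF N 1])
      have "j' \<noteq> j" using ne keyG keyH by auto
      moreover have "\<not> j' < j"
      proof
        assume less: "j' < j"
        obtain i' where i': "(i', j') \<in># arcs G" using propsG(7)[OF j'] by blast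
        have "b j' = b j" using H_arc[OF 1] a_arc[OF ij] by simp
        then have "\<not> (i < i' \<and> j > j')" using layer[OF i' ij] by blast
        moreover have "i' \<noteq> i" using propsG(3)[OF i'] ij less by auto
        ultimately have lt: "i' < i" using less by simp
        have i'p: "i' \<in> {1..p}" using propsG(1)[OF i'] by simp
        have "graph_key q H i' = q - j'" using before[OF i'p lt] graph_key_arc[OF M i'] by simp
        then have "(i', j') \<in># arcs H" using H_at_arc[OF i'p] j' by blast
        then show False using propsH(4)[OF 1] lt by blast
      qed
      ultimately show ?thesis using keyG keyH j j' by auto
    next
      case (2 J r)
      define m where "m = length (star_hyperedges H)"
      define l where "l = a i"
      have l: "l < k" using w(1) by (simp add: l_def words_def)
      have m: "length (star_hyperedges G) = m"
      proof -
        have "k * length (star_hyperedges G) = k * m"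
          using matching_graphs_size[OF M(1)] matching_graphs_size[OF N(1)] unfolding m_def by linarith
        then show ?thesis using k by simp
      qed
      have "m \<noteq> 0" using 2(1) by (auto simp: m_def)
      then have neG: "star_hyperedges G \<noteq> []" using m by auto
      \<comment> \<open>Each hyperedge of \<open>H\<close> contains the letter \<open>l\<close> at most once, so \<open>Z\<close> has at most \<open>m\<close> elements; but it contains \<open>i\<close> and the \<open>m\<close> hyperedge vertices of \<open>G\<close> with the letter \<open>l\<close>.\<close>
      define Z where "Z = {x. (\<exists>J\<in>set (star_hyperedges H). x \<in> set J) \<and> a x = l}"
      have "card Z \<le> m"
      proof -
        have Z: "Z = (\<Union>J\<in>set (star_hyperedges H). {x \<in> set J. a x = l})" by (auto simp: Z_def)
        have "card {x \<in> set J. a x = l} \<le> 1" if "J \<in> set (star_hyperedges H)" for J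
          using H_inj[OF that] card_le_Suc0_iff_eq[of "{x \<in> set J. a x = l}"] by (auto simp: inj_on_def)
        then have "card Z \<le> (\<Sum>J\<in>set (star_hyperedges H). 1)"
          unfolding Z by (intro order.trans[OF card_UN_le] sum_mono) auto
        then show ?thesis using card_length[of "star_hyperedges H"] by (simp add: m_def)
      qed
      moreover have "Suc m \<le> card Z"
      proof -
        define Y where "Y = (\<lambda>s. star_hyperedges G ! s ! l) ` {..<m}"
        have inj: "inj_on (\<lambda>s. star_hyperedges G ! s ! l) {..<m}"
        proof (rule inj_onI)
          fix s s' assume s: "s \<in> {..<m}" "s' \<in> {..<m}" "star_hyperedges G ! s ! l = star_hyperedges G ! s' ! l"
          then have mem: "star_hyperedges G ! s \<in> set (star_hyperedges G)" "star_hyperedges G ! s' \<in> set (star_hyperedges G)"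
            using m by auto
          then have "star_hyperedges G ! s ! l \<in> set (star_hyperedges G ! s)" "star_hyperedges G ! s ! l \<in> set (star_hyperedges G ! s')"
            using propsG(2) l s(3) by (metis nth_mem)+
          then show "s = s'" using distinct_concat_unique[OF propsG(6), of s s'] s m by auto
        qed
        have Yless: "y < i \<and> y \<in> Z" if "y \<in> Y" for y
        proof -
          obtain s where s: "s < m" "y = star_hyperedges G ! s ! l" using \<open>y \<in> Y\<close> by (auto simp: Y_def)
          let ?I = "star_hyperedges G ! s"
          have I: "?I \<in> set (star_hyperedges G)" using s m by simp
          have lastI: "last (star_hyperedges G) = star_hyperedges G ! (m - 1)" using neG m by (simp add: last_conv_nth)
          have "?I ! l \<le> last (star_hyperedges G) ! l"
          proof (cases "s = m - 1")
            case False
            then have "list_all2 (\<le>) ?I (star_hyperedges G ! (m - 1))"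
              using G s m by (auto simp: starred_sl_graphs_def one_regular_sl_graphs_def is_sl_graph_def
                  hyperedge_chain_def sorted_wrt_iff_nth_less)
            then show ?thesis
              unfolding lastI using l propsG(2)[OF I] by (simp add: list_all2_conv_all_nth)
          qed (simp add: lastI)
          moreover have "last (star_hyperedges G) ! l \<le> i" using rule[OF neG ij] by (simp add: l_def)
          moreover have "?I ! l \<noteq> i" using hyperedge_vertex_no_arc[OF M I l] ij by auto
          ultimately have lt: "y < i" using s(2) by simp
          have "?I ! l \<in> set ?I" using propsG(2)[OF I] l by simp
          then have yp: "y \<in> {1..p}" using propsG(2)[OF I] s(2) by blast
          have "graph_key q H y = q + l" using before[OF yp lt] graph_key_hyperedge[OF M I l] s(2) by simp
          then obtain J where J: "J \<in> set (star_hyperedges H)" "J ! l = y" using H_at_hyp[OF yp] by blast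
          have "y \<in> set J" using mem_nth(1)[OF J(1) l] J(2) by simp
          moreover have "a y = l" using a_hyp[OF I l] s(2) by simp
          ultimately show ?thesis using lt J(1) by (auto simp: Z_def)
        qed
        have "i \<in> Z" using 2 mem_nth(1)[OF 2(1,2)] by (auto simp: Z_def l_def)
        then have sub: "insert i Y \<subseteq> Z" using Yless by auto
        have "finite Z" by (rule finite_subset[of _ "\<Union>(set ` set (star_hyperedges H))"]) (auto simp: Z_def)
        then have "card (insert i Y) \<le> card Z" using sub by (intro card_mono)
        moreover have "i \<notin> Y" using Yless by auto
        moreover have "card Y = m" using inj by (simp add: Y_def card_image)
        moreover have "finite Y" by (simp add: Y_def)
        ultimately show ?thesis by simp
      qed
      ultimately show ?thesis by simp
    qed
  next
    case (2 I r)
    have keyG: "graph_key q G i = q + r" using graph_key_hyperedge[OF M 2(1,2)] 2(3) by simp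
    show ?thesis
    proof (cases rule: starred_vertex_cases[OF N i])
      case (1 j')
      have "j' \<in> {1..q}" using propsH(1)[OF 1] by simp
      then show ?thesis using graph_key_arc[OF N 1] keyG by auto
    next
      case J: (2 J r')
      have keyH: "graph_key q H i = q + r'" using graph_key_hyperedge[OF N J(1,2)] J(3) by simp
      have "\<not> r < r'"
      proof
        assume less: "r < r'"
        let ?x = "J ! r"
        have lt: "?x < i" using strictH[OF J(1) less J(2)] J(3) by simp
        have x: "?x \<in> set J" "i \<in> set J" using mem_nth(1)[OF J(1)] 2(2) J(2,3) by auto
        then have xp: "?x \<in> {1..p}" using mem_nth(2)[OF J(1,2)] by blast
        have keyx: "graph_key q G ?x = q + r"
          using before[OF xp lt] graph_key_hyperedge[OF N J(1) 2(2), of q] by simp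
        have "a ?x = r"
        proof (cases rule: starred_vertex_cases[OF M xp])
          case (1 j)
          then have "q - j = q + r" "j \<in> {1..q}" using keyx graph_key_arc[OF M 1] propsG(1)[OF 1] by auto
          then show ?thesis by auto
        next
          case (2 I' s)
          then have "s = r" using keyx graph_key_hyperedge[OF M 2(1,2), of q] by simp
          then show ?thesis using a_hyp[OF 2(1,2)] 2(3) by simp
        qed
        moreover have "a i = r" using a_hyp[OF 2(1,2)] 2(3) by simp
        ultimately have "?x = i" using H_inj[OF J(1)] x by (auto dest: inj_onD)
        then show False using lt by simp
      qed
      then show ?thesis using keyG keyH ne by auto
    qed
  qed
qed

lemma word_value_layer_colouring:
  assumes G: "G \<in> starred_sl_graphs k p q" and col: "layer_colouring k G a b"
  shows "word_value k G a b = 1"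
proof -
  have "(\<Prod>(i, j) \<in># arcs G. if a i = b j then 1 else 0 :: complex) = (\<Prod>e \<in># arcs G. 1)"
    using layer_colouringD(4)[OF col] by (intro arg_cong[of _ _ prod_mset] image_mset_cong) auto
  moreover have "(\<Prod>I \<leftarrow> Is. word_det k a I) = 1" if "set Is \<subseteq> set (star_hyperedges G)" for Is
    using that word_det_id[of k a] layer_colouringD(3)[OF col] by (induction Is) auto
  ultimately show ?thesis using G by (simp add: word_value_def starred_sl_graphs_def)
qed

text \<open>
  Evaluating the relation on the canonical words of \<open>G\<close> leaves the coefficient of \<open>G\<close> and those of graphs with smaller keys,
  which vanish by induction.
\<close>

lemma starred_values_independent:
  assumes \<Gamma>: "finite \<Gamma>" "\<Gamma> \<subseteq> starred_sl_graphs k p q" and k: "k \<ge> 1"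
    and zero: "\<And>a b. a \<in> words k \<Longrightarrow> b \<in> words k \<Longrightarrow> (\<Sum>G\<in>\<Gamma>. c G * word_value k G a b) = 0"
  shows "\<forall>G\<in>\<Gamma>. c G = 0"
proof -
  have "c G = 0" if "G \<in> \<Gamma>" for G
    using that
  proof (induction "map (graph_key q G) [1..<Suc p]" arbitrary: G rule: wf_induct_rule[OF wf_lex[OF wf_less_than]])
    case (1 G)
    have G: "G \<in> starred_sl_graphs k p q" using 1 \<Gamma> by blast
    obtain a b where col: "layer_colouring k G a b" using layer_colouring_exists[OF G k] by blast
    have other: "c H * word_value k H a b = 0" if H: "H \<in> \<Gamma> - {G}" for H
    proof (cases "word_value k H a b = 0")
      case False
      have HS: "H \<in> starred_sl_graphs k p q" using H \<Gamma> by blast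
      define i where "i = (LEAST i. i \<in> {1..p} \<and> graph_key q H i \<noteq> graph_key q G i)"
      have "\<exists>i. i \<in> {1..p} \<and> graph_key q H i \<noteq> graph_key q G i"
        using graph_key_inj[OF HS G k] H by blast
      then have i: "i \<in> {1..p} \<and> graph_key q H i \<noteq> graph_key q G i"
        unfolding i_def by (rule LeastI_ex)
      have before: "graph_key q H i' = graph_key q G i'" if "i' \<in> {1..p}" "i' < i" for i'
        using not_less_Least[of i' "\<lambda>i. i \<in> {1..p} \<and> graph_key q H i \<noteq> graph_key q G i"] that
        unfolding i_def by blast
      have "graph_key q H i < graph_key q G i"
        by (rule graph_key_decreases[OF G HS k col False]) (use i before in auto)
      then have "(map (graph_key q H) [1..<Suc p], map (graph_key q G) [1..<Suc p]) \<in> lex less_than"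
        using i before by (intro lex_first_difference[of i]) auto
      then have "c H = 0" using H by (intro "1.hyps") auto
      then show ?thesis by simp
    qed simp
    have "0 = (\<Sum>H\<in>\<Gamma>. c H * word_value k H a b)" using zero layer_colouringD(1,2)[OF col] by simp
    also have "\<dots> = c G * word_value k G a b + (\<Sum>H\<in>\<Gamma> - {G}. c H * word_value k H a b)"
      using \<Gamma>(1) 1(2) by (intro sum.remove)
    also have "(\<Sum>H\<in>\<Gamma> - {G}. c H * word_value k H a b) = 0"
      by (rule sum.neutral) (use other in blast)
    also have "c G * word_value k G a b + 0 = c G" using word_value_layer_colouring[OF G col] by simp
    finally show ?case by simp
  qed
  then show ?thesis by blast
qed


section \<open>Duality and existence of basis graphs\<close>

definition swap_graph :: "sl_graph \<Rightarrow> sl_graph" where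
  "swap_graph G = SL_Graph (image_mset prod.swap (arcs G)) (unstar_hyperedges G) (star_hyperedges G)"

lemma swap_graph_sel [simp]:
  "arcs (swap_graph G) = image_mset prod.swap (arcs G)"
  "star_hyperedges (swap_graph G) = unstar_hyperedges G"
  "unstar_hyperedges (swap_graph G) = star_hyperedges G"
  by (simp_all add: swap_graph_def)

lemma swap_swap_graph [simp]: "swap_graph (swap_graph G) = G"
  by (intro sl_graph.expand) (simp add: image_mset.compositionality)

lemma first_layer_swap:
  "first_layer_star (image_mset prod.swap M) = image_mset prod.swap (first_layer_unstar M)"
  "first_layer_unstar (image_mset prod.swap M) = image_mset prod.swap (first_layer_star M)"
  by (auto simp: first_layer_star_def first_layer_unstar_def filter_mset_image_mset
      case_prod_unfold intro!: arg_cong[of _ _ "image_mset prod.swap"] filter_mset_cong)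

lemma layer_swap:
  "layer_star l (image_mset prod.swap M) = image_mset prod.swap (layer_unstar l M)"
  "layer_unstar l (image_mset prod.swap M) = image_mset prod.swap (layer_star l M)"
proof -
  have "first_layer_star N \<subseteq># N" "first_layer_unstar N \<subseteq># N" for N
    by (simp_all add: first_layer_star_def first_layer_unstar_def)
  then have "((\<lambda>N. N - first_layer_star N) ^^ l) (image_mset prod.swap M) =
      image_mset prod.swap (((\<lambda>N. N - first_layer_unstar N) ^^ l) M)"
    "((\<lambda>N. N - first_layer_unstar N) ^^ l) (image_mset prod.swap M) =
      image_mset prod.swap (((\<lambda>N. N - first_layer_star N) ^^ l) M)"
    by (induction l) (simp_all add: first_layer_swap image_mset_Diff)
  then show "layer_star l (image_mset prod.swap M) = image_mset prod.swap (layer_unstar l M)"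
    "layer_unstar l (image_mset prod.swap M) = image_mset prod.swap (layer_star l M)"
    by (simp_all add: layer_star_def layer_unstar_def first_layer_swap)
qed

lemma strict_nesting_swap: "strict_nesting (prod.swap ` C) \<longleftrightarrow> strict_nesting C"
  unfolding strict_nesting_def by (auto 0 3)

lemma swap_graph_one_regular_sl_graphs:
  assumes "G \<in> one_regular_sl_graphs k p q"
  shows "swap_graph G \<in> one_regular_sl_graphs k q p"
proof -
  have sl: "is_sl_graph k p q G" and reg: "one_regular p q G"
    using assms by (auto simp: one_regular_sl_graphs_def)
  have "card C \<le> k" if C: "C \<subseteq> set_mset (arcs (swap_graph G))" "strict_nesting C" for C
  proof -
    have "prod.swap ` C \<subseteq> set_mset (arcs G)" using C(1) by fastforce
    then have "card (prod.swap ` C) \<le> k"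
      using sl C(2) by (simp add: is_sl_graph_def strict_nesting_swap)
    then show ?thesis by (simp add: card_image)
  qed
  moreover have "hyperedge_rule k (swap_graph G)"
    using sl by (auto simp: is_sl_graph_def hyperedge_rule_def layer_swap)
  moreover have "set_mset (arcs (swap_graph G)) \<subseteq> {1..q} \<times> {1..p}"
    using sl by (auto simp: is_sl_graph_def)
  moreover have "hyperedge_chain q k (star_hyperedges (swap_graph G))"
    "hyperedge_chain p k (unstar_hyperedges (swap_graph G))"
    "star_hyperedges (swap_graph G) = [] \<or> unstar_hyperedges (swap_graph G) = []"
    using sl unfolding is_sl_graph_def swap_graph_sel by blast+
  ultimately have "is_sl_graph k q p (swap_graph G)"
    unfolding is_sl_graph_def by blast
  moreover have "degree_star (swap_graph G) j = degree_unstar G j"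
    "degree_unstar (swap_graph G) i = degree_star G i" for i j
    by (simp_all add: degree_star_def degree_unstar_def size_filter_fst image_mset.compositionality comp_def)
  then have "one_regular q p (swap_graph G)" using reg by (simp add: one_regular_def)
  ultimately show ?thesis by (simp add: one_regular_sl_graphs_def)
qed

lemma word_value_swap: "word_value k (swap_graph G) b a = word_value k G a b"
  by (simp add: word_value_def image_mset.compositionality comp_def case_prod_unfold eq_commute mult.commute mult.left_commute)

lemma word_span_swap:
  assumes "word_span k \<Gamma> \<Phi>" "swap_graph ` \<Gamma> \<subseteq> \<Delta>"
  shows "word_span k \<Delta> (\<lambda>b a. \<Phi> a b)"
  using assms(1)
proof induction
  case (zero \<Phi>)
  then show ?case by (intro word_span.zero) simp
next
  case (step \<Phi> G \<Psi> c)
  show ?case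
    by (rule word_span.step[OF step.IH, of "swap_graph G" _ c])
      (use step.hyps assms(2) in \<open>auto simp: word_value_swap\<close>)
qed

text \<open>
  Exchanging \<open>V\<close> with its dual inverts the power of the determinant.
\<close>

lemma sl_invariant_swap:
  assumes "sl_invariant k \<mu> S T \<Phi>"
  shows "sl_invariant k (- \<mu>) T S (\<lambda>b a. \<Phi> a b)"
  unfolding sl_invariant_def
proof (intro conjI ballI allI impI)
  fix b b' a a' assume "b \<in> words k" "b' \<in> words k" "a \<in> words k" "a' \<in> words k"
    "\<forall>j\<in>T. b j = b' j" "\<forall>i\<in>S. a i = a' i"
  then show "\<Phi> a b = \<Phi> a' b'" by (intro sl_invariant_cong[OF assms]) auto
next
  fix b a r s assume *: "b \<in> words k" "a \<in> words k" "r < k" "s < k"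
  have "x - y = - z" if "y - x = z" for x y z :: complex using that by auto
  from this[OF sl_invariantD[OF assms *(2,1,4,3)]]
  show "(\<Sum>j\<in>T. if b j = r then \<Phi> a (b(j := s)) else 0) -
      (\<Sum>i\<in>S. if a i = s then \<Phi> (a(i := r)) b else 0) = (if r = s then - \<mu> * \<Phi> a b else 0)"
    by auto
qed

lemma one_regular_sl_graph_counts:
  assumes G: "G \<in> one_regular_sl_graphs k p q"
  shows "size (arcs G) + k * length (star_hyperedges G) = p"
    and "size (arcs G) + k * length (unstar_hyperedges G) = q"
    and "star_hyperedges G = [] \<or> unstar_hyperedges G = []"
proof -
  show empty: "star_hyperedges G = [] \<or> unstar_hyperedges G = []"
    using G by (simp add: one_regular_sl_graphs_def is_sl_graph_def)
  have *: "size (arcs G) + k * length (star_hyperedges G) = p" "size (arcs G) = q"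
    if "G \<in> one_regular_sl_graphs k p q" "unstar_hyperedges G = []" for G p q
    using matching_graphs_size[OF starred_imp_matching, of G k p q] that
    by (simp_all add: starred_sl_graphs_def)
  have "size (arcs G) + k * length (star_hyperedges G) = p \<and> size (arcs G) + k * length (unstar_hyperedges G) = q"
  proof (cases "unstar_hyperedges G = []")
    case True
    then show ?thesis using *[OF G] by simp
  next
    case False
    then have "star_hyperedges G = []" using empty by simp
    then show ?thesis using *[OF swap_graph_one_regular_sl_graphs[OF G]] by simp
  qed
  then show "size (arcs G) + k * length (star_hyperedges G) = p"
    "size (arcs G) + k * length (unstar_hyperedges G) = q" by auto
qed

lemma starred_sl_graphs_eq:
  assumes "q \<le> p" "k \<ge> 1"
  shows "starred_sl_graphs k p q = one_regular_sl_graphs k p q"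
proof -
  have "unstar_hyperedges G = []" if G: "G \<in> one_regular_sl_graphs k p q" for G
  proof (rule ccontr)
    assume ne: "unstar_hyperedges G \<noteq> []"
    then have "star_hyperedges G = []" using one_regular_sl_graph_counts(3)[OF G] by simp
    then have "p + k * length (unstar_hyperedges G) = q"
      using one_regular_sl_graph_counts(1,2)[OF G] by simp
    moreover have "k * length (unstar_hyperedges G) > 0" using assms ne by simp
    ultimately show False using assms by linarith
  qed
  then show ?thesis by (auto simp: starred_sl_graphs_def)
qed

theorem word_values_span:
  assumes k: "k \<ge> 1" and m: "int p - int q = int k * m"
    and \<Phi>: "sl_invariant k (of_int m) {1..p} {1..q} \<Phi>"
  shows "word_span k (one_regular_sl_graphs k p q) \<Phi>"
proof -
  have *: "word_span k (one_regular_sl_graphs k p q) \<Phi>"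
    if "sl_invariant k (of_nat m) {1..p} {1..q} \<Phi>" for p q m \<Phi>
    using word_span_trans[OF first_fundamental_theorem[OF finite_atLeastAtMost finite_atLeastAtMost k that]
        straightening[OF k]] .
  show ?thesis
  proof (cases "m \<ge> 0")
    case True
    then have "(of_int m :: complex) = of_nat (nat m)" by simp
    then show ?thesis using * \<Phi> by metis
  next
    case False
    then have "- (of_int m :: complex) = of_nat (nat (- m))" by simp
    then have "word_span k (one_regular_sl_graphs k q p) (\<lambda>b a. \<Phi> a b)"
      using *[of "nat (- m)" q p] sl_invariant_swap[OF \<Phi>] by metis
    from word_span_swap[OF this, of "one_regular_sl_graphs k p q"]
    show ?thesis using swap_graph_one_regular_sl_graphs by auto
  qed
qed

theorem word_values_independent:
  assumes k: "k \<ge> 1" and \<Gamma>: "finite \<Gamma>" "\<Gamma> \<subseteq> one_regular_sl_graphs k p q"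
    and zero: "\<And>a b. a \<in> words k \<Longrightarrow> b \<in> words k \<Longrightarrow> (\<Sum>G\<in>\<Gamma>. c G * word_value k G a b) = 0"
  shows "\<forall>G\<in>\<Gamma>. c G = 0"
proof (cases "q \<le> p")
  case True
  then show ?thesis
    using starred_values_independent[OF \<Gamma>(1) _ k zero] \<Gamma>(2) starred_sl_graphs_eq[OF _ k] by metis
next
  case False
  have inj: "inj_on swap_graph \<Gamma>" by (metis inj_onI swap_swap_graph)
  have "\<forall>H\<in>swap_graph ` \<Gamma>. c (swap_graph H) = 0"
  proof (rule starred_values_independent[OF _ _ k])
    show "swap_graph ` \<Gamma> \<subseteq> starred_sl_graphs k q p"
      using \<Gamma>(2) swap_graph_one_regular_sl_graphs starred_sl_graphs_eq[of p q k] False k by auto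
    fix b a assume "b \<in> words k" "a \<in> words k"
    then show "(\<Sum>H\<in>swap_graph ` \<Gamma>. c (swap_graph H) * word_value k H b a) = 0"
      using zero[of a b] by (simp add: sum.reindex[OF inj] word_value_swap)
  qed (use \<Gamma>(1) in simp)
  then show ?thesis by simp
qed

lemma concat_blocks: "concat (map (\<lambda>s. [s * k + 1..<s * k + k + 1]) [0..<m]) = [1..<k * m + 1]"
proof (induction m)
  case (Suc m)
  then show ?case using upt_add_eq_append[of 1 "k * m + 1" k] by (simp add: ac_simps)
qed simp

text \<open>
  For \<open>p = q + k m\<close>, let the hyperedges be the \<open>m\<close> consecutive blocks of length \<open>k\<close>, followed by arcs that join the remaining
  vertices in order. No two arcs nest, so all arcs are in layer 0 and lie to the right of all hyperedges.
\<close>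

lemma one_regular_sl_graphs_nonempty:
  assumes k: "k \<ge> 1" and dvd: "int k dvd int p - int q"
  shows "one_regular_sl_graphs k p q \<noteq> {}"
proof -
  have *: "one_regular_sl_graphs k p q \<noteq> {}" if p: "p = q + k * m" for p q m
  proof -
    define A where "A = mset (map (\<lambda>j. (k * m + j, j)) [1..<Suc q])"
    define Is where "Is = map (\<lambda>s. [s * k + 1..<s * k + k + 1]) [0..<m]"
    define G where "G = SL_Graph A Is []"
    have A: "i = k * m + j \<and> 1 \<le> j \<and> j \<le> q" if "(i, j) \<in># A" for i j
      using that by (auto simp: A_def)
    have "map (\<lambda>j. k * m + j) [1..<Suc q] = [k * m + 1..<Suc (k * m + q)]"
      using map_add_upt[of "k * m + 1" q] map_add_upt[of 1 q] by (intro nth_equalityI) (auto simp del: upt_Suc)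
    then have "image_mset fst A + mset (concat Is) = mset ([1..<k * m + 1] @ [k * m + 1..<Suc (k * m + q)])"
      unfolding A_def Is_def concat_blocks by (simp add: comp_def del: upt_Suc flip: mset_map)
    also have "[1..<k * m + 1] @ [k * m + 1..<Suc (k * m + q)] = [1..<Suc p]"
      using upt_add_eq_append[of 1 "k * m + 1" q] p by (simp add: ac_simps del: upt_Suc)
    also have "mset [1..<Suc p] = mset_set {1..p}" by (simp add: atLeastLessThanSuc_atLeastAtMost del: upt_Suc)
    finally have fst: "image_mset fst A + mset (concat Is) = mset_set {1..p}" .
    have snd: "image_mset snd A = mset_set {1..q}"
      unfolding A_def
      by (simp add: comp_def atLeastLessThanSuc_atLeastAtMost del: upt_Suc flip: mset_map)
    have M: "G \<in> matching_graphs k {1..p} {1..q}"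
    proof -
      have "\<forall>I\<in>set Is. length I = k" by (auto simp: Is_def simp del: upt_Suc)
      then show ?thesis
        unfolding matching_graphs_def G_def sl_graph.sel using fst snd by (intro CollectI conjI) auto
    qed
    note props = matching_graphs_props[OF M finite_atLeastAtMost finite_atLeastAtMost]
    have nest: "card C \<le> 1" if "C \<subseteq> set_mset A" "strict_nesting C" for C
    proof -
      have "x = y" if "x \<in> C" "y \<in> C" for x y
        using that \<open>C \<subseteq> set_mset A\<close> \<open>strict_nesting C\<close> A[of "fst x" "snd x"] A[of "fst y" "snd y"]
        unfolding strict_nesting_def by (cases x; cases y) force
      then show ?thesis by (metis One_nat_def card.infinite card_le_Suc0_iff_eq le0)
    qed
    have chain: "hyperedge_chain p k Is"
      unfolding hyperedge_chain_def
    proof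
      have len: "I \<in> set Is \<Longrightarrow> set I \<subseteq> {1..p} \<and> length I = k" for I using props(2)[of I] by (simp add: G_def)
      have "sorted_wrt (<) I" if "I \<in> set Is" for I
        using that by (auto simp: Is_def strict_sorted_iff simp del: upt_Suc)
      then show "set Is \<subseteq> hyperedges p k" using len by (auto simp: hyperedges_def)
      show "sorted_wrt (list_all2 (\<le>)) Is"
        unfolding Is_def sorted_wrt_map
        by (rule sorted_wrt_mono_rel[of _ "(<)"])
          (auto simp: list_all2_conv_all_nth simp del: upt_Suc)
    qed
    have "last Is ! l \<le> i" if "Is \<noteq> []" "l < k" "(i, j) \<in># layer_star l A" for l i j
    proof -
      obtain C where "C \<subseteq> set_mset A" "strict_nesting C" "card C = Suc l"
        using mem_layer_star_nesting[OF \<open>(i, j) \<in># layer_star l A\<close>] by blast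
      then have l: "l = 0" using nest[of C] by simp
      have m: "m \<noteq> 0" using that(1) by (auto simp: Is_def)
      have "last Is = [(m - 1) * k + 1..<(m - 1) * k + k + 1]"
        using m unfolding Is_def by (subst last_map) (auto simp: last_conv_nth simp del: upt_Suc)
      then have "last Is ! l = (m - 1) * k + 1" using l k by (simp del: upt_Suc)
      moreover have "i = k * m + j" "1 \<le> j" using A[OF layer_star_subset[OF that(3)]] by auto
      moreover have "(m - 1) * k \<le> k * m" by (simp add: mult.commute)
      ultimately show ?thesis by linarith
    qed
    then have "hyperedge_rule k G" by (auto simp: hyperedge_rule_def G_def)
    moreover have "set_mset A \<subseteq> {1..p} \<times> {1..q}" using props(1) by (auto simp: G_def)
    moreover have "\<forall>C \<subseteq> set_mset A. strict_nesting C \<longrightarrow> card C \<le> k"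
      using nest k le_trans by blast
    moreover have "hyperedge_chain q k []" by (simp add: hyperedge_chain_def)
    moreover have "arcs G = A" "star_hyperedges G = Is" "unstar_hyperedges G = []" by (simp_all add: G_def)
    ultimately have "is_sl_graph k p q G"
      using chain unfolding is_sl_graph_def by metis
    then have "G \<in> one_regular_sl_graphs k p q"
      using one_regular_iff_matching[of k p q G] M by (simp add: one_regular_sl_graphs_def G_def)
    then show ?thesis by blast
  qed
  obtain m where m: "int p - int q = int k * m" using dvd by (elim dvdE)
  show ?thesis
  proof (cases "m \<ge> 0")
    case True
    then have "int p = int (q + k * nat m)" using m by simp
    then have "p = q + k * nat m" by (simp only: of_nat_eq_iff)
    then show ?thesis by (rule *)
  next
    case False
    then have "int q = int (p + k * nat (- m))" using m by simp
    then have "q = p + k * nat (- m)" by (simp only: of_nat_eq_iff)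
    then have "one_regular_sl_graphs k q p \<noteq> {}" by (rule *)
    then show ?thesis using swap_graph_one_regular_sl_graphs by blast
  qed
qed


section \<open>Multilinearity of graph forms\<close>

text \<open>
  A vertex of degree one meets exactly one factor of the product, so as a function of the vector at this
  vertex the product is a constant times that factor.
\<close>

lemma degree_one_factor:
  fixes \<alpha> :: "'y \<Rightarrow> 'e \<Rightarrow> complex" and \<beta> :: "'y \<Rightarrow> nat list \<Rightarrow> complex"
  assumes deg: "size {# e \<in># M. f e = i #} + length (filter (\<lambda>I. i \<in> set I) Is) = 1"
    and \<alpha>: "\<forall>y y'. \<forall>e\<in>#M. f e \<noteq> i \<longrightarrow> \<alpha> y e = \<alpha> y' e"
    and \<beta>: "\<forall>y y'. \<forall>I\<in>set Is. i \<notin> set I \<longrightarrow> \<beta> y I = \<beta> y' I"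
  obtains (arc) e c where "e \<in># M" "f e = i" "\<And>y. (\<Prod>e\<in>#M. \<alpha> y e) * (\<Prod>I\<leftarrow>Is. \<beta> y I) = c * \<alpha> y e"
  | (hyperedge) I c where "I \<in> set Is" "i \<in> set I"
      "\<And>y. (\<Prod>e\<in>#M. \<alpha> y e) * (\<Prod>I\<leftarrow>Is. \<beta> y I) = c * \<beta> y I"
proof -
  define y0 :: 'y where "y0 = undefined"
  have constM: "(\<Prod>e\<in>#N. \<alpha> y e) = (\<Prod>e\<in>#N. \<alpha> y0 e)" if "N \<subseteq># M" "\<forall>e\<in>#N. f e \<noteq> i" for N y
    using that mset_subset_eqD[OF that(1)] \<alpha>
    by (intro arg_cong[of _ _ prod_mset] image_mset_cong) blast
  have constI: "(\<Prod>I\<leftarrow>Js. \<beta> y I) = (\<Prod>I\<leftarrow>Js. \<beta> y0 I)" if "set Js \<subseteq> set Is" "\<forall>I\<in>set Js. i \<notin> set I" for Js y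
    using that \<beta> by (intro arg_cong[of _ _ prod_list] map_cong) blast+
  consider (arc) "size {# e \<in># M. f e = i #} = 1" "filter (\<lambda>I. i \<in> set I) Is = []"
    | (hyp) "{# e \<in># M. f e = i #} = {#}" "length (filter (\<lambda>I. i \<in> set I) Is) = 1"
    using deg by (cases "filter (\<lambda>I. i \<in> set I) Is") auto
  then show ?thesis
  proof cases
    case arc
    then obtain e where e: "{# e \<in># M. f e = i #} = {#e#}" by (metis One_nat_def size_1_singleton_mset)
    then have "e \<in># {# e \<in># M. f e = i #}" by simp
    then have eM: "e \<in># M" "f e = i" by auto
    define N where "N = {# e \<in># M. f e \<noteq> i #}"
    have M: "M = {#e#} + N" using multiset_partition[of M "\<lambda>e. f e = i"] e by (simp add: N_def)
    have N: "N \<subseteq># M" "\<forall>e\<in>#N. f e \<noteq> i" by (auto simp: N_def)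
    have "\<forall>I\<in>set Is. i \<notin> set I" using arc(2) by (simp add: filter_empty_conv)
    then have "(\<Prod>e\<in>#M. \<alpha> y e) * (\<Prod>I\<leftarrow>Is. \<beta> y I) =
        ((\<Prod>e\<in>#N. \<alpha> y0 e) * (\<Prod>I\<leftarrow>Is. \<beta> y0 I)) * \<alpha> y e" for y
      using constM[OF N, of y] constI[of Is y] by (subst M) (simp add: mult.commute mult.left_commute)
    then show ?thesis by (rule that(1)[OF eM])
  next
    case hyp
    then obtain I where "filter (\<lambda>I. i \<in> set I) Is = [I]" by (auto simp: length_Suc_conv)
    then obtain Is1 Is2 where Is: "Is = Is1 @ I # Is2" "i \<in> set I"
      and Is1: "\<forall>J\<in>set Is1. i \<notin> set J" and "[] = filter (\<lambda>I. i \<in> set I) Is2"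
      by (auto dest: filter_eq_ConsD)
    then have Is2: "\<forall>J\<in>set Is2. i \<notin> set J" by (metis filter_empty_conv)
    have sub: "set Is1 \<subseteq> set Is" "set Is2 \<subseteq> set Is" by (auto simp: Is(1))
    have "\<forall>e\<in>#M. f e \<noteq> i" using hyp(1) by (metis (mono_tags, lifting) empty_not_add_mset filter_mset_add_mset multi_member_split)
    then have "(\<Prod>e\<in>#M. \<alpha> y e) * (\<Prod>I\<leftarrow>Is. \<beta> y I) =
        ((\<Prod>e\<in>#M. \<alpha> y0 e) * (\<Prod>I\<leftarrow>Is1. \<beta> y0 I) * (\<Prod>I\<leftarrow>Is2. \<beta> y0 I)) * \<beta> y I" for y
      using constM[of M y] constI[OF sub(1) Is1, of y] constI[OF sub(2) Is2, of y]
      by (simp add: Is(1) mult.commute mult.left_commute)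
    moreover have "I \<in> set Is" by (simp add: Is(1))
    ultimately show ?thesis using that(2) Is(2) by blast
  qed
qed

lemma det_column_linear:
  fixes A :: "'y \<Rightarrow> complex mat"
  assumes c: "c < k"
    and A: "\<And>y. A y \<in> carrier_mat k k"
    and same: "\<And>y y' r d. r < k \<Longrightarrow> d < k \<Longrightarrow> d \<noteq> c \<Longrightarrow> A y $$ (r, d) = A y' $$ (r, d)"
  shows "\<exists>u. \<forall>y. det (A y) = (\<Sum>r<k. u r * A y $$ (r, c))"
proof -
  define y0 :: 'y where "y0 = undefined"
  have cof: "cofactor (A y) r c = cofactor (A y0) r c" for y r
  proof -
    have "mat_delete (A y) r c = mat_delete (A y0) r c"
    proof (rule eq_matI)
      show "mat_delete (A y) r c $$ (i, j) = mat_delete (A y0) r c $$ (i, j)"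
        if "i < dim_row (mat_delete (A y0) r c)" "j < dim_col (mat_delete (A y0) r c)" for i j
      proof -
        have "A y \<in> carrier_mat k k" "A y0 \<in> carrier_mat k k" using A by auto
        then show ?thesis using that unfolding mat_delete_def by (auto intro!: same)
      qed
    qed (use A[of y] A[of y0] in \<open>auto simp: mat_delete_def\<close>)
    then show ?thesis by (simp add: cofactor_def)
  qed
  have "det (A y) = (\<Sum>r<k. cofactor (A y0) r c * A y $$ (r, c))" for y
  proof -
    have "det (A y) = (\<Sum>r<k. A y $$ (r, c) * cofactor (A y) r c)"
      by (rule laplace_expansion_column[OF A c])
    also have "\<dots> = (\<Sum>r<k. cofactor (A y0) r c * A y $$ (r, c))"
      unfolding cof[of y] by (intro sum.cong refl) (rule mult.commute)
    finally show ?thesis .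
  qed
  then show ?thesis by (intro exI[of _ "\<lambda>r. cofactor (A y0) r c"] allI)
qed

lemma det_star_linear:
  assumes "distinct I" "length I = k" "i \<in> set I"
  shows "\<exists>u. \<forall>\<phi>. det_star e k (x(i := \<phi>)) I = (\<Sum>r<k. u r * \<phi> (e r))"
proof -
  obtain c where c: "c < k" "I ! c = i" using assms by (metis in_set_conv_nth)
  have ne: "I ! d \<noteq> i" if "d < k" "d \<noteq> c" for d using that c assms by (auto simp: nth_eq_iff_index_eq)
  have "\<exists>u. \<forall>\<phi>. det (mat k k (\<lambda>(r, c). (x(i := \<phi>)) (I ! c) (e r))) =
      (\<Sum>r<k. u r * mat k k (\<lambda>(r, c). (x(i := \<phi>)) (I ! c) (e r)) $$ (r, c))"
    by (rule det_column_linear[OF c(1)]) (use ne in auto)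
  then show ?thesis unfolding det_star_def using c by simp
qed

lemma det_unstar_linear:
  assumes "distinct J" "length J = k" "j \<in> set J"
  shows "\<exists>u. \<forall>v. det_unstar scale e k (w(j := v)) J = (\<Sum>r<k. u r * dual_basis scale e k r v)"
proof -
  obtain c where c: "c < k" "J ! c = j" using assms by (metis in_set_conv_nth)
  have ne: "J ! d \<noteq> j" if "d < k" "d \<noteq> c" for d using that c assms by (auto simp: nth_eq_iff_index_eq)
  have "\<exists>u. \<forall>v. det (mat k k (\<lambda>(r, c). dual_basis scale e k r ((w(j := v)) (J ! c)))) =
      (\<Sum>r<k. u r * mat k k (\<lambda>(r, c). dual_basis scale e k r ((w(j := v)) (J ! c))) $$ (r, c))"
    by (rule det_column_linear[OF c(1)]) (use ne in auto)
  then show ?thesis unfolding det_unstar_def using c by simp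
qed

lemma det_star_cong: "length I = k \<Longrightarrow> (\<And>i. i \<in> set I \<Longrightarrow> x i = x' i) \<Longrightarrow> det_star e k x I = det_star e k x' I"
  unfolding det_star_def by (rule arg_cong[of _ _ det]) (auto intro!: eq_matI)

lemma det_unstar_cong:
  "length J = k \<Longrightarrow> (\<And>j. j \<in> set J \<Longrightarrow> w j = w' j) \<Longrightarrow> det_unstar scale e k w J = det_unstar scale e k w' J"
  unfolding det_unstar_def by (rule arg_cong[of _ _ det]) (auto intro!: eq_matI)

lemma one_regular_sl_graph_hyperedges:
  assumes "G \<in> one_regular_sl_graphs k p q"
  shows "I \<in> set (star_hyperedges G) \<Longrightarrow> distinct I \<and> length I = k \<and> set I \<subseteq> {1..p}"
    and "J \<in> set (unstar_hyperedges G) \<Longrightarrow> distinct J \<and> length J = k \<and> set J \<subseteq> {1..q}"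
    and "(i, j) \<in># arcs G \<Longrightarrow> i \<in> {1..p} \<and> j \<in> {1..q}"
proof -
  have sl: "is_sl_graph k p q G" using assms by (simp add: one_regular_sl_graphs_def)
  have hyp: "distinct I \<and> length I = k \<and> set I \<subseteq> {1..n}" if "I \<in> hyperedges n k" for I n
    using that by (simp add: hyperedges_def strict_sorted_iff)
  have sub: "set (star_hyperedges G) \<subseteq> hyperedges p k" "set (unstar_hyperedges G) \<subseteq> hyperedges q k"
    "set_mset (arcs G) \<subseteq> {1..p} \<times> {1..q}"
    using sl by (simp_all add: is_sl_graph_def hyperedge_chain_def)
  show "I \<in> set (star_hyperedges G) \<Longrightarrow> distinct I \<and> length I = k \<and> set I \<subseteq> {1..p}"
    by (rule hyp[OF subsetD[OF sub(1)]])
  show "J \<in> set (unstar_hyperedges G) \<Longrightarrow> distinct J \<and> length J = k \<and> set J \<subseteq> {1..q}"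
    by (rule hyp[OF subsetD[OF sub(2)]])
  show "(i, j) \<in># arcs G \<Longrightarrow> i \<in> {1..p} \<and> j \<in> {1..q}"
    using sub(3) by auto
qed

lemma graph_form_linear_star:
  assumes G: "G \<in> one_regular_sl_graphs k p q" and i: "i \<in> {1..p}"
  shows "\<exists>n u v. \<forall>\<phi>. (x(i := \<phi>), w) \<in> points scale p q \<longrightarrow>
    graph_form scale e k p q G (x(i := \<phi>), w) = (\<Sum>r<(n::nat). u r * \<phi> (v r))"
proof -
  note hyp = one_regular_sl_graph_hyperedges[OF G]
  let ?\<alpha> = "\<lambda>\<phi> a. (x(i := \<phi>)) (fst a) (w (snd a))" and ?\<beta> = "\<lambda>\<phi> I. det_star e k (x(i := \<phi>)) I"
  define C where "C = (\<Prod>J \<leftarrow> unstar_hyperedges G. det_unstar scale e k w J)"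
  have "one_regular p q G" using G by (simp add: one_regular_sl_graphs_def)
  then have deg: "size {# a \<in># arcs G. fst a = i #} + length (filter (\<lambda>I. i \<in> set I) (star_hyperedges G)) = 1"
    using i by (simp add: one_regular_def degree_star_def)
  have \<alpha>: "\<forall>\<phi> \<phi>'. \<forall>a\<in>#arcs G. fst a \<noteq> i \<longrightarrow> ?\<alpha> \<phi> a = ?\<alpha> \<phi>' a" by simp
  have \<beta>: "\<forall>\<phi> \<phi>'. \<forall>I\<in>set (star_hyperedges G). i \<notin> set I \<longrightarrow> ?\<beta> \<phi> I = ?\<beta> \<phi>' I"
    using hyp(1) by (intro allI ballI impI det_star_cong) auto
  have gf: "graph_form scale e k p q G (x(i := \<phi>), w) =
      (\<Prod>a\<in>#arcs G. ?\<alpha> \<phi> a) * (\<Prod>I\<leftarrow>star_hyperedges G. ?\<beta> \<phi> I) * C"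
    if "(x(i := \<phi>), w) \<in> points scale p q" for \<phi>
    using that by (simp add: graph_form_def C_def case_prod_unfold)
  show ?thesis
  proof (cases rule: degree_one_factor[where \<alpha> = ?\<alpha> and \<beta> = ?\<beta>, OF deg \<alpha> \<beta>])
    case (1 a c)
    have "graph_form scale e k p q G (x(i := \<phi>), w) = (\<Sum>r<(1::nat). (c * C) * \<phi> (w (snd a)))"
      if "(x(i := \<phi>), w) \<in> points scale p q" for \<phi>
      unfolding gf[OF that] 1(3) using 1(2) by simp
    then show ?thesis
      by (intro exI[of _ 1] exI[of _ "\<lambda>_. c * C"] exI[of _ "\<lambda>_. w (snd a)"] allI impI)
  next
    case (2 I c)
    obtain u where u: "\<forall>\<phi>. ?\<beta> \<phi> I = (\<Sum>r<k. u r * \<phi> (e r))"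
      using det_star_linear[of I k i e x] hyp(1)[OF 2(1)] 2(2) by blast
    have "graph_form scale e k p q G (x(i := \<phi>), w) = (\<Sum>r<k. (c * C * u r) * \<phi> (e r))"
      if "(x(i := \<phi>), w) \<in> points scale p q" for \<phi>
      unfolding gf[OF that] 2(3) u[rule_format]
      by (simp add: sum_distrib_left mult.commute mult.left_commute)
    then show ?thesis
      by (intro exI[of _ k] exI[of _ "\<lambda>r. c * C * u r"] exI[of _ e] allI impI)
  qed
qed

lemma graph_form_linear_unstar:
  assumes V: "vector_space scale" and B: "ordered_basis scale e k"
    and G: "G \<in> one_regular_sl_graphs k p q" and j: "j \<in> {1..q}" and xw: "(x, w) \<in> points scale p q"
  shows "\<exists>n u \<psi>. (\<forall>r. \<psi> r \<in> covectors scale) \<and>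
    (\<forall>v. graph_form scale e k p q G (x, w(j := v)) = (\<Sum>r<(n::nat). u r * \<psi> r v))"
proof -
  note hyp = one_regular_sl_graph_hyperedges[OF G]
  let ?\<alpha> = "\<lambda>v a. x (fst a) ((w(j := v)) (snd a))" and ?\<beta> = "\<lambda>v J. det_unstar scale e k (w(j := v)) J"
  define C where "C = (\<Prod>I \<leftarrow> star_hyperedges G. det_star e k x I)"
  have "one_regular p q G" using G by (simp add: one_regular_sl_graphs_def)
  then have deg: "size {# a \<in># arcs G. snd a = j #} + length (filter (\<lambda>J. j \<in> set J) (unstar_hyperedges G)) = 1"
    using j by (simp add: one_regular_def degree_unstar_def)
  have \<alpha>: "\<forall>v v'. \<forall>a\<in>#arcs G. snd a \<noteq> j \<longrightarrow> ?\<alpha> v a = ?\<alpha> v' a" by simp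
  have \<beta>: "\<forall>v v'. \<forall>J\<in>set (unstar_hyperedges G). j \<notin> set J \<longrightarrow> ?\<beta> v J = ?\<beta> v' J"
    using hyp(2) by (intro allI ballI impI det_unstar_cong) auto
  have gf: "graph_form scale e k p q G (x, w(j := v)) =
      C * ((\<Prod>a\<in>#arcs G. ?\<alpha> v a) * (\<Prod>J\<leftarrow>unstar_hyperedges G. ?\<beta> v J))" for v
    using points_upd_unstar[OF xw j, of v]
    by (simp add: graph_form_def C_def case_prod_unfold mult.commute mult.left_commute)
  show ?thesis
  proof (cases rule: degree_one_factor[where \<alpha> = ?\<alpha> and \<beta> = ?\<beta>, OF deg \<alpha> \<beta>])
    case (1 a c)
    have "fst a \<in> {1..p}" using hyp(3)[of "fst a" "snd a"] 1(1) by simp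
    then have "x (fst a) \<in> covectors scale" using xw by (auto simp: points_def)
    moreover have "graph_form scale e k p q G (x, w(j := v)) = (\<Sum>r<(1::nat). (C * c) * x (fst a) v)" for v
      unfolding gf 1(3) using 1(2) by simp
    ultimately show ?thesis
      by (intro exI[of _ 1] exI[of _ "\<lambda>_. C * c"] exI[of _ "\<lambda>_. x (fst a)"] conjI allI)
  next
    case (2 J c)
    obtain u where u: "\<forall>v. ?\<beta> v J = (\<Sum>r<k. u r * dual_basis scale e k r v)"
      using det_unstar_linear[of J k j scale e w] hyp(2)[OF 2(1)] 2(2) by blast
    have "graph_form scale e k p q G (x, w(j := v)) = (\<Sum>r<k. (C * c * u r) * dual_basis scale e k r v)" for v
      unfolding gf 2(3) u[rule_format] by (simp add: sum_distrib_left mult.assoc)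
    then show ?thesis
      by (intro exI[of _ k] exI[of _ "\<lambda>r. C * c * u r"] exI[of _ "dual_basis scale e k"] conjI allI
          dual_basis(1)[OF V B])
  qed
qed

lemma graph_form_multilinear:
  assumes V: "vector_space scale" and B: "ordered_basis scale e k" and G: "G \<in> one_regular_sl_graphs k p q"
  shows "graph_form scale e k p q G \<in> multilinear_forms scale p q"
  unfolding multilinear_forms_def
proof (intro CollectI conjI allI impI ballI case_prodI2)
  fix z assume "z \<notin> points scale p q"
  then show "graph_form scale e k p q G z = 0" by (cases z) (simp add: graph_form_def)
next
  fix z x w i \<phi> \<psi>
  assume z: "z \<in> points scale p q" "z = (x, w)" and i: "i \<in> {1..p}" and \<phi>: "\<phi> \<in> covectors scale" "\<psi> \<in> covectors scale"
  obtain n u v where *: "(x(i := \<phi>), w) \<in> points scale p q \<Longrightarrow>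
    graph_form scale e k p q G (x(i := \<phi>), w) = (\<Sum>r<(n::nat). u r * \<phi> (v r))" for \<phi>
    using graph_form_linear_star[OF G i, of x w scale e] by blast
  have "(x(i := \<chi>), w) \<in> points scale p q" if "\<chi> \<in> covectors scale" for \<chi>
    using points_upd_star[of x w scale p q i \<chi>] z i that by simp
  then show "graph_form scale e k p q G (x(i := \<phi> + \<psi>), w) =
    graph_form scale e k p q G (x(i := \<phi>), w) + graph_form scale e k p q G (x(i := \<psi>), w)"
    using \<phi> covectors_add[OF V \<phi>] by (simp add: * distrib_left sum.distrib)
next
  fix z x w i \<phi> c
  assume z: "z \<in> points scale p q" "z = (x, w)" and i: "i \<in> {1..p}" and \<phi>: "\<phi> \<in> covectors scale"
  obtain n u v where *: "(x(i := \<phi>), w) \<in> points scale p q \<Longrightarrow>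
    graph_form scale e k p q G (x(i := \<phi>), w) = (\<Sum>r<(n::nat). u r * \<phi> (v r))" for \<phi>
    using graph_form_linear_star[OF G i, of x w scale e] by blast
  have "(x(i := \<chi>), w) \<in> points scale p q" if "\<chi> \<in> covectors scale" for \<chi>
    using points_upd_star[of x w scale p q i \<chi>] z i that by simp
  then show "graph_form scale e k p q G (x(i := \<lambda>v. c * \<phi> v), w) = c * graph_form scale e k p q G (x(i := \<phi>), w)"
    using \<phi> covectors_scale[OF V \<phi>, of c] by (simp add: * sum_distrib_left mult.left_commute)
next
  fix z x w j assume z: "z \<in> points scale p q" "z = (x, w)" and j: "j \<in> {1..q}"
  then have xw: "(x, w) \<in> points scale p q" by simp
  obtain n u \<psi> where \<psi>: "\<And>r. \<psi> r \<in> covectors scale"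
    and *: "\<And>v. graph_form scale e k p q G (x, w(j := v)) = (\<Sum>r<(n::nat). u r * \<psi> r v)"
    using graph_form_linear_unstar[OF V B G j xw] by blast
  have "\<psi> r (a + b) = \<psi> r a + \<psi> r b" "\<psi> r (scale c a) = c * \<psi> r a" for r a b c
    using \<psi>[of r] by (simp_all add: covectors_def linear_mult_iff[OF V])
  then show "Vector_Spaces.linear scale (*) (\<lambda>v. graph_form scale e k p q G (x, w(j := v)))"
    unfolding linear_mult_iff[OF V] *
    by (simp add: distrib_left sum.distrib sum_distrib_left mult.left_commute)
qed


section \<open>Values and invariance of graph forms\<close>

definition basis_point ::
  "(complex \<Rightarrow> 'v::ab_group_add \<Rightarrow> 'v) \<Rightarrow> (nat \<Rightarrow> 'v) \<Rightarrow> nat \<Rightarrow> nat \<Rightarrow> nat \<Rightarrow>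
   (nat \<Rightarrow> nat) \<Rightarrow> (nat \<Rightarrow> nat) \<Rightarrow> (nat \<Rightarrow> 'v \<Rightarrow> complex) \<times> (nat \<Rightarrow> 'v)" where
  "basis_point scale e k p q a b =
     (restrict (\<lambda>i. dual_basis scale e k (a i)) {1..p}, restrict (\<lambda>j. e (b j)) {1..q})"

lemma graph_form_basis_point:
  assumes V: "vector_space scale" and B: "ordered_basis scale e k"
    and G: "G \<in> one_regular_sl_graphs k p q" and w: "a \<in> words k" "b \<in> words k"
  shows "graph_form scale e k p q G (basis_point scale e k p q a b) = word_value k G a b"
proof -
  note hyp = one_regular_sl_graph_hyperedges[OF G]
  let ?d = "dual_basis scale e k"
  define x where "x = restrict (\<lambda>i. ?d (a i)) {1..p}"
  define u where "u = restrict (\<lambda>j. e (b j)) {1..q}"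
  have d: "?d r (e s) = (if r = s then 1 else 0)" if "r < k" "s < k" for r s
    using dual_basis(3)[OF V B that] .
  have pt: "(x, u) \<in> points scale p q"
    using dual_basis(1)[OF V B] by (auto simp: x_def u_def points_def)
  have arcs: "(\<Prod>(i, j) \<in># arcs G. x i (u j)) = (\<Prod>(i, j) \<in># arcs G. if a i = b j then 1 else 0)"
    using hyp(3) d w
    by (intro arg_cong[of _ _ prod_mset] image_mset_cong) (auto simp: x_def u_def words_def)
  have "det_star e k x I = word_det k a I" if I: "I \<in> set (star_hyperedges G)" for I
  proof -
    have "I ! c \<in> {1..p}" if "c < k" for c using hyp(1)[OF I] that by (metis nth_mem subsetD)
    then show ?thesis
      unfolding det_star_def word_det_def using d w
      by (intro arg_cong[of _ _ det] eq_matI) (auto simp: x_def words_def)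
  qed
  then have stars: "map (det_star e k x) (star_hyperedges G) = map (word_det k a) (star_hyperedges G)"
    by simp
  have "det_unstar scale e k u J = word_det k b J" if J: "J \<in> set (unstar_hyperedges G)" for J
  proof -
    have "J ! c \<in> {1..q}" if "c < k" for c using hyp(2)[OF J] that by (metis nth_mem subsetD)
    then show ?thesis
      unfolding det_unstar_def word_det_def using d w
      by (intro arg_cong[of _ _ det] eq_matI) (auto simp: u_def words_def)
  qed
  then have unstars: "map (det_unstar scale e k u) (unstar_hyperedges G) = map (word_det k b) (unstar_hyperedges G)"
    by simp
  show ?thesis
    unfolding basis_point_def x_def[symmetric] u_def[symmetric] graph_form_def word_value_def
      prod.case if_P[OF pt] arcs stars unstars ..
qed

lemma basis_expansion:
  assumes V: "vector_space scale" and B: "ordered_basis scale e k"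
    and f: "Vector_Spaces.linear scale (*) (f :: 'v::ab_group_add \<Rightarrow> complex)"
  shows "f v = (\<Sum>s<k. dual_basis scale e k s v * f (e s))"
  using linear_sum_scale[OF V f, of "\<lambda>s. dual_basis scale e k s v" e "{..<k}"] dual_basis(2)[OF V B, of v]
  by simp

lemma linear_sum_scale_vector:
  assumes "Vector_Spaces.linear scale scale g"
  shows "g (\<Sum>s\<in>A. scale (c s) (u s)) = (\<Sum>s\<in>A. scale (c s) (g (u s)))"
proof -
  interpret Vector_Spaces.linear scale scale g by fact
  show ?thesis by (simp add: sum scale)
qed

definition matrix_of :: "(complex \<Rightarrow> 'v::ab_group_add \<Rightarrow> 'v) \<Rightarrow> (nat \<Rightarrow> 'v) \<Rightarrow> nat \<Rightarrow> ('v \<Rightarrow> 'v) \<Rightarrow> complex mat" where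
  "matrix_of scale e k g = mat k k (\<lambda>(r, c). dual_basis scale e k r (g (e c)))"

text \<open>
  The adjugate matrix provides a right inverse.
\<close>

lemma special_linear_surj:
  assumes V: "vector_space scale" and B: "ordered_basis scale e k" and g: "g \<in> special_linear scale e k"
  shows "surj g"
proof
  let ?M = "matrix_of scale e k g"
  have lin: "Vector_Spaces.linear scale scale g" and det: "det ?M = 1"
    using g by (auto simp: special_linear_def matrix_of_def)
  interpret vector_space scale by (rule V)
  have M: "?M \<in> carrier_mat k k" by (simp add: matrix_of_def)
  obtain N where N: "N \<in> carrier_mat k k" "?M * N = 1\<^sub>m k"
  proof
    have "(1 :: complex) \<cdot>\<^sub>m 1\<^sub>m k = 1\<^sub>m k" by (rule eq_matI) auto
    then show "?M * adj_mat ?M = 1\<^sub>m k" using adj_mat(2)[OF M] det by simp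
  qed (rule adj_mat(1)[OF M])
  have inv: "(\<Sum>s<k. ?M $$ (r, s) * N $$ (s, t)) = (if r = t then 1 else 0)" if "r < k" "t < k" for r t
  proof -
    have "(?M * N) $$ (r, t) = (\<Sum>s<k. ?M $$ (r, s) * N $$ (s, t))"
      using that M N(1) by (simp add: scalar_prod_def atLeast0LessThan)
    then show ?thesis using N(2) that by simp
  qed
  show "UNIV \<subseteq> range g"
  proof
    fix v
    let ?d = "dual_basis scale e k"
    \<comment> \<open>the coordinates of a preimage of \<open>v\<close>\<close>
    define c where "c s = (\<Sum>t<k. N $$ (s, t) * ?d t v)" for s
    have "g (\<Sum>s<k. scale (c s) (e s)) = (\<Sum>s<k. scale (c s) (g (e s)))"
      by (rule linear_sum_scale_vector[OF lin])
    also have "\<dots> = (\<Sum>s<k. scale (c s) (\<Sum>r<k. scale (?d r (g (e s))) (e r)))"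
      by (simp only: dual_basis(2)[OF V B])
    also have "\<dots> = (\<Sum>r<k. scale (\<Sum>s<k. c s * ?d r (g (e s))) (e r))"
      unfolding scale_sum_right scale_scale scale_sum_left by (rule sum.swap)
    also have "\<dots> = (\<Sum>r<k. scale (?d r v) (e r))"
    proof (intro sum.cong refl arg_cong2[of _ _ _ _ scale])
      fix r assume r: "r \<in> {..<k}"
      have "(\<Sum>s<k. c s * ?d r (g (e s))) = (\<Sum>s<k. \<Sum>t<k. ?M $$ (r, s) * N $$ (s, t) * ?d t v)"
        unfolding c_def sum_distrib_right using r
        by (intro sum.cong refl) (simp add: matrix_of_def mult.commute mult.left_commute)
      also have "\<dots> = (\<Sum>t<k. (\<Sum>s<k. ?M $$ (r, s) * N $$ (s, t)) * ?d t v)"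
        unfolding sum_distrib_right by (rule sum.swap)
      also have "\<dots> = (\<Sum>t<k. if r = t then ?d t v else 0)"
        using inv r by (intro sum.cong) auto
      also have "\<dots> = ?d r v" using r by simp
      finally show "(\<Sum>s<k. c s * ?d r (g (e s))) = ?d r v" .
    qed
    also have "\<dots> = v" by (rule dual_basis(2)[OF V B])
    finally show "v \<in> range g" by (metis rangeI)
  qed
qed simp

text \<open>
  An arc pairs a covector with a vector and the two actions cancel. A determinant of covectors or vectors is multiplied by
  the determinant of \<open>g\<close> or of its inverse, which is 1.
\<close>

lemma graph_form_invariant:
  fixes scale :: "complex \<Rightarrow> 'v::ab_group_add \<Rightarrow> 'v"
  assumes V: "vector_space scale" and B: "ordered_basis scale e k"
    and G: "G \<in> one_regular_sl_graphs k p q" and g: "g \<in> special_linear scale e k"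
  shows "tensor_action scale p q g (graph_form scale e k p q G) = graph_form scale e k p q G"
proof (rule ext, clarify)
  fix x :: "nat \<Rightarrow> 'v \<Rightarrow> complex" and w :: "nat \<Rightarrow> 'v"
  note hyp = one_regular_sl_graph_hyperedges[OF G]
  let ?d = "dual_basis scale e k" and ?M = "matrix_of scale e k g"
  let ?x = "restrict (\<lambda>i. x i \<circ> g) {1..p}" and ?w = "restrict (\<lambda>j. inv_into UNIV g (w j)) {1..q}"
  have lin: "Vector_Spaces.linear scale scale g" and det: "det ?M = 1"
    using g by (auto simp: special_linear_def matrix_of_def)
  have M: "?M \<in> carrier_mat k k" by (simp add: matrix_of_def)
  have g_inv: "g (inv_into UNIV g v) = v" for v
    using special_linear_surj[OF V B g] by (rule surj_f_inv_f)
  show "tensor_action scale p q g (graph_form scale e k p q G) (x, w) = graph_form scale e k p q G (x, w)"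
  proof (cases "(x, w) \<in> points scale p q")
    case True
    have xlin: "Vector_Spaces.linear scale (*) (x i)" if "i \<in> {1..p}" for i
      using True that by (auto simp: points_def covectors_def)
    have pt: "(?x, ?w) \<in> points scale p q"
      using Vector_Spaces.linear_compose[OF lin xlin] by (auto simp: points_def covectors_def)
    have arcs: "(\<Prod>(i, j) \<in># arcs G. ?x i (?w j)) = (\<Prod>(i, j) \<in># arcs G. x i (w j))"
      using hyp(3) by (intro arg_cong[of _ _ prod_mset] image_mset_cong) (auto simp: g_inv)
    have "det_star e k ?x I = det_star e k x I" if I: "I \<in> set (star_hyperedges G)" for I
    proof -
      have mem: "I ! c \<in> {1..p}" if "c < k" for c using hyp(1)[OF I] that by (metis nth_mem subsetD)
      let ?X = "mat k k (\<lambda>(r, c). x (I ! c) (e r))"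
      have "mat k k (\<lambda>(r, c). ?x (I ! c) (e r)) = transpose_mat ?M * ?X"
      proof (rule eq_matI)
        fix r c assume "r < dim_row (transpose_mat ?M * ?X)" "c < dim_col (transpose_mat ?M * ?X)"
        then have rc: "r < k" "c < k" using M by auto
        have "(transpose_mat ?M * ?X) $$ (r, c) = (\<Sum>s<k. ?d s (g (e r)) * x (I ! c) (e s))"
          using rc by (simp add: scalar_prod_def matrix_of_def atLeast0LessThan)
        also have "\<dots> = x (I ! c) (g (e r))" by (rule basis_expansion[OF V B xlin[OF mem[OF rc(2)]], symmetric])
        finally show "mat k k (\<lambda>(r, c). ?x (I ! c) (e r)) $$ (r, c) = (transpose_mat ?M * ?X) $$ (r, c)"
          using rc mem[OF rc(2)] by simp
      qed (use M in auto)
      then have "det_star e k ?x I = det (transpose_mat ?M * ?X)" by (simp only: det_star_def)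
      also have "\<dots> = det ?X"
        using M det by (subst det_mult[of _ k]) (auto simp: det_transpose)
      finally show ?thesis by (simp only: det_star_def)
    qed
    then have stars: "map (det_star e k ?x) (star_hyperedges G) = map (det_star e k x) (star_hyperedges G)"
      by simp
    have "det_unstar scale e k ?w J = det_unstar scale e k w J" if J: "J \<in> set (unstar_hyperedges G)" for J
    proof -
      have mem: "J ! c \<in> {1..q}" if "c < k" for c using hyp(2)[OF J] that by (metis nth_mem subsetD)
      let ?W = "mat k k (\<lambda>(r, c). ?d r (?w (J ! c)))"
      have d_lin: "Vector_Spaces.linear scale (*) (?d r \<circ> g)" for r
        using dual_basis(1)[OF V B, of r] unfolding covectors_def mem_Collect_eq
        by (rule Vector_Spaces.linear_compose[OF lin])
      have "?d r (w j) = (\<Sum>s<k. ?d r (g (e s)) * ?d s (inv_into UNIV g (w j)))" for r j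
        using basis_expansion[OF V B d_lin, of r "inv_into UNIV g (w j)"]
        unfolding comp_apply g_inv by (simp only: mult.commute)
      note entry = this
      have "mat k k (\<lambda>(r, c). ?d r (w (J ! c))) = ?M * ?W"
      proof (rule eq_matI)
        fix r c assume "r < dim_row (?M * ?W)" "c < dim_col (?M * ?W)"
        then have rc: "r < k" "c < k" using M by auto
        have "(?M * ?W) $$ (r, c) = (\<Sum>s<k. ?d r (g (e s)) * ?d s (inv_into UNIV g (w (J ! c))))"
          using rc mem[OF rc(2)] by (simp add: scalar_prod_def matrix_of_def atLeast0LessThan)
        then show "mat k k (\<lambda>(r, c). ?d r (w (J ! c))) $$ (r, c) = (?M * ?W) $$ (r, c)"
          unfolding entry[symmetric] using rc by simp
      qed (use M in auto)
      then have "det_unstar scale e k w J = det (?M * ?W)" by (simp only: det_unstar_def)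
      also have "\<dots> = det ?W" using M det by (subst det_mult[of _ k]) auto
      finally show ?thesis by (simp only: det_unstar_def)
    qed
    then have unstars: "map (det_unstar scale e k ?w) (unstar_hyperedges G) = map (det_unstar scale e k w) (unstar_hyperedges G)"
      by simp
    show ?thesis
      unfolding tensor_action_def graph_form_def prod.case if_P[OF True] if_P[OF pt] arcs stars unstars ..
  qed (simp add: tensor_action_def graph_form_def)
qed


section \<open>Unipotent elements of the special linear group\<close>

definition word_form ::
  "(complex \<Rightarrow> 'v::ab_group_add \<Rightarrow> 'v) \<Rightarrow> (nat \<Rightarrow> 'v) \<Rightarrow> nat \<Rightarrow> nat \<Rightarrow> nat \<Rightarrow> 'v form \<Rightarrow>
   (nat \<Rightarrow> nat) \<Rightarrow> (nat \<Rightarrow> nat) \<Rightarrow> complex" where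
  "word_form scale e k p q F a b = F (basis_point scale e k p q a b)"

lemma multilinear_add_scale_star:
  assumes V: "vector_space scale" and F: "F \<in> multilinear_forms scale p q"
    and pt: "(x, w) \<in> points scale p q" and i: "i \<in> {1..p}" and \<phi>: "\<phi> \<in> covectors scale" "\<psi> \<in> covectors scale"
  shows "F (x(i := (\<lambda>v. \<phi> v + c * \<psi> v)), w) = F (x(i := \<phi>), w) + c * F (x(i := \<psi>), w)"
proof -
  have "F (x(i := \<phi> + (\<lambda>v. c * \<psi> v)), w) = F (x(i := \<phi>), w) + F (x(i := (\<lambda>v. c * \<psi> v)), w)"
    using F pt i \<phi> covectors_scale[OF V \<phi>(2), of c] unfolding multilinear_forms_def by blast
  moreover have "F (x(i := (\<lambda>v. c * \<psi> v)), w) = c * F (x(i := \<psi>), w)"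
    using F pt i \<phi> unfolding multilinear_forms_def by blast
  moreover have "\<phi> + (\<lambda>v. c * \<psi> v) = (\<lambda>v. \<phi> v + c * \<psi> v)" by (simp add: fun_eq_iff)
  ultimately show ?thesis by simp
qed

lemma multilinear_add_scale_unstar:
  assumes V: "vector_space scale" and F: "F \<in> multilinear_forms scale p q"
    and pt: "(x, w) \<in> points scale p q" and j: "j \<in> {1..q}"
  shows "F (x, w(j := u + scale c v)) = F (x, w(j := u)) + c * F (x, w(j := v))"
proof -
  have "Vector_Spaces.linear scale (*) (\<lambda>v. F (x, w(j := v)))"
    using F pt j unfolding multilinear_forms_def by blast
  then show ?thesis by (simp add: linear_mult_iff[OF V])
qed

text \<open>
  The images of dual basis covectors under the unipotent element \<open>v + t d v \<sqdot> e s\<close>, where \<open>d\<close> is the \<open>r\<close>-th dual basis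
  covector: those with the letter \<open>s\<close> move in the direction of \<open>d\<close>. The set \<open>X\<close> restricts the change to some of the slots,
  so that slots can be added one at a time.
\<close>

definition tilted_star ::
  "(complex \<Rightarrow> 'v::ab_group_add \<Rightarrow> 'v) \<Rightarrow> (nat \<Rightarrow> 'v) \<Rightarrow> nat \<Rightarrow> nat \<Rightarrow> nat \<Rightarrow> complex \<Rightarrow>
   (nat \<Rightarrow> nat) \<Rightarrow> nat set \<Rightarrow> nat \<Rightarrow> 'v \<Rightarrow> complex" where
  "tilted_star scale e k p r t a X =
     restrict (\<lambda>i v. dual_basis scale e k (a i) v + (if i \<in> X then t * dual_basis scale e k r v else 0)) {1..p}"

definition tilted_unstar ::
  "(complex \<Rightarrow> 'v::ab_group_add \<Rightarrow> 'v) \<Rightarrow> (nat \<Rightarrow> 'v) \<Rightarrow> nat \<Rightarrow> nat \<Rightarrow> complex \<Rightarrow>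
   (nat \<Rightarrow> nat) \<Rightarrow> nat set \<Rightarrow> nat \<Rightarrow> 'v" where
  "tilted_unstar scale e q s t b Y =
     restrict (\<lambda>j. e (b j) + (if j \<in> Y then scale (- t) (e s) else 0)) {1..q}"

lemma tilted_star_upd:
  assumes "i \<in> {1..p}" "i \<notin> X"
  shows "tilted_star scale e k p r t (a(i := c)) X = (tilted_star scale e k p r t a X)(i := dual_basis scale e k c)"
    and "tilted_star scale e k p r t a (insert i X) =
      (tilted_star scale e k p r t a X)(i := (\<lambda>v. dual_basis scale e k (a i) v + t * dual_basis scale e k r v))"
  using assms by (auto simp: tilted_star_def fun_eq_iff)

lemma tilted_unstar_upd:
  assumes "j \<in> {1..q}" "j \<notin> Y"
  shows "tilted_unstar scale e q s t (b(j := c)) Y = (tilted_unstar scale e q s t b Y)(j := e c)"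
    and "tilted_unstar scale e q s t b (insert j Y) =
      (tilted_unstar scale e q s t b Y)(j := e (b j) + scale (- t) (e s))"
  using assms by (auto simp: tilted_unstar_def fun_eq_iff)

lemma tilted_empty:
  "(tilted_star scale e k p r t a {}, tilted_unstar scale e q s t b {}) = basis_point scale e k p q a b"
  by (simp add: tilted_star_def tilted_unstar_def basis_point_def)

lemma tilted_points:
  assumes V: "vector_space scale" and B: "ordered_basis scale e k"
  shows "(tilted_star scale e k p r t a X, tilted_unstar scale e q s t b Y) \<in> points scale p q"
proof -
  have "(\<lambda>v. dual_basis scale e k c v + (if P then t * dual_basis scale e k r v else 0)) \<in> covectors scale" for c P
    using covectors_add[OF V dual_basis(1)[OF V B] covectors_scale[OF V dual_basis(1)[OF V B]], of c t r]
      dual_basis(1)[OF V B, of c] by (cases P) (simp_all add: plus_fun_def)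
  then show ?thesis by (auto simp: tilted_star_def tilted_unstar_def points_def)
qed

text \<open>
  Each tilted slot splits the value, by multilinearity, into the value with the slot as it was and \<open>t\<close> or \<open>- t\<close> times
  the value with the slot replaced. Hence the value is a polynomial in \<open>t\<close> whose linear coefficient collects the terms
  with a single replacement.
\<close>

lemma tilted_form_poly:
  fixes scale :: "complex \<Rightarrow> 'v::ab_group_add \<Rightarrow> 'v"
  assumes V: "vector_space scale" and B: "ordered_basis scale e k"
    and F: "F \<in> multilinear_forms scale p q"
    and X: "X \<subseteq> {1..p}" "\<forall>i\<in>X. a i = s" and Y: "Y \<subseteq> {1..q}" "\<forall>j\<in>Y. b j = r"
  defines "\<Phi> \<equiv> word_form scale e k p q F"
  shows "\<exists>P. (\<forall>t. F (tilted_star scale e k p r t a X, tilted_unstar scale e q s t b Y) = poly P t) \<and> coeff P 0 = \<Phi> a b \<and>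
    coeff P 1 = (\<Sum>i\<in>X. \<Phi> (a(i := r)) b) - (\<Sum>j\<in>Y. \<Phi> a (b(j := s)))"
proof -
  interpret vector_space scale by (rule V)
  let ?d = "dual_basis scale e k" and ?x = "tilted_star scale e k p r" and ?w = "tilted_unstar scale e q s"
  have cov: "?d c \<in> covectors scale" for c by (rule dual_basis(1)[OF V B])
  have Y_case: "\<exists>P. (\<forall>t. F (?x t a {}, ?w t b Y) = poly P t) \<and> coeff P 0 = \<Phi> a b \<and>
      coeff P 1 = - (\<Sum>j\<in>Y. \<Phi> a (b(j := s)))"
    if "finite Y" "Y \<subseteq> {1..q}" "\<forall>j\<in>Y. b j = r" for Y a b
    using that
  proof (induction Y arbitrary: b)
    case empty
    show ?case by (intro exI[of _ "[:\<Phi> a b:]"]) (simp add: tilted_empty \<Phi>_def word_form_def)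
  next
    case (insert j Y)
    have j: "j \<in> {1..q}" "b j = r" using insert.prems by auto
    have sub: "Y \<subseteq> {1..q}" and eqY: "\<forall>j\<in>Y. b j = r" using insert.prems by auto
    have "\<forall>j'\<in>Y. (b(j := s)) j' = r" using eqY insert.hyps(2) by auto
    from insert.IH[OF sub this] obtain P2 where P2: "\<forall>t. F (?x t a {}, ?w t (b(j := s)) Y) = poly P2 t" "coeff P2 0 = \<Phi> a (b(j := s))" by blast
    from insert.IH[OF sub eqY] obtain P1 where P1: "\<forall>t. F (?x t a {}, ?w t b Y) = poly P1 t" "coeff P1 0 = \<Phi> a b"
      "coeff P1 1 = - (\<Sum>j\<in>Y. \<Phi> a (b(j := s)))" by blast
    have "F (?x t a {}, ?w t b (insert j Y)) = poly (P1 - pCons 0 P2) t" for t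
    proof -
      have upd: "?w t b Y = (?w t b Y)(j := e r)"
        by (rule tilted_unstar_upd(1)[OF j(1) insert.hyps(2), of scale e s t b "b j", unfolded fun_upd_triv, unfolded j(2)])
      have "F (?x t a {}, ?w t b (insert j Y)) = F (?x t a {}, (?w t b Y)(j := e r)) + (- t) * F (?x t a {}, (?w t b Y)(j := e s))"
        unfolding tilted_unstar_upd(2)[OF j(1) insert.hyps(2)] j(2)
        by (rule multilinear_add_scale_unstar[OF V F tilted_points[OF V B] j(1)])
      also have "\<dots> = F (?x t a {}, ?w t b Y) + (- t) * F (?x t a {}, ?w t (b(j := s)) Y)"
        unfolding upd[symmetric] tilted_unstar_upd(1)[OF j(1) insert.hyps(2)] ..
      finally have "F (?x t a {}, ?w t b (insert j Y)) = F (?x t a {}, ?w t b Y) + (- t) * F (?x t a {}, ?w t (b(j := s)) Y)" .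
      then show ?thesis using P1(1) P2(1) by simp
    qed
    moreover have "coeff (P1 - pCons 0 P2) 0 = \<Phi> a b" using P1(2) by (simp add: coeff_pCons)
    moreover have "coeff (P1 - pCons 0 P2) 1 = coeff P1 1 - coeff P2 0" by (simp add: coeff_pCons)
    then have "coeff (P1 - pCons 0 P2) 1 = - (\<Sum>j\<in>insert j Y. \<Phi> a (b(j := s)))"
      unfolding P1(3) P2(2) sum.insert[OF insert.hyps] minus_add_distrib by (simp only: add.commute diff_conv_add_uminus)
    ultimately show ?case by blast
  qed
  have "\<exists>P. (\<forall>t. F (?x t a X, ?w t b Y) = poly P t) \<and> coeff P 0 = \<Phi> a b \<and>
      coeff P 1 = (\<Sum>i\<in>X. \<Phi> (a(i := r)) b) - (\<Sum>j\<in>Y. \<Phi> a (b(j := s)))"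
    if "finite X" "X \<subseteq> {1..p}" "\<forall>i\<in>X. a i = s" for X a
    using that
  proof (induction X arbitrary: a)
    case empty
    have "finite Y" using Y(1) finite_subset by blast
    from Y_case[OF this Y] show ?case unfolding sum.empty diff_0 .
  next
    case (insert i X)
    have i: "i \<in> {1..p}" "a i = s" using insert.prems by auto
    have sub: "X \<subseteq> {1..p}" and eqX: "\<forall>i\<in>X. a i = s" using insert.prems by auto
    have "\<forall>i'\<in>X. (a(i := r)) i' = s" using eqX insert.hyps(2) by auto
    from insert.IH[OF sub this] obtain P2 where P2: "\<forall>t. F (?x t (a(i := r)) X, ?w t b Y) = poly P2 t" "coeff P2 0 = \<Phi> (a(i := r)) b" by blast
    from insert.IH[OF sub eqX] obtain P1 where P1: "\<forall>t. F (?x t a X, ?w t b Y) = poly P1 t" "coeff P1 0 = \<Phi> a b"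
      "coeff P1 1 = (\<Sum>i\<in>X. \<Phi> (a(i := r)) b) - (\<Sum>j\<in>Y. \<Phi> a (b(j := s)))" by blast
    have "F (?x t a (insert i X), ?w t b Y) = poly (P1 + pCons 0 P2) t" for t
    proof -
      have upd: "?x t a X = (?x t a X)(i := ?d s)"
        by (rule tilted_star_upd(1)[OF i(1) insert.hyps(2), of scale e k r t a "a i", unfolded fun_upd_triv, unfolded i(2)])
      have "F (?x t a (insert i X), ?w t b Y) = F ((?x t a X)(i := ?d s), ?w t b Y) + t * F ((?x t a X)(i := ?d r), ?w t b Y)"
        unfolding tilted_star_upd(2)[OF i(1) insert.hyps(2)] i(2)
        by (rule multilinear_add_scale_star[OF V F tilted_points[OF V B] i(1) cov cov])
      also have "\<dots> = F (?x t a X, ?w t b Y) + t * F (?x t (a(i := r)) X, ?w t b Y)"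
        unfolding upd[symmetric] tilted_star_upd(1)[OF i(1) insert.hyps(2)] ..
      finally have "F (?x t a (insert i X), ?w t b Y) = F (?x t a X, ?w t b Y) + t * F (?x t (a(i := r)) X, ?w t b Y)" .
      then show ?thesis using P1(1) P2(1) by simp
    qed
    moreover have "coeff (P1 + pCons 0 P2) 0 = \<Phi> a b" using P1(2) by (simp add: coeff_pCons)
    moreover have "coeff (P1 + pCons 0 P2) 1 = coeff P1 1 + coeff P2 0" by (simp add: coeff_pCons)
    then have "coeff (P1 + pCons 0 P2) 1 = (\<Sum>i\<in>insert i X. \<Phi> (a(i := r)) b) - (\<Sum>j\<in>Y. \<Phi> a (b(j := s)))"
      unfolding P1(3) P2(2) sum.insert[OF insert.hyps] by (simp only: diff_conv_add_uminus ac_simps)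
    ultimately show ?case by blast
  qed
  note X_case = this
  have "finite X" using X(1) finite_subset by blast
  from X_case[OF this X] show ?thesis .
qed

lemma linear_add_functional:
  assumes V: "vector_space scale" and f: "f \<in> covectors scale"
  shows "Vector_Spaces.linear scale scale (\<lambda>v. v + scale (f v) u)"
proof -
  interpret vector_space scale by (rule V)
  have "f (a + b) = f a + f b" "f (scale c a) = c * f a" for a b c
    using f by (simp_all add: covectors_def linear_mult_iff[OF V])
  then show ?thesis
    by (intro Vector_Spaces.linear_iff[THEN iffD2]) (simp add: V scale_left_distrib scale_right_distrib)
qed

text \<open>
  Along a unipotent one-parameter subgroup the polynomial of the preceding lemma is constant, so its linear coefficient
  vanishes.
\<close>

lemma invariant_unipotent:
  fixes scale :: "complex \<Rightarrow> 'v::ab_group_add \<Rightarrow> 'v"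
  assumes V: "vector_space scale" and B: "ordered_basis scale e k"
    and F: "F \<in> tensor_invariants scale e k p q"
    and w: "a \<in> words k" "b \<in> words k" and rs: "r < k" "s < k" "r \<noteq> s"
  defines "\<Phi> \<equiv> word_form scale e k p q F"
  shows "(\<Sum>i\<in>{i\<in>{1..p}. a i = s}. \<Phi> (a(i := r)) b) = (\<Sum>j\<in>{j\<in>{1..q}. b j = r}. \<Phi> a (b(j := s)))"
proof -
  interpret vector_space scale by (rule V)
  let ?d = "dual_basis scale e k" and ?x = "tilted_star scale e k p r" and ?w = "tilted_unstar scale e q s"
  have FM: "F \<in> multilinear_forms scale p q"
    using F tensor_space_eq_multilinear_forms[OF V B] by (simp add: tensor_invariants_def)
  have d_add: "?d c (u + v) = ?d c u + ?d c v" "?d c (scale l u) = l * ?d c u" for c u v l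
    using dual_basis(1)[OF V B, of c] by (simp_all add: covectors_def linear_mult_iff[OF V])
  have d: "?d c (e c') = (if c = c' then 1 else 0)" if "c < k" "c' < k" for c c'
    by (rule dual_basis(3)[OF V B that])
  define g where "g t v = v + scale (t * ?d r v) (e s)" for t v
  have inv: "g (- t) (g t v) = v" for t v
    using d[OF rs(1,2)] rs(3) by (simp add: g_def d_add)
  have SL: "g t \<in> special_linear scale e k" for t
  proof -
    have "Vector_Spaces.linear scale scale (g t)"
      unfolding g_def using linear_add_functional[OF V covectors_scale[OF V dual_basis(1)[OF V B]]] .
    moreover have "mat k k (\<lambda>(r', c). ?d r' (g t (e c))) = addrow_mat k t s r"
      unfolding addrow_mat_def using d rs
      by (intro eq_matI) (auto simp: g_def d_add)
    ultimately show ?thesis using det_addrow_mat[of s r k t] rs(3) by (simp add: special_linear_def)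
  qed
  define X where "X = {i\<in>{1..p}. a i = s}"
  define Y where "Y = {j\<in>{1..q}. b j = r}"
  have XY: "X \<subseteq> {1..p}" "\<forall>i\<in>X. a i = s" "Y \<subseteq> {1..q}" "\<forall>j\<in>Y. b j = r"
    by (auto simp: X_def Y_def)
  have "F (?x t a X, ?w t b Y) = \<Phi> a b" for t
  proof -
    have pt: "basis_point scale e k p q a b \<in> points scale p q"
      using dual_basis(1)[OF V B] by (auto simp: basis_point_def points_def)
    have "inj (g t)" using inv by (metis injI)
    then have g_inv: "inv_into UNIV (g t) v = g (- t) v" for v
      using inv[of "- t" v] by (simp add: inv_f_eq)
    have 1: "restrict (\<lambda>i. restrict (\<lambda>i. ?d (a i)) {1..p} i \<circ> g t) {1..p} = ?x t a X"
      unfolding tilted_star_def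
      by (intro restrict_ext) (use d w rs in \<open>auto simp: fun_eq_iff g_def d_add X_def words_def\<close>)
    have 2: "restrict (\<lambda>j. inv_into UNIV (g t) (restrict (\<lambda>j. e (b j)) {1..q} j)) {1..q} = ?w t b Y"
      unfolding tilted_unstar_def g_inv
      by (intro restrict_ext) (use d w rs in \<open>auto simp: g_def Y_def words_def\<close>)
    have "tensor_action scale p q (g t) F (basis_point scale e k p q a b) = F (?x t a X, ?w t b Y)"
      using pt unfolding tensor_action_def basis_point_def prod.case 1 2 by (rule if_P)
    moreover have "tensor_action scale p q (g t) F = F"
      using F SL by (simp add: tensor_invariants_def)
    ultimately show ?thesis by (simp add: \<Phi>_def word_form_def)
  qed
  moreover obtain P where P: "\<forall>t. F (?x t a X, ?w t b Y) = poly P t"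
    "coeff P 1 = (\<Sum>i\<in>X. \<Phi> (a(i := r)) b) - (\<Sum>j\<in>Y. \<Phi> a (b(j := s)))"
    using tilted_form_poly[OF V B FM XY] unfolding \<Phi>_def by blast
  ultimately have "poly (P - [:\<Phi> a b:]) t = 0" for t by simp
  then have "P - [:\<Phi> a b:] = 0" by (intro poly_all_0_iff_0[THEN iffD1] allI)
  then have "P = [:\<Phi> a b:]" by simp
  then have "coeff P 1 = 0" by simp
  then show ?thesis using P(2) by (simp add: X_def Y_def)
qed


section \<open>Diagonal elements and weights\<close>

text \<open>
  The sets \<open>X\<close> and \<open>Y\<close> in the proof collect the slots that are already rescaled.
\<close>

lemma multilinear_scale_all:
  assumes V: "vector_space scale" and B: "ordered_basis scale e k" and F: "F \<in> multilinear_forms scale p q"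
  shows "F (restrict (\<lambda>i v. c i * dual_basis scale e k (a i) v) {1..p}, restrict (\<lambda>j. scale (d j) (e (b j))) {1..q}) =
    (\<Prod>i\<in>{1..p}. c i) * (\<Prod>j\<in>{1..q}. d j) * F (basis_point scale e k p q a b)"
proof -
  let ?d = "dual_basis scale e k"
  define x where "x X = restrict (\<lambda>i. if i \<in> X then (\<lambda>v. c i * ?d (a i) v) else ?d (a i)) {1..p}" for X
  define w where "w Y = restrict (\<lambda>j. if j \<in> Y then scale (d j) (e (b j)) else e (b j)) {1..q}" for Y
  have cov: "?d r \<in> covectors scale" for r by (rule dual_basis(1)[OF V B])
  have pt: "(x X, w Y) \<in> points scale p q" for X Y
    using cov covectors_scale[OF V cov] by (auto simp: x_def w_def points_def)
  have star: "F (x X, w Y) = (\<Prod>i\<in>X. c i) * F (x {}, w Y)" if "finite X" "X \<subseteq> {1..p}" for X Y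
    using that
  proof (induction X)
    case (insert i X)
    then have i: "i \<in> {1..p}" by simp
    have 1: "x (insert i X) = (x X)(i := (\<lambda>v. c i * ?d (a i) v))" "x X = (x X)(i := ?d (a i))"
      using i insert.hyps by (auto simp: x_def fun_eq_iff)
    have "F ((x X)(i := (\<lambda>v. c i * ?d (a i) v)), w Y) = c i * F ((x X)(i := ?d (a i)), w Y)"
      using F pt[of X Y] i cov unfolding multilinear_forms_def by blast
    then have "F (x (insert i X), w Y) = c i * F (x X, w Y)" unfolding 1(1) 1(2)[symmetric] .
    then show ?case using insert by simp
  qed simp
  have unstar: "F (x X, w Y) = (\<Prod>j\<in>Y. d j) * F (x X, w {})" if "finite Y" "Y \<subseteq> {1..q}" for X Y
    using that
  proof (induction Y)
    case (insert j Y)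
    then have j: "j \<in> {1..q}" by simp
    have 1: "w (insert j Y) = (w Y)(j := scale (d j) (e (b j)))" "w Y = (w Y)(j := e (b j))"
      using j insert.hyps by (auto simp: w_def fun_eq_iff)
    have "Vector_Spaces.linear scale (*) (\<lambda>v. F (x X, (w Y)(j := v)))"
      using F pt[of X Y] j unfolding multilinear_forms_def by blast
    then have "F (x X, (w Y)(j := scale (d j) (e (b j)))) = d j * F (x X, (w Y)(j := e (b j)))"
      by (simp only: linear_mult_iff[OF V])
    then have "F (x X, w (insert j Y)) = d j * F (x X, w Y)" unfolding 1(1) 1(2)[symmetric] .
    then show ?case using insert by simp
  qed simp
  have "restrict (\<lambda>i v. c i * ?d (a i) v) {1..p} = x {1..p}" "restrict (\<lambda>j. scale (d j) (e (b j))) {1..q} = w {1..q}"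
    by (auto simp: x_def w_def fun_eq_iff)
  moreover have "(x {}, w {}) = basis_point scale e k p q a b"
    by (simp add: x_def w_def basis_point_def)
  moreover have "F (x {1..p}, w {1..q}) = (\<Prod>i\<in>{1..p}. c i) * ((\<Prod>j\<in>{1..q}. d j) * F (x {}, w {}))"
    using star[of "{1..p}" "{1..q}"] unstar[of "{1..q}" "{}"] by simp
  ultimately show ?thesis by (simp only: mult.assoc)
qed

lemma prod_two_letters:
  assumes "finite X" "r \<noteq> s" "u \<noteq> 0"
  shows "(\<Prod>i\<in>X. if c i = r then u else if c i = s then inverse u else 1 :: complex) =
    u ^ card {i\<in>X. c i = r} * inverse u ^ card {i\<in>X. c i = s}"
  using assms(1)
proof (induction X rule: finite_induct)
  case (insert x X)
  have "{i \<in> insert x X. c i = t} = (if c x = t then insert x {i \<in> X. c i = t} else {i \<in> X. c i = t})" for t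
    by auto
  then show ?case using insert assms(2,3) by simp
qed simp

text \<open>
  The element that doubles \<open>e r\<close> and halves \<open>e s\<close> has determinant 1 and multiplies the value on basis vectors by a power of 2.
  If the value is nonzero, the exponent is 0.
\<close>

lemma invariant_torus:
  fixes scale :: "complex \<Rightarrow> 'v::ab_group_add \<Rightarrow> 'v"
  assumes V: "vector_space scale" and B: "ordered_basis scale e k"
    and F: "F \<in> tensor_invariants scale e k p q"
    and w: "a \<in> words k" "b \<in> words k" and rs: "r < k" "s < k"
    and nz: "word_form scale e k p q F a b \<noteq> 0"
  shows "card {i\<in>{1..p}. a i = r} + card {j\<in>{1..q}. b j = s} =
    card {i\<in>{1..p}. a i = s} + card {j\<in>{1..q}. b j = r}"
proof (cases "r = s")
  case False
  interpret vector_space scale by (rule V)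
  let ?d = "dual_basis scale e k"
  have FM: "F \<in> multilinear_forms scale p q"
    using F tensor_space_eq_multilinear_forms[OF V B] by (simp add: tensor_invariants_def)
  have d: "?d c (e c') = (if c = c' then 1 else 0)" if "c < k" "c' < k" for c c'
    by (rule dual_basis(3)[OF V B that])
  have d_add: "?d c (u + v) = ?d c u + ?d c v" "?d c (scale l u) = l * ?d c u" for c u v l
    using dual_basis(1)[OF V B, of c] by (simp_all add: covectors_def linear_mult_iff[OF V])
  have d_sum: "?d c (\<Sum>s\<in>A. scale (h s) (u s)) = (\<Sum>s\<in>A. h s * ?d c (u s))" for c h u and A :: "nat set"
    using linear_sum_scale[OF V, of "?d c"] dual_basis(1)[OF V B, of c] by (simp add: covectors_def)
  define l where "l c = (if c = r then 2 else if c = s then inverse 2 else 1 :: complex)" for c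
  have l: "l c \<noteq> 0" for c by (simp add: l_def)
  define g where "g f v = (\<Sum>c<k. scale (f c * ?d c v) (e c))" for f :: "nat \<Rightarrow> complex" and v
  have dg: "?d c (g f v) = f c * ?d c v" if "c < k" for c f v
  proof -
    have "?d c (g f v) = (\<Sum>c'<k. if c = c' then f c * ?d c v else 0)"
      unfolding g_def d_sum using d that by (intro sum.cong) auto
    then show ?thesis using that by simp
  qed
  have ge: "g f (e c) = scale (f c) (e c)" if "c < k" for f c
  proof -
    have "g f (e c) = (\<Sum>c'<k. if c = c' then scale (f c) (e c) else 0)"
      unfolding g_def using d that by (intro sum.cong) auto
    then show ?thesis using that by simp
  qed
  have inv: "g (\<lambda>c. inverse (f c)) (g f v) = v" if "\<And>c. f c \<noteq> 0" for f v
  proof -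
    have "g (\<lambda>c. inverse (f c)) (g f v) = (\<Sum>c<k. scale (?d c v) (e c))"
      unfolding g_def[of "\<lambda>c. inverse (f c)"] using dg that by (intro sum.cong) auto
    then show ?thesis using dual_basis(2)[OF V B] by simp
  qed
  have "Vector_Spaces.linear scale scale (g l)"
    by (intro Vector_Spaces.linear_iff[THEN iffD2])
      (simp add: V g_def d_add distrib_left scale_left_distrib sum.distrib scale_sum_right mult.left_commute)
  moreover have "det (mat k k (\<lambda>(r', c). ?d r' (g l (e c)))) = 1"
  proof -
    let ?A = "mat k k (\<lambda>(r', c). ?d r' (g l (e c)))"
    have A: "?A $$ (i, j) = (if i = j then l j else 0)" if "i < k" "j < k" for i j
      using that d dg by simp
    have "det ?A = prod_list (diag_mat ?A)"
      by (rule det_upper_triangular[of _ k]) (use A in \<open>auto simp: upper_triangular_def\<close>)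
    also have "\<dots> = (\<Prod>i<k. ?A $$ (i, i))"
      by (simp add: diag_mat_def prod.list_conv_set_nth atLeast0LessThan)
    also have "\<dots> = (\<Prod>i<k. if i = r then 2 else if i = s then inverse 2 else 1 :: complex)"
      using A by (intro prod.cong) (auto simp: l_def)
    also have "\<dots> = 2 ^ card {i\<in>{..<k}. i = r} * inverse 2 ^ card {i\<in>{..<k}. i = s}"
      using False by (intro prod_two_letters) auto
    also have "{i\<in>{..<k}. i = r} = {r}" using rs by auto
    also have "{i\<in>{..<k}. i = s} = {s}" using rs by auto
    finally show ?thesis by simp
  qed
  ultimately have "g l \<in> special_linear scale e k" by (simp add: special_linear_def)
  then have action: "tensor_action scale p q (g l) F (basis_point scale e k p q a b) = F (basis_point scale e k p q a b)"
    using F by (simp add: tensor_invariants_def)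
  have pt: "basis_point scale e k p q a b \<in> points scale p q"
    using dual_basis(1)[OF V B] by (auto simp: basis_point_def points_def)
  have "inj (g l)" by (rule inj_on_inverseI[of _ "g (\<lambda>c. inverse (l c))"]) (rule inv[OF l])
  then have g_inv: "inv_into UNIV (g l) v = g (\<lambda>c. inverse (l c)) v" for v
    using inv[of "\<lambda>c. inverse (l c)" v] l by (intro inv_f_eq) auto
  have 1: "restrict (\<lambda>i. restrict (\<lambda>i. ?d (a i)) {1..p} i \<circ> g l) {1..p} =
      restrict (\<lambda>i v. l (a i) * ?d (a i) v) {1..p}"
    by (intro restrict_ext) (use dg w in \<open>auto simp: fun_eq_iff words_def\<close>)
  have 2: "restrict (\<lambda>j. inv_into UNIV (g l) (restrict (\<lambda>j. e (b j)) {1..q} j)) {1..q} =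
      restrict (\<lambda>j. scale (inverse (l (b j))) (e (b j))) {1..q}"
    unfolding g_inv by (intro restrict_ext) (use ge w in \<open>auto simp: words_def\<close>)
  have "tensor_action scale p q (g l) F (basis_point scale e k p q a b) =
      F (restrict (\<lambda>i v. l (a i) * ?d (a i) v) {1..p}, restrict (\<lambda>j. scale (inverse (l (b j))) (e (b j))) {1..q})"
    using pt unfolding tensor_action_def basis_point_def prod.case 1 2 by (rule if_P)
  also have "\<dots> = (\<Prod>i\<in>{1..p}. l (a i)) * (\<Prod>j\<in>{1..q}. inverse (l (b j))) * F (basis_point scale e k p q a b)"
    by (rule multilinear_scale_all[OF V B FM])
  finally have "(\<Prod>i\<in>{1..p}. l (a i)) * (\<Prod>j\<in>{1..q}. inverse (l (b j))) = 1"
    using nz unfolding action word_form_def by simp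
  then have "(\<Prod>i\<in>{1..p}. l (a i)) = (\<Prod>j\<in>{1..q}. l (b j))"
  proof -
    assume "(\<Prod>i\<in>{1..p}. l (a i)) * (\<Prod>j\<in>{1..q}. inverse (l (b j))) = 1"
    moreover have "(\<Prod>j\<in>{1..q}. inverse (l (b j))) = inverse (\<Prod>j\<in>{1..q}. l (b j))"
      using prod_inversef[of "\<lambda>j. l (b j)" "{1..q}"] by (simp only: comp_def)
    moreover have "(\<Prod>j\<in>{1..q}. l (b j)) \<noteq> 0" using l by simp
    moreover have "x = y" if "x * inverse y = 1" "y \<noteq> 0" for x y :: complex
      using that by (simp add: field_simps)
    ultimately show ?thesis by metis
  qed
  then have "2 ^ card {i\<in>{1..p}. a i = r} * inverse 2 ^ card {i\<in>{1..p}. a i = s} =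
      (2 ^ card {j\<in>{1..q}. b j = r} * inverse 2 ^ card {j\<in>{1..q}. b j = s} :: complex)"
    unfolding l_def by (subst (asm) (1 2) prod_two_letters) (use False in auto)
  then have "(2 :: complex) ^ (card {i\<in>{1..p}. a i = r} + card {j\<in>{1..q}. b j = s}) =
      2 ^ (card {i\<in>{1..p}. a i = s} + card {j\<in>{1..q}. b j = r})"
    by (simp add: power_add power_inverse field_simps)
  then have "(of_nat (2 ^ (card {i\<in>{1..p}. a i = r} + card {j\<in>{1..q}. b j = s})) :: complex) =
      of_nat (2 ^ (card {i\<in>{1..p}. a i = s} + card {j\<in>{1..q}. b j = r}))"
    by (simp only: of_nat_power of_nat_numeral)
  then have "(2 :: nat) ^ (card {i\<in>{1..p}. a i = r} + card {j\<in>{1..q}. b j = s}) =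
      2 ^ (card {i\<in>{1..p}. a i = s} + card {j\<in>{1..q}. b j = r})"
    by (simp only: of_nat_eq_iff)
  then show ?thesis by simp
qed simp

text \<open>
  All letters have the same excess of occurrences in \<open>a\<close> over those in \<open>b\<close>, and the sum of these \<open>k\<close> excesses is \<open>p - q\<close>.
\<close>

lemma invariant_weight:
  fixes scale :: "complex \<Rightarrow> 'v::ab_group_add \<Rightarrow> 'v"
  assumes V: "vector_space scale" and B: "ordered_basis scale e k"
    and F: "F \<in> tensor_invariants scale e k p q"
    and w: "a \<in> words k" "b \<in> words k" and r: "r < k"
    and nz: "word_form scale e k p q F a b \<noteq> 0"
  shows "int p - int q = int k * (int (card {i\<in>{1..p}. a i = r}) - int (card {j\<in>{1..q}. b j = r}))"
proof -
  define \<delta> where "\<delta> s = int (card {i\<in>{1..p}. a i = s}) - int (card {j\<in>{1..q}. b j = s})" for s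
  have same: "\<delta> s = \<delta> r" if "s < k" for s
    using invariant_torus[OF V B F w r that nz] unfolding \<delta>_def by linarith
  have letters: "(\<Sum>s<k. int (card {x\<in>{1..n}. c x = s})) = int n" if "c \<in> words k" for c n
  proof -
    have "(\<Sum>s<k. int (card {x\<in>{1..n}. c x = s})) = (\<Sum>s<k. \<Sum>x\<in>{1..n}. if c x = s then 1 else 0)"
      by (intro sum.cong refl) (simp flip: sum.inter_filter)
    also have "\<dots> = (\<Sum>x\<in>{1..n}. \<Sum>s<k. if c x = s then 1 else 0)" by (rule sum.swap)
    also have "\<dots> = int n" using that by (simp add: words_def)
    finally show ?thesis .
  qed
  have "int p - int q = (\<Sum>s<k. \<delta> s)"
    unfolding \<delta>_def sum_subtractf letters[OF w(1)] letters[OF w(2)] ..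
  also have "\<dots> = int k * \<delta> r" using same by simp
  finally show ?thesis unfolding \<delta>_def .
qed

lemma word_form_sl_invariant:
  fixes scale :: "complex \<Rightarrow> 'v::ab_group_add \<Rightarrow> 'v"
  assumes V: "vector_space scale" and B: "ordered_basis scale e k" and k: "k \<ge> 1"
    and F: "F \<in> tensor_invariants scale e k p q" and m: "int p - int q = int k * m"
  shows "sl_invariant k (of_int m) {1..p} {1..q} (word_form scale e k p q F)"
  unfolding sl_invariant_def
proof (intro conjI ballI allI impI)
  fix a a' b b' :: "nat \<Rightarrow> nat" assume "\<forall>i\<in>{1..p}. a i = a' i" "\<forall>j\<in>{1..q}. b j = b' j"
  then have "basis_point scale e k p q a b = basis_point scale e k p q a' b'"
    unfolding basis_point_def by (intro arg_cong2[of _ _ _ _ Pair] restrict_ext) auto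
  then show "word_form scale e k p q F a b = word_form scale e k p q F a' b'"
    by (simp add: word_form_def)
next
  let ?\<Phi> = "word_form scale e k p q F"
  fix a b r s assume w: "a \<in> words k" "b \<in> words k" and rs: "r < k" "s < k"
  have filter: "(\<Sum>x\<in>{1..n}. if c x = t then h x else 0) = (\<Sum>x\<in>{x\<in>{1..n}. c x = t}. h x)"
    for c t and h :: "nat \<Rightarrow> complex" and n :: nat
    by (rule sum.inter_filter[symmetric]) simp
  show "(\<Sum>i\<in>{1..p}. if a i = r then ?\<Phi> (a(i := s)) b else 0) -
      (\<Sum>j\<in>{1..q}. if b j = s then ?\<Phi> a (b(j := r)) else 0) = (if r = s then of_int m * ?\<Phi> a b else 0)"
  proof (cases "r = s")
    case False
    then show ?thesis
      unfolding filter using invariant_unipotent[OF V B F w rs(2,1)] by simp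
  next
    case True
    have 1: "(\<Sum>i\<in>{i\<in>{1..p}. a i = s}. ?\<Phi> (a(i := s)) b) = of_nat (card {i\<in>{1..p}. a i = s}) * ?\<Phi> a b"
    proof -
      have "(\<Sum>i\<in>{i\<in>{1..p}. a i = s}. ?\<Phi> (a(i := s)) b) = (\<Sum>i\<in>{i\<in>{1..p}. a i = s}. ?\<Phi> a b)"
        by (intro sum.cong refl) (metis (mono_tags, lifting) fun_upd_triv mem_Collect_eq)
      then show ?thesis by simp
    qed
    have 2: "(\<Sum>j\<in>{j\<in>{1..q}. b j = s}. ?\<Phi> a (b(j := s))) = of_nat (card {j\<in>{1..q}. b j = s}) * ?\<Phi> a b"
    proof -
      have "(\<Sum>j\<in>{j\<in>{1..q}. b j = s}. ?\<Phi> a (b(j := s))) = (\<Sum>j\<in>{j\<in>{1..q}. b j = s}. ?\<Phi> a b)"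
        by (intro sum.cong refl) (metis (mono_tags, lifting) fun_upd_triv mem_Collect_eq)
      then show ?thesis by simp
    qed
    have "(of_nat (card {i\<in>{1..p}. a i = s}) - of_nat (card {j\<in>{1..q}. b j = s})) * ?\<Phi> a b = of_int m * ?\<Phi> a b"
    proof (cases "?\<Phi> a b = 0")
      case nz: False
      have "int (card {i\<in>{1..p}. a i = s}) - int (card {j\<in>{1..q}. b j = s}) = m"
        using invariant_weight[OF V B F w rs(2) nz] m k by simp
      then have "(of_int (int (card {i\<in>{1..p}. a i = s}) - int (card {j\<in>{1..q}. b j = s})) :: complex) = of_int m"
        by (rule arg_cong)
      then show ?thesis by simp
    qed simp
    then show ?thesis unfolding filter True 1 2 by (simp add: left_diff_distrib)
  qed
qed


section \<open>The basis of the space of invariants\<close>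

lemma multilinear_eq_0_words:
  assumes V: "vector_space scale" and B: "ordered_basis scale e k" and k: "k \<ge> 1"
    and F: "F \<in> multilinear_forms scale p q"
    and 0: "\<And>a b. a \<in> words k \<Longrightarrow> b \<in> words k \<Longrightarrow> word_form scale e k p q F a b = 0"
  shows "F = 0"
proof (rule multilinear_eq_0[OF V B F])
  fix a b assume ab: "a \<in> {1..p} \<rightarrow> {..<k}" "b \<in> {1..q} \<rightarrow> {..<k}"
  define a' where "a' i = (if i \<in> {1..p} then a i else 0)" for i
  define b' where "b' j = (if j \<in> {1..q} then b j else 0)" for j
  have "a' \<in> words k" "b' \<in> words k" using ab k by (auto simp: words_def a'_def b'_def)
  then have "F (basis_point scale e k p q a' b') = 0" using 0 by (simp only: word_form_def)
  moreover have "basis_point scale e k p q a' b' =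
      (restrict (\<lambda>i. dual_basis scale e k (a i)) {1..p}, restrict (\<lambda>j. e (b j)) {1..q})"
    unfolding basis_point_def
    by (intro arg_cong2[of _ _ _ _ Pair] restrict_ext) (simp_all add: a'_def b'_def)
  ultimately show "F (restrict (\<lambda>i. dual_basis scale e k (a i)) {1..p}, restrict (\<lambda>j. e (b j)) {1..q}) = 0"
    by simp
qed

text \<open>
  A multilinear form is determined by its values on words, so a combination of graphs found on words is an identity
  of forms.
\<close>

lemma word_span_imp_span:
  fixes scale :: "complex \<Rightarrow> 'v::ab_group_add \<Rightarrow> 'v"
  assumes V: "vector_space scale" and B: "ordered_basis scale e k" and k: "k \<ge> 1"
    and \<Gamma>: "\<Gamma> \<subseteq> one_regular_sl_graphs k p q" and \<Phi>: "word_span k \<Gamma> \<Phi>"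
    and F: "F \<in> multilinear_forms scale p q"
    and eq: "\<And>a b. a \<in> words k \<Longrightarrow> b \<in> words k \<Longrightarrow> word_form scale e k p q F a b = \<Phi> a b"
  shows "F \<in> module.span form_scale (graph_form scale e k p q ` \<Gamma>)"
proof -
  interpret F: vector_space "form_scale :: complex \<Rightarrow> 'v form \<Rightarrow> 'v form" by (rule form_space)
  note sub = subspace_multilinear_forms[OF V]
  from \<Phi> F eq show ?thesis
  proof (induction arbitrary: F)
    case (zero \<Phi>)
    then have "F = 0" by (intro multilinear_eq_0_words[OF V B k]) auto
    then show ?case using F.span_zero by (simp only:)
  next
    case (step \<Phi> G \<Psi> c)
    let ?g = "graph_form scale e k p q G"
    have G: "G \<in> one_regular_sl_graphs k p q" using step.hyps(2) \<Gamma> by blast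
    have "F - form_scale c ?g \<in> F.span (graph_form scale e k p q ` \<Gamma>)"
    proof (rule step.IH)
      show "F - form_scale c ?g \<in> multilinear_forms scale p q"
        using step.prems(1) graph_form_multilinear[OF V B G] by (intro F.subspace_diff F.subspace_scale sub)
      fix a b assume w: "a \<in> words k" "b \<in> words k"
      show "word_form scale e k p q (F - form_scale c ?g) a b = \<Phi> a b"
        using step.prems(2)[OF w] step.hyps(3)[OF w] graph_form_basis_point[OF V B G w]
        by (simp add: word_form_def form_scale_def)
    qed
    moreover have "form_scale c ?g \<in> F.span (graph_form scale e k p q ` \<Gamma>)"
      using step.hyps(2) by (intro F.span_scale F.span_base) auto
    ultimately have "(F - form_scale c ?g) + form_scale c ?g \<in> F.span (graph_form scale e k p q ` \<Gamma>)"
      by (rule F.span_add)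
    then show ?case by simp
  qed
qed

lemma graph_form_in_invariants:
  assumes "vector_space scale" "ordered_basis scale e k" "G \<in> one_regular_sl_graphs k p q"
  shows "graph_form scale e k p q G \<in> tensor_invariants scale e k p q"
  using assms graph_form_multilinear[OF assms] graph_form_invariant[OF assms]
    tensor_space_eq_multilinear_forms[OF assms(1,2)]
  by (simp add: tensor_invariants_def)

lemma subspace_tensor_invariants:
  fixes scale :: "complex \<Rightarrow> 'v::ab_group_add \<Rightarrow> 'v"
  shows "module.subspace form_scale (tensor_invariants scale e k p q)"
proof -
  interpret F: vector_space "form_scale :: complex \<Rightarrow> 'v form \<Rightarrow> 'v form" by (rule form_space)
  have T: "F.subspace (tensor_space scale p q)" unfolding tensor_space_def by (rule F.subspace_span)
  have zero: "tensor_action scale p q g 0 = 0" for g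
    by (auto simp: tensor_action_def fun_eq_iff)
  have add: "tensor_action scale p q g (F + G) = tensor_action scale p q g F + tensor_action scale p q g G" for g F G
    by (auto simp: tensor_action_def fun_eq_iff)
  have smult: "tensor_action scale p q g (form_scale c F) = form_scale c (tensor_action scale p q g F)" for g c F
    by (auto simp: tensor_action_def form_scale_def fun_eq_iff)
  show ?thesis
    unfolding F.subspace_def tensor_invariants_def
    using F.subspace_0[OF T] F.subspace_add[OF T] F.subspace_scale[OF T] by (simp add: zero add smult)
qed

lemma graph_forms_independent:
  fixes scale :: "complex \<Rightarrow> 'v::ab_group_add \<Rightarrow> 'v"
  assumes V: "vector_space scale" and B: "ordered_basis scale e k" and k: "k \<ge> 1"
    and \<Gamma>: "finite \<Gamma>" "\<Gamma> \<subseteq> one_regular_sl_graphs k p q"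
    and zero: "(\<Sum>G\<in>\<Gamma>. form_scale (c G) (graph_form scale e k p q G)) = 0"
  shows "\<forall>G\<in>\<Gamma>. c G = 0"
proof (rule word_values_independent[OF k \<Gamma>])
  fix a b assume w: "a \<in> words k" "b \<in> words k"
  have apply_sum: "(\<Sum>G\<in>\<Gamma>. h G) z = (\<Sum>G\<in>\<Gamma>. h G z)" for h :: "sl_graph \<Rightarrow> 'v form" and z
    by (induction \<Gamma> rule: infinite_finite_induct) auto
  have "0 = (\<Sum>G\<in>\<Gamma>. form_scale (c G) (graph_form scale e k p q G)) (basis_point scale e k p q a b)"
    by (simp add: zero)
  also have "\<dots> = (\<Sum>G\<in>\<Gamma>. c G * word_value k G a b)"
    unfolding apply_sum form_scale_def using \<Gamma>(2) graph_form_basis_point[OF V B _ w]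
    by (intro sum.cong refl) (simp add: subset_iff)
  finally show "(\<Sum>G\<in>\<Gamma>. c G * word_value k G a b) = 0" by simp
qed

theorem proposition4p2p2:
  fixes scale :: "complex \<Rightarrow> 'v::ab_group_add \<Rightarrow> 'v"
    and e :: "nat \<Rightarrow> 'v"
    and k p q :: nat
  assumes "vector_space scale"
    and "vector_space.dim scale (UNIV :: 'v set) = k"
    and "k \<ge> 1"
    and "ordered_basis scale e k"
  shows "(tensor_invariants scale e k p q \<noteq> {0} \<longleftrightarrow> int k dvd int p - int q) \<and>
    (int k dvd int p - int q \<longrightarrow>
      inj_on (graph_form scale e k p q) (one_regular_sl_graphs k p q) \<and>
      \<not> module.dependent form_scale (graph_form scale e k p q ` one_regular_sl_graphs k p q) \<and>
      module.span form_scale (graph_form scale e k p q ` one_regular_sl_graphs k p q)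
        = tensor_invariants scale e k p q \<and>
      (\<forall>G \<in> one_regular_sl_graphs k p q.
        size (arcs G) = min p q \<and>
        (star_hyperedges G = [] \<or> unstar_hyperedges G = []) \<and>
        real (length (star_hyperedges G) + length (unstar_hyperedges G)) = \<bar>real p - real q\<bar> / real k \<and>
        hyperedge_rule k G \<and>
        one_regular p q G))"
proof -
  note V = assms(1) and k = assms(3) and B = assms(4)
  interpret F: vector_space "form_scale :: complex \<Rightarrow> 'v form \<Rightarrow> 'v form" by (rule form_space)
  let ?std = "one_regular_sl_graphs k p q" and ?f = "graph_form scale e k p q"
    and ?inv = "tensor_invariants scale e k p q"
  have multilinear: "F \<in> multilinear_forms scale p q" if "F \<in> ?inv" for F
    using that tensor_space_eq_multilinear_forms[OF V B] by (simp add: tensor_invariants_def)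
  have inj: "inj_on ?f ?std"
  proof (rule inj_onI, rule ccontr)
    fix G H assume GH: "G \<in> ?std" "H \<in> ?std" "?f G = ?f H" "G \<noteq> H"
    have "(\<Sum>K\<in>{G, H}. form_scale (if K = G then 1 else - 1) (?f K)) = 0"
      using GH by (simp add: form_scale_def fun_eq_iff)
    then have "\<forall>K\<in>{G, H}. (if K = G then 1 else - 1 :: complex) = 0"
      using GH by (intro graph_forms_independent[OF V B k]) auto
    then show False by simp
  qed
  have indep: "F.independent (?f ` ?std)"
  proof
    assume "F.dependent (?f ` ?std)"
    then obtain t u where t: "finite t" "t \<subseteq> ?f ` ?std" "(\<Sum>v\<in>t. form_scale (u v) v) = 0" "\<exists>v\<in>t. u v \<noteq> 0"
      unfolding F.dependent_explicit by blast
    then obtain \<Gamma> where \<Gamma>: "\<Gamma> \<subseteq> ?std" "finite \<Gamma>" "t = ?f ` \<Gamma>"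
      by (meson finite_subset_image)
    have "(\<Sum>G\<in>\<Gamma>. form_scale (u (?f G)) (?f G)) = 0"
      using t(3) unfolding \<Gamma>(3) sum.reindex[OF inj_on_subset[OF inj \<Gamma>(1)]] by (simp add: comp_def)
    then have "\<forall>G\<in>\<Gamma>. u (?f G) = 0" by (rule graph_forms_independent[OF V B k \<Gamma>(2,1)])
    then show False using t(4) \<Gamma>(3) by auto
  qed
  have graphs_inv: "?f ` ?std \<subseteq> ?inv" using graph_form_in_invariants[OF V B] by blast
  have span: "F.span (?f ` ?std) = ?inv" if dvd: "int k dvd int p - int q"
  proof
    show "F.span (?f ` ?std) \<subseteq> ?inv"
      using graphs_inv subspace_tensor_invariants by (rule F.span_minimal)
    obtain m where m: "int p - int q = int k * m" using dvd by (elim dvdE)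
    show "?inv \<subseteq> F.span (?f ` ?std)"
    proof
      fix F assume F: "F \<in> ?inv"
      show "F \<in> F.span (?f ` ?std)"
        by (rule word_span_imp_span[OF V B k order.refl
              word_values_span[OF k m word_form_sl_invariant[OF V B k F m]] multilinear[OF F]]) (rule refl)
    qed
  qed
  have nonzero: "?inv \<noteq> {0}" if dvd: "int k dvd int p - int q"
  proof -
    obtain G where G: "G \<in> ?std" using one_regular_sl_graphs_nonempty[OF k dvd] by blast
    then have "?f G \<noteq> 0" using indep F.dependent_zero[of "?f ` ?std"] by (metis image_eqI)
    then show ?thesis using graphs_inv G by blast
  qed
  have "int k dvd int p - int q" if ne: "?inv \<noteq> {0}"
  proof -
    have "0 \<in> ?inv" by (rule F.subspace_0[OF subspace_tensor_invariants])
    then obtain F where F: "F \<in> ?inv" "F \<noteq> 0" using ne by blast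
    then obtain a b where w: "a \<in> words k" "b \<in> words k" and nz: "word_form scale e k p q F a b \<noteq> 0"
      using multilinear_eq_0_words[OF V B k multilinear[OF F(1)]] by blast
    have "0 < k" using k by simp
    from invariant_weight[OF V B F(1) w this nz] show ?thesis by (rule dvdI)
  qed
  moreover have "size (arcs G) = min p q \<and> (star_hyperedges G = [] \<or> unstar_hyperedges G = []) \<and>
      real (length (star_hyperedges G) + length (unstar_hyperedges G)) = \<bar>real p - real q\<bar> / real k \<and>
      hyperedge_rule k G \<and> one_regular p q G" if G: "G \<in> ?std" for G
  proof -
    note counts = one_regular_sl_graph_counts[OF G]
    have "real p - real q = real k * (real (length (star_hyperedges G)) - real (length (unstar_hyperedges G)))"
      using counts(1,2) by (simp flip: counts(1,2) add: algebra_simps)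
    then have "real (length (star_hyperedges G) + length (unstar_hyperedges G)) = \<bar>real p - real q\<bar> / real k"
      using counts(3) k by (auto simp: abs_mult)
    moreover have "size (arcs G) = min p q" using counts by auto
    ultimately show ?thesis
      using counts(3) G by (simp add: one_regular_sl_graphs_def is_sl_graph_def)
  qed
  ultimately show ?thesis using inj indep span nonzero by blast
qed

end
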